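(* Let $p>2$, $\Omega\subset\mathbb{R}^n$ bounded open, $T>0$, and let $u_i$, $i=1,2,\dots$, be weak supersolutions of $\partial_tu-\Delta_pu=0$ in $\Omega_T=\Omega\times(0,T)$ such that $|u_i|\le M<\infty$ for every $i$. Then there exist a subsequence, still denoted $(u_i)$, and a function $u$ such that $u_i\to u$ and $\nabla u_i\to\nabla u$ pointwise almost everywhere in $\Omega_T$ as $i\to\infty$; moreover, $u$ is a weak supersolution of $\partial_tu-\Delta_pu=0$ in $\Omega_T$.
   Context: $\Delta_p u=\operatorname{div}(|\nabla u|^{p-2}\nabla u)$. A function $u\in L^p_{loc}(0,T;W^{1,p}_{loc}(\Omega))$ (i.e. $u\in L^p(t_1,t_2;W^{1,p}(\Omega'))$ for every $\Omega'\times(t_1,t_2)\Subset\Omega_T$) is a weak supersolution of $\partial_tu-\Delta_pu=0$ in $\Omega_T$ if $-\int_{\Omega_T}u\,\partial_t\varphi\,dx\,dt+\int_{\Omega_T}|\nabla u|^{p-2}\nabla u\cdot\nabla\varphi\,dx\,dt\ge0$ for all nonnegative $\varphi\in C_0^\infty(\Omega_T)$. *)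

theory Defs
  imports "HOL-Analysis.Analysis"
begin

fun C_k :: "nat \<Rightarrow> ('a::real_normed_vector \<Rightarrow> real) \<Rightarrow> bool" where
  "C_k 0 f = continuous_on UNIV f"
| "C_k (Suc k) f = ((\<forall>z. f differentiable at z) \<and>
      (\<forall>v. C_k k (\<lambda>z. frechet_derivative f (at z) v)))"

definition smooth :: "('a::real_normed_vector \<Rightarrow> real) \<Rightarrow> bool" where
  "smooth f \<longleftrightarrow> (\<forall>k. C_k k f)"

definition cyl :: "(real^'n) set \<Rightarrow> real \<Rightarrow> ((real^'n) \<times> real) set" where
  "cyl \<Omega> T = \<Omega> \<times> {0<..<T}"

definition test_fun :: "('a::euclidean_space) set \<Rightarrow> ('a \<Rightarrow> real) \<Rightarrow> bool" where
  "test_fun D \<phi> \<longleftrightarrow> smooth \<phi> \<and> compact (closure {z. \<phi> z \<noteq> 0})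
      \<and> closure {z. \<phi> z \<noteq> 0} \<subseteq> D"

definition dt :: "((real^'n) \<times> real \<Rightarrow> real) \<Rightarrow> (real^'n) \<times> real \<Rightarrow> real" where
  "dt \<phi> z = frechet_derivative \<phi> (at z) (0, 1)"

definition gradx :: "((real^'n) \<times> real \<Rightarrow> real) \<Rightarrow> (real^'n) \<times> real \<Rightarrow> real^'n" where
  "gradx \<phi> z = (\<chi> k. frechet_derivative \<phi> (at z) (axis k 1, 0))"

text \<open>u in L^p_loc(0,T; W^{1,p}_loc(Omega)) with spatial weak gradient Du:
  u, Du measurable on Omega_T, Du is the weak spatial gradient of u in Omega_T, and
  u, Du are in L^p(Omega' x (t1,t2)) whenever Omega' x (t1,t2) is compactly contained in Omega_T.\<close>
definition loc_parabolic_sobolev ::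
  "real \<Rightarrow> (real^'n) set \<Rightarrow> real \<Rightarrow> ((real^'n) \<times> real \<Rightarrow> real)
     \<Rightarrow> ((real^'n) \<times> real \<Rightarrow> real^'n) \<Rightarrow> bool" where
  "loc_parabolic_sobolev p \<Omega> T u Du \<longleftrightarrow>
     set_borel_measurable lebesgue (cyl \<Omega> T) u \<and>
     set_borel_measurable lebesgue (cyl \<Omega> T) Du \<and>
     (\<forall>\<Omega>' t1 t2. open \<Omega>' \<and> compact (closure \<Omega>') \<and> closure \<Omega>' \<subseteq> \<Omega> \<and>
         0 < t1 \<and> t1 < t2 \<and> t2 < T \<longrightarrow>
         set_integrable lebesgue (\<Omega>' \<times> {t1<..<t2}) (\<lambda>z. \<bar>u z\<bar> powr p) \<and>
         set_integrable lebesgue (\<Omega>' \<times> {t1<..<t2}) (\<lambda>z. norm (Du z) powr p)) \<and>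
     (\<forall>\<phi> k. test_fun (cyl \<Omega> T) \<phi> \<longrightarrow>
         (LINT z:cyl \<Omega> T|lebesgue. u z * gradx \<phi> z $ k)
           = - (LINT z:cyl \<Omega> T|lebesgue. Du z $ k * \<phi> z))"

definition weak_supersol ::
  "real \<Rightarrow> (real^'n) set \<Rightarrow> real \<Rightarrow> ((real^'n) \<times> real \<Rightarrow> real)
     \<Rightarrow> ((real^'n) \<times> real \<Rightarrow> real^'n) \<Rightarrow> bool" where
  "weak_supersol p \<Omega> T u Du \<longleftrightarrow>
     loc_parabolic_sobolev p \<Omega> T u Du \<and>
     (\<forall>\<phi>. test_fun (cyl \<Omega> T) \<phi> \<and> (\<forall>z. 0 \<le> \<phi> z) \<longrightarrow>
        - (LINT z:cyl \<Omega> T|lebesgue. u z * dt \<phi> z)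
        + (LINT z:cyl \<Omega> T|lebesgue. norm (Du z) powr (p - 2) * (Du z \<bullet> gradx \<phi> z)) \<ge> 0)"

end

theory Submission
  imports Defs "HOL-Library.Diagonal_Subsequence" "HOL-Complex_Analysis.Great_Picard"
begin

text \<open>
  Mollify a supersolution \<open>u\<close> in space and time. Then \<open>\<partial>\<^sub>t u\<^sub>\<epsilon> - div A\<^sub>\<epsilon> \<ge> 0\<close> holds pointwise,
  with \<open>A = |Du| powr (p - 2) Du\<close>, so smooth functions of \<open>u\<^sub>\<epsilon>\<close> are admissible test functions,
  and \<open>\<epsilon>\<close> tends to 0 at the end of each estimate.

  For two supersolutions \<open>u, v\<close>, test with \<open>\<zeta> (\<kappa> - T (u - v))\<close> and \<open>\<zeta> (\<kappa> + T (u - v))\<close>, where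
  \<open>|T| \<le> \<kappa>\<close>, and add. This bounds the integral of \<open>\<zeta> T' (u - v) (A\<^sub>u - A\<^sub>v) \<bullet> (Du - Dv)\<close>
  by a constant times \<open>\<kappa>\<close>. With \<open>v = 0\<close> and \<open>T = id\<close> this is the Caccioppoli inequality; with
  \<open>T s = \<delta> arctan (s / \<delta>)\<close> it shows that \<open>Du - Dv\<close> is small in \<open>L\<^sup>p\<close> on the set
  where \<open>|u - v| \<le> \<delta>\<close>. Convergence in measure of the functions thus forces that of the gradients.

  Compactness of the functions comes from testing with \<open>\<zeta> (u (z + h) - u z)\<close>: space-time
  translates satisfy a bound of order \<open>|h|\<close> in \<open>L\<^sup>2\<close>, uniformly over the sequence. A diagonal
  argument over a countable cover by balls gives almost everywhere convergence, and the
  local \<open>L\<^sup>p\<close> bounds of the gradients pass the equation to the limit.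
\<close>

section \<open>A smooth bump function\<close>

text \<open>A supersolution satisfies only an inequality: the defect \<open>u_t - div A\<close> is a
  nonnegative measure of which nothing but the sign is known. Two supersolutions can therefore not
  simply be subtracted, since the defect of \<open>u - v\<close> has no sign. The level \<kappa>
  added to the test functions restores the sign of each defect, at the price of their local mass
  times \<kappa>; a truncation with small \<kappa> thus yields smallness, while \<kappa> of the size
  of the bound yields only boundedness. The sign also controls that mass: tested with a cutoff
  alone, the equation for the defect bounds its integral by integrals of the function and of the
  flux. In the translation estimate this replaces a bound on the time derivative, which is written
  as the defect plus a divergence, and the divergence is moved to the test function. All bounds are
  uniform in \<epsilon> because they involve only the energy of the function before mollification.
  Convergence of the gradients almost everywhere is what identifies the limit of the flux, through
  which weak convergence would not pass.\<close>

lemma C_k_SucD: "C_k (Suc k) f \<Longrightarrow> C_k k f"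
proof (induction k arbitrary: f)
  case 0
  then show ?case
    by (auto intro!: differentiable_imp_continuous_on simp: differentiable_on_def
        intro: differentiable_at_withinI)
qed auto

text \<open>Uniqueness of the derivative lets an explicit formula \<open>D\<close> replace
  \<open>frechet_derivative\<close>, so that smoothness is proved by computing derivatives by
  hand.\<close>

lemma C_k_SucI:
  assumes "\<And>z. (f has_derivative D z) (at z)" "\<And>v. C_k k (\<lambda>z. D z v)"
  shows "C_k (Suc k) f"
proof -
  have "frechet_derivative f (at z) = D z" for z
    using frechet_derivative_at[OF assms(1)] by simp
  then show ?thesis
    using assms by (auto simp: differentiable_def)
qed

lemma C_k_const: "C_k k (\<lambda>_. c)"
proof (induction k arbitrary: c)
  case (Suc k)
  show ?case by (rule C_k_SucI[where D="\<lambda>_ _. 0"]) (auto intro: Suc)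
qed auto

lemma C_k_has_derivative:
  "C_k (Suc k) f \<Longrightarrow> (f has_derivative frechet_derivative f (at z)) (at z)"
  by (simp add: frechet_derivative_works[symmetric])

lemma C_k_add: "C_k k f \<Longrightarrow> C_k k g \<Longrightarrow> C_k k (\<lambda>z. f z + g z)"
proof (induction k arbitrary: f g)
  case 0 then show ?case by (auto intro: continuous_intros)
next
  case (Suc k)
  show ?case
    by (rule C_k_SucI[OF has_derivative_add[OF C_k_has_derivative[OF Suc(2)] C_k_has_derivative[OF Suc(3)]]])
      (use Suc in auto)
qed

text \<open>The undifferentiated factors of the product rule enter at order \<open>k\<close>;
  \<open>C_k_SucD\<close> lowers them to it.\<close>

lemma C_k_mult: "C_k k f \<Longrightarrow> C_k k g \<Longrightarrow> C_k k (\<lambda>z. f z * g z)"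
proof (induction k arbitrary: f g)
  case 0 then show ?case by (auto intro: continuous_intros)
next
  case (Suc k)
  have "C_k k f" "C_k k g" using Suc.prems C_k_SucD by blast+
  then show ?case
    by (intro C_k_SucI[OF has_derivative_mult[OF C_k_has_derivative[OF Suc(2)] C_k_has_derivative[OF Suc(3)]]]
        C_k_add Suc) (use Suc in auto)
qed

lemma C_k_inner: "C_k k (\<lambda>w::'a::real_inner. (w - z) \<bullet> v)"
proof (cases k)
  case 0 then show ?thesis by (auto intro!: continuous_intros)
next
  case (Suc k)
  show ?thesis unfolding Suc
    by (rule C_k_SucI[where D="\<lambda>w h. h \<bullet> v"]) (auto intro!: derivative_eq_intros C_k_const)
qed

text \<open>The powers \<open>x ^ m\<close> in the denominator make this family closed under differentiation.\<close>

definition flat :: "nat \<Rightarrow> real \<Rightarrow> real" where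
  "flat m x = (if x > 0 then exp (- (1 / x)) / x ^ m else 0)"

lemma flat_nonneg: "0 \<le> flat m x" by (simp add: flat_def)

text \<open>Comes from \<open>(1 + t / n) ^ n \<le> exp t\<close> with \<open>t = 1 / x\<close> and
  \<open>n = m + 2\<close>: two powers more than the denominator has, so that two powers of
  \<open>x\<close> are left over.\<close>

lemma flat_bound: assumes "x > 0" shows "flat m x \<le> real (m + 2) ^ (m + 2) * x ^ 2"
proof -
  let ?n = "m + 2"
  have "(1 / x / real ?n) ^ ?n \<le> (1 + 1 / x / real ?n) ^ ?n"
    using assms by (intro power_mono) auto
  also have "\<dots> \<le> exp (1 / x)"
    using assms by (intro exp_ge_one_plus_x_over_n_power_n) (auto intro: order_trans[of _ 0])
  finally have "1 \<le> exp (1/x) * (real ?n ^ ?n * x ^ ?n)"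
    using assms unfolding power_divide by (simp add: field_simps del: power_Suc add_2_eq_Suc')
  then show ?thesis using assms
    by (simp add: flat_def exp_minus field_simps power_add power2_eq_square)
qed

text \<open>At 0 the quadratic bound makes the difference quotient of order \<open>h\<close>;
  elsewhere the function agrees near the point with an elementary one.\<close>

lemma DERIV_flat: "(flat m has_real_derivative - real m * flat (Suc m) x + flat (m + 2) x) (at x)"
proof -
  consider "x > 0" | "x < 0" | "x = 0" by linarith
  then show ?thesis
  proof cases
    case 1
    have "((\<lambda>x. exp (- (1 / x)) / x ^ m) has_real_derivative - real m * flat (Suc m) x + flat (m + 2) x) (at x)"
      using 1 apply (auto intro!: derivative_eq_intros simp: flat_def)
      apply (cases m; simp add: field_simps power_add power2_eq_square)
      done
    then show ?thesis
      by (rule has_field_derivative_transform_within_open[where S="{0<..}"]) (use 1 in \<open>auto simp: flat_def\<close>)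
  next
    case 2
    have "((\<lambda>x. 0) has_real_derivative - real m * flat (Suc m) x + flat (m + 2) x) (at x)"
      using 2 by (auto simp: flat_def)
    then show ?thesis
      by (rule has_field_derivative_transform_within_open[where S="{..<0}"]) (use 2 in \<open>auto simp: flat_def\<close>)
  next
    case 3
    have "(\<lambda>h. (flat m (0 + h) - flat m 0) / h) \<midarrow>0\<rightarrow> 0"
    proof (rule Lim_null_comparison)
      show "eventually (\<lambda>h. norm ((flat m (0 + h) - flat m 0) / h) \<le> real (m + 2) ^ (m + 2) * \<bar>h\<bar>) (at 0)"
      proof (intro always_eventually allI)
        fix h :: real
        show "norm ((flat m (0 + h) - flat m 0) / h) \<le> real (m + 2) ^ (m + 2) * \<bar>h\<bar>"
        proof (cases "h > 0")
          case True
          then show ?thesis using flat_bound[OF True, of m] flat_nonneg[of m h]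
            by (simp add: field_simps power2_eq_square flat_def[of _ 0])
        next
          case False
          then have "flat m (0 + h) - flat m 0 = 0" by (simp add: flat_def)
          then show ?thesis by simp
        qed
      qed
      show "((\<lambda>h. real (m + 2) ^ (m + 2) * \<bar>h\<bar>) \<longlongrightarrow> 0) (at 0)"
        by (auto intro!: tendsto_eq_intros)
    qed
    then show ?thesis unfolding 3 DERIV_def by (simp add: flat_def)
  qed
qed

text \<open>The squared norm keeps the function smooth at the centre, where the norm is not
  differentiable.\<close>

definition bump :: "real \<Rightarrow> 'a::real_inner \<Rightarrow> real" where
  "bump r y = flat 0 (r\<^sup>2 - (norm y)\<^sup>2)"

text \<open>The derivative of \<open>bump\<close> along \<open>e\<close>. Of the two terms in the
  derivative of \<open>flat 0\<close> only \<open>flat 2\<close> survives, since the factor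
  \<open>m\<close> of the other is 0.\<close>

definition dbump :: "real \<Rightarrow> 'a::real_inner \<Rightarrow> 'a \<Rightarrow> real" where
  "dbump r e y = - 2 * (y \<bullet> e) * flat 2 (r\<^sup>2 - (norm y)\<^sup>2)"

lemma flat_bump_has_derivative:
  "((\<lambda>w. flat m (r\<^sup>2 - (norm (z - w))\<^sup>2)) has_derivative
    (\<lambda>h. - 2 * ((w - z) \<bullet> h) * (- real m * flat (Suc m) (r\<^sup>2 - (norm (z - w))\<^sup>2) + flat (m + 2) (r\<^sup>2 - (norm (z - w))\<^sup>2)))) (at w)"
proof -
  have eq: "(norm (z - w))\<^sup>2 = (w - z) \<bullet> (w - z)" for w
    by (simp add: norm_minus_commute[of z] power2_norm_eq_inner)
  have "((\<lambda>w. r\<^sup>2 - (w - z) \<bullet> (w - z)) has_derivative (\<lambda>h. - 2 * ((w - z) \<bullet> h))) (at w)"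
    by (auto intro!: derivative_eq_intros simp: inner_commute algebra_simps)
  from has_derivative_compose[OF this DERIV_flat[of m, unfolded has_field_derivative_def]]
  show ?thesis unfolding eq by (simp add: mult.commute)
qed

lemma C_k_flat_bump: "C_k k (\<lambda>w::'a::real_inner. flat m (r\<^sup>2 - (norm (z - w))\<^sup>2))"
proof (induction k arbitrary: m)
  case 0
  have "continuous (at w) (\<lambda>w::'a. flat m (r\<^sup>2 - (norm (z - w))\<^sup>2))" for w
    by (rule has_derivative_continuous[OF flat_bump_has_derivative])
  then show ?case by (auto simp: continuous_on_eq_continuous_at)
next
  case (Suc k)
  show ?case
    by (rule C_k_SucI[OF flat_bump_has_derivative])
       (intro C_k_mult C_k_add C_k_const C_k_inner Suc)
qed

lemma smooth_bump: "smooth (\<lambda>w::'a::real_inner. bump r (z - w))"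
  unfolding smooth_def bump_def by (auto intro: C_k_flat_bump)

lemma bump_has_derivative: "((\<lambda>w. bump r (z - w)) has_derivative (\<lambda>e. - dbump r e (z - w))) (at w)"
  using flat_bump_has_derivative[of 0 r z w]
  by (simp add: bump_def dbump_def numeral_2_eq_2[symmetric] inner_diff_left algebra_simps)

lemma bump_DERIV: "((\<lambda>t. bump r (z + t *\<^sub>R e)) has_real_derivative dbump r e z) (at 0)"
proof -
  have "((\<lambda>t. bump r (0 - (- z - t *\<^sub>R e))) has_derivative (\<lambda>t. - dbump r (- t *\<^sub>R e) (0 - (- z - 0 *\<^sub>R e)))) (at 0)"
    by (rule has_derivative_compose[OF _ bump_has_derivative]) (auto intro!: derivative_eq_intros)
  then show ?thesis
    unfolding has_field_derivative_def
    by (rule has_derivative_eq_rhs[OF has_derivative_transform[rotated 2]]) (auto simp: dbump_def fun_eq_iff add.commute)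
qed

lemma bump_nonneg: "0 \<le> bump r y" and bump_pos: "norm y < r \<Longrightarrow> 0 < bump r y"
  and bump_zero: "0 < r \<Longrightarrow> norm y \<ge> r \<Longrightarrow> bump r y = 0" and dbump_zero: "0 < r \<Longrightarrow> norm y \<ge> r \<Longrightarrow> dbump r e y = 0"
proof -
  show "0 \<le> bump r y" by (simp add: bump_def flat_nonneg)
  show "0 < bump r y" if "norm y < r"
    using power_strict_mono[OF that, of 2] by (simp add: bump_def flat_def)
  assume "0 < r" "norm y \<ge> r"
  then have "r\<^sup>2 \<le> (norm y)\<^sup>2" by (intro power_mono) auto
  then show "bump r y = 0" "dbump r e y = 0" by (auto simp: bump_def dbump_def flat_def)
qed

lemma continuous_flat: "isCont (flat m) x"
  by (rule DERIV_isCont[OF DERIV_flat])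

lemma continuous_flat_comp [continuous_intros]:
  "continuous_on A f \<Longrightarrow> continuous_on A (\<lambda>x. flat m (f x))"
  using continuous_on_compose2[of UNIV "flat m" A f]
  by (simp add: continuous_at_imp_continuous_on continuous_flat)

lemma continuous_bump: "continuous_on A (bump r)" and continuous_dbump: "continuous_on A (dbump r e)"
  unfolding bump_def dbump_def by (intro continuous_intros)+

section \<open>Directional derivatives and integration by parts\<close>

lemma integral_shift:
  fixes f :: "'a::euclidean_space \<Rightarrow> 'b::{banach, second_countable_topology}"
  assumes "f \<in> borel_measurable borel"
  shows "(LINT z|lborel. f (z + a)) = (LINT z|lborel. f z)"
proof -
  have "(LINT z|lborel. f z) = (LINT z|distr lborel borel ((+) a). f z)"
    by (simp add: lborel_distr_plus)
  also have "\<dots> = (LINT z|lborel. f (a + z))"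
    by (rule integral_distr) (use assms in auto)
  finally show ?thesis by (simp add: add.commute)
qed

lemma integrable_shift:
  fixes f :: "'a::euclidean_space \<Rightarrow> 'b::{banach, second_countable_topology}"
  assumes "integrable lborel f"
  shows "integrable lborel (\<lambda>z. f (z + a))"
proof -
  have "integrable (distr lborel borel ((+) a)) f"
    using assms by (simp add: lborel_distr_plus)
  then have "integrable lborel (\<lambda>z. f (a + z))"
    by (subst (asm) integrable_distr_eq) (use assms in \<open>auto dest: borel_measurable_integrable\<close>)
  then show ?thesis by (simp add: add.commute)
qed

lemma nn_integral_shift:
  fixes f :: "'a::euclidean_space \<Rightarrow> ennreal"
  assumes "f \<in> borel_measurable borel"
  shows "(\<integral>\<^sup>+ z. f (z + a) \<partial>lborel) = (\<integral>\<^sup>+ z. f z \<partial>lborel)"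
proof -
  have "(\<integral>\<^sup>+ z. f z \<partial>lborel) = (\<integral>\<^sup>+ z. f z \<partial>distr lborel borel ((+) a))"
    by (simp add: lborel_distr_plus)
  also have "\<dots> = (\<integral>\<^sup>+ z. f (a + z) \<partial>lborel)"
    by (rule nn_integral_distr) (use assms in auto)
  finally show ?thesis by (simp add: add.commute)
qed

lemma AE_shift:
  fixes P :: "'a::euclidean_space \<Rightarrow> bool"
  assumes "AE z in lborel. P z"
  shows "AE z in lborel. P (z + a)"
proof -
  have "AE z in distr lborel borel ((+) a). P z"
    unfolding lborel_distr_plus by (rule assms)
  from AE_distrD[OF _ this] show ?thesis by (simp add: add.commute)
qed

section \<open>Bounded measurable functions and their directional derivatives\<close>

definition bdd_meas :: "('a::euclidean_space \<Rightarrow> real) \<Rightarrow> bool" where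
  "bdd_meas f \<longleftrightarrow> f \<in> borel_measurable borel \<and> (\<exists>C. \<forall>z. \<bar>f z\<bar> \<le> C)"

text \<open>Only derivatives along lines are required; \<open>f' e\<close> is the derivative in direction \<open>e\<close>.\<close>

definition C1_bdd :: "('a::euclidean_space \<Rightarrow> real) \<Rightarrow> ('a \<Rightarrow> 'a \<Rightarrow> real) \<Rightarrow> bool" where
  "C1_bdd f f' \<longleftrightarrow> bdd_meas f \<and> (\<forall>e. bdd_meas (f' e) \<and>
     (\<forall>z. ((\<lambda>t. f (z + t *\<^sub>R e)) has_real_derivative f' e z) (at 0)))"

text \<open>Here \<open>S\<close> is a set containing the support, usually a closed ball, and not
  the support itself.\<close>

definition supp_in :: "('a::euclidean_space \<Rightarrow> real) \<Rightarrow> 'a set \<Rightarrow> bool" where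
  "supp_in f S \<longleftrightarrow> (\<forall>z. z \<notin> S \<longrightarrow> f z = 0)"

lemma supp_inD: "supp_in f S \<Longrightarrow> z \<notin> S \<Longrightarrow> f z = 0"
  by (simp add: supp_in_def del: split_paired_All)

lemma bdd_measD [measurable_dest]: "bdd_meas f \<Longrightarrow> f \<in> borel_measurable borel"
  by (simp add: bdd_meas_def)

lemma bdd_meas_bound: "bdd_meas f \<Longrightarrow> \<exists>C\<ge>0. \<forall>z. \<bar>f z\<bar> \<le> C"
  by (auto simp: bdd_meas_def) (meson abs_ge_zero order_trans)

lemma bdd_measI: "f \<in> borel_measurable borel \<Longrightarrow> (\<And>z. \<bar>f z\<bar> \<le> C) \<Longrightarrow> bdd_meas f"
  by (auto simp: bdd_meas_def)

lemma bdd_meas_const: "bdd_meas (\<lambda>_. c)"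
  by (rule bdd_measI[where C="\<bar>c\<bar>"]) auto

lemma bdd_meas_add: assumes "bdd_meas f" "bdd_meas g" shows "bdd_meas (\<lambda>z. f z + g z)"
proof -
  obtain C D where "\<And>z. \<bar>f z\<bar> \<le> C" "\<And>z. \<bar>g z\<bar> \<le> D"
    using assms[THEN bdd_meas_bound] by blast
  then have "\<bar>f z + g z\<bar> \<le> C + D" for z by (meson abs_triangle_ineq add_mono order_trans)
  then show ?thesis using assms by (intro bdd_measI) auto
qed

lemma bdd_meas_mult: assumes "bdd_meas f" "bdd_meas g" shows "bdd_meas (\<lambda>z. f z * g z)"
proof -
  obtain C D where C: "C \<ge> 0" "\<And>z. \<bar>f z\<bar> \<le> C" and D: "\<And>z. \<bar>g z\<bar> \<le> D"
    using assms[THEN bdd_meas_bound] by blast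
  then have "\<bar>f z * g z\<bar> \<le> C * D" for z by (auto simp: abs_mult intro!: mult_mono)
  then show ?thesis using assms by (intro bdd_measI) auto
qed

lemma bdd_meas_minus: "bdd_meas f \<Longrightarrow> bdd_meas (\<lambda>z. - f z)"
  using bdd_meas_mult[OF bdd_meas_const[of "-1"]] by simp

lemma bdd_meas_diff: "bdd_meas f \<Longrightarrow> bdd_meas g \<Longrightarrow> bdd_meas (\<lambda>z. f z - g z)"
  using bdd_meas_add[OF _ bdd_meas_minus] by fastforce

lemma bdd_meas_abs: "bdd_meas f \<Longrightarrow> bdd_meas (\<lambda>z. \<bar>f z\<bar>)"
  by (auto simp: bdd_meas_def)

lemma bdd_meas_sum: "(\<And>k. k \<in> K \<Longrightarrow> bdd_meas (f k)) \<Longrightarrow> bdd_meas (\<lambda>z. \<Sum>k\<in>K. f k z)"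
  by (induction K rule: infinite_finite_induct) (auto intro: bdd_meas_const bdd_meas_add)

lemma bdd_meas_shift: "bdd_meas f \<Longrightarrow> bdd_meas (\<lambda>z. f (z + a))"
  by (auto simp: bdd_meas_def)

text \<open>\<open>T\<close> may be unbounded; \<open>f\<close> takes its values in a compact
  interval, on which \<open>T\<close> is bounded.\<close>

lemma bdd_meas_comp:
  assumes "bdd_meas f" "continuous_on UNIV T"
  shows "bdd_meas (\<lambda>z. T (f z))"
proof -
  obtain C where C: "\<And>z. \<bar>f z\<bar> \<le> C" using bdd_meas_bound[OF assms(1)] by blast
  have "compact (T ` {-C..C})"
    using assms(2) by (intro compact_continuous_image) (auto intro: continuous_on_subset)
  then obtain D where "\<And>x. x \<in> T ` {-C..C} \<Longrightarrow> norm x \<le> D"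
    using compact_imp_bounded bounded_iff by metis
  then have "\<bar>T (f z)\<bar> \<le> D" for z using C[of z] by (auto simp: abs_le_iff)
  moreover have "T \<in> borel_measurable borel"
    using assms(2) by (rule borel_measurable_continuous_onI)
  ultimately show ?thesis using assms(1) by (intro bdd_measI) auto
qed

lemmas bdd_meas_intros = bdd_meas_const bdd_meas_add bdd_meas_mult bdd_meas_minus bdd_meas_diff
  bdd_meas_abs bdd_meas_sum bdd_meas_shift

lemma integrable_indicator_cball: "integrable lborel (indicat_real (cball (c::'a::euclidean_space) R))"
  using emeasure_bounded_finite[OF bounded_cball, of c R]
  by (intro integrable_real_indicator) auto

lemma integrable_bdd_meas_supp:
  assumes "bdd_meas f" "supp_in f S" "bounded S"
  shows "integrable lborel f"
proof -
  obtain C where C: "\<And>z. \<bar>f z\<bar> \<le> C" using bdd_meas_bound[OF assms(1)] by blast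
  obtain R where R: "S \<subseteq> cball 0 R" using assms(3)[unfolded bounded_iff] by force
  have "integrable lborel (\<lambda>z. C * indicat_real (cball 0 R) z)"
    by (intro integrable_mult_right integrable_indicator_cball)
  then show ?thesis
  proof (rule Bochner_Integration.integrable_bound)
    have "\<bar>f z\<bar> \<le> \<bar>C * indicat_real (cball 0 R) z\<bar>" for z
    proof (cases "z \<in> cball 0 R")
      case True
      then show ?thesis using C[of z] by (auto simp: indicator_def)
    next
      case False
      then have "f z = 0" using R assms(2) by (auto simp: supp_in_def)
      then show ?thesis by simp
    qed
    then show "AE z in lborel. norm (f z) \<le> norm (C * indicat_real (cball 0 R) z)"
      by simp
  qed (use assms in auto)
qed

lemma integrable_bdd_meas_mult:
  assumes "bdd_meas f" "integrable lborel g"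
  shows "integrable lborel (\<lambda>z. f z * g z)"
proof -
  obtain C where C: "C \<ge> 0" "\<And>z. \<bar>f z\<bar> \<le> C" using bdd_meas_bound[OF assms(1)] by blast
  have [measurable]: "g \<in> borel_measurable borel"
    using assms(2) borel_measurable_integrable by fastforce
  show ?thesis
    by (rule Bochner_Integration.integrable_bound[of _ "\<lambda>z. C * g z"])
      (use assms C in \<open>auto simp: abs_mult intro!: AE_I2 mult_right_mono\<close>)
qed

lemma C1_bdd_D:
  assumes "C1_bdd f f'"
  shows "bdd_meas f" "bdd_meas (f' e)"
    "((\<lambda>t. f (z + t *\<^sub>R e)) has_real_derivative f' e (z + s *\<^sub>R e)) (at s)"
proof -
  show "bdd_meas f" "bdd_meas (f' e)" using assms by (auto simp: C1_bdd_def)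
  have "((\<lambda>t. f ((z + s *\<^sub>R e) + t *\<^sub>R e)) has_real_derivative f' e (z + s *\<^sub>R e)) (at 0)"
    using assms by (auto simp: C1_bdd_def)
  then show "((\<lambda>t. f (z + t *\<^sub>R e)) has_real_derivative f' e (z + s *\<^sub>R e)) (at s)"
    using DERIV_at_within_shift[of "\<lambda>t. f (z + t *\<^sub>R e)" "f' e (z + s *\<^sub>R e)" s 0 UNIV]
    by (simp add: algebra_simps)
qed

lemma C1_bdd_const: "C1_bdd (\<lambda>_. c) (\<lambda>_ _. 0)"
  by (auto simp: C1_bdd_def intro: bdd_meas_const)

lemma C1_bdd_add: "C1_bdd f f' \<Longrightarrow> C1_bdd g g' \<Longrightarrow> C1_bdd (\<lambda>z. f z + g z) (\<lambda>e z. f' e z + g' e z)"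
  by (auto simp: C1_bdd_def intro!: bdd_meas_intros DERIV_add)

lemma C1_bdd_diff: "C1_bdd f f' \<Longrightarrow> C1_bdd g g' \<Longrightarrow> C1_bdd (\<lambda>z. f z - g z) (\<lambda>e z. f' e z - g' e z)"
  by (auto simp: C1_bdd_def intro!: bdd_meas_intros DERIV_diff)

lemma C1_bdd_mult:
  assumes "C1_bdd f f'" "C1_bdd g g'"
  shows "C1_bdd (\<lambda>z. f z * g z) (\<lambda>e z. f' e z * g z + f z * g' e z)"
proof -
  have "((\<lambda>t. f (z + t *\<^sub>R e) * g (z + t *\<^sub>R e)) has_real_derivative f' e z * g z + f z * g' e z) (at 0)" for e z
    using DERIV_mult[of "\<lambda>t. f (z + t *\<^sub>R e)" "f' e z" 0 UNIV "\<lambda>t. g (z + t *\<^sub>R e)" "g' e z"] assms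
    by (auto simp: C1_bdd_def mult.commute)
  then show ?thesis using assms
    by (auto simp: C1_bdd_def intro!: bdd_meas_intros)
qed

lemma C1_bdd_shift:
  assumes "C1_bdd f f'" shows "C1_bdd (\<lambda>z. f (z + a)) (\<lambda>e z. f' e (z + a))"
proof -
  have "z + t *\<^sub>R e + a = (z + a) + t *\<^sub>R e" for z e t by simp
  then show ?thesis
    using assms by (simp only: C1_bdd_def bdd_meas_shift) auto
qed

lemma C1_bdd_comp:
  assumes "C1_bdd f f'" "\<And>x. (T has_real_derivative \<tau> x) (at x)" "continuous_on UNIV \<tau>"
  shows "C1_bdd (\<lambda>z. T (f z)) (\<lambda>e z. \<tau> (f z) * f' e z)"
proof -
  have "continuous_on UNIV T" 
    by (intro continuous_at_imp_continuous_on ballI DERIV_isCont[OF assms(2)])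
  moreover have "((\<lambda>t. T (f (z + t *\<^sub>R e))) has_real_derivative \<tau> (f z) * f' e z) (at 0)" for e z
  proof -
    have "((\<lambda>t. f (z + t *\<^sub>R e)) has_real_derivative f' e z) (at 0)"
      using assms(1) by (simp add: C1_bdd_def)
    from DERIV_chain2[where f=T, OF _ this] show ?thesis using assms(2)[of "f z"] by simp
  qed
  ultimately show ?thesis using assms
    unfolding C1_bdd_def
    by (intro conjI allI bdd_meas_mult bdd_meas_comp[of f T] bdd_meas_comp[of f \<tau>]) auto
qed

lemma C1_bdd_line_bound:
  assumes "C1_bdd f f'" "\<And>z. \<bar>f' e z\<bar> \<le> C"
  shows "\<bar>f (z + t *\<^sub>R e) - f z\<bar> \<le> C * \<bar>t\<bar>"
proof -
  have "norm ((\<lambda>t. f (z + t *\<^sub>R e)) t - (\<lambda>t. f (z + t *\<^sub>R e)) 0) \<le> C * norm (t - 0)"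
    by (rule field_differentiable_bound[of UNIV _ "\<lambda>s. f' e (z + s *\<^sub>R e)"])
      (use assms(2) in \<open>auto intro: C1_bdd_D(3)[OF assms(1)]\<close>)
  then show ?thesis by simp
qed

text \<open>Off a closed \<open>S\<close> the function vanishes on a short segment of every line
  through the point.\<close>

lemma C1_bdd_supp_deriv:
  assumes "C1_bdd f f'" "supp_in f S" "closed S"
  shows "supp_in (f' e) S"
  unfolding supp_in_def
proof (intro allI impI)
  fix z assume "z \<notin> S"
  have "((\<lambda>t. f (z + t *\<^sub>R e)) has_real_derivative f' e z) (at 0)"
    using C1_bdd_D(3)[OF assms(1), of z e 0] by simp
  moreover have "((\<lambda>t. f (z + t *\<^sub>R e)) has_real_derivative 0) (at 0)"
  proof (rule has_field_derivative_transform_within_open[of "\<lambda>_. 0"])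
    show "open ((\<lambda>t. z + t *\<^sub>R e) -` (- S))"
      using assms(3) by (intro open_vimage) (auto intro!: continuous_intros)
  qed (use \<open>z \<notin> S\<close> assms(2) in \<open>auto simp: supp_in_def\<close>)
  ultimately show "f' e z = 0" by (rule DERIV_unique)
qed

lemma tendsto_difference_quotient_seq:
  assumes "(f has_real_derivative D) (at 0)"
  shows "(\<lambda>n. (f (1 / real (Suc n)) - f 0) * real (Suc n)) \<longlonglongrightarrow> D"
proof -
  have "filterlim (\<lambda>n. 1 / real (Suc n)) (at 0) sequentially"
    using LIMSEQ_inverse_real_of_nat by (auto simp: filterlim_at inverse_eq_divide)
  from filterlim_compose[OF assms[unfolded DERIV_def] this] show ?thesis by simp
qed

text \<open>Difference quotients have integral 0 by translation invariance and converge to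
  \<open>f' e\<close>. The mean value bound supplies the majorant, supported in a ball enlarged by
  \<open>norm e\<close>, the length of the largest shift in use.\<close>

lemma integral_derivative_eq_0:
  assumes f: "C1_bdd f f'" and S: "supp_in f S" "bounded S"
  shows "(LINT z|lborel. f' e z) = 0"
proof -
  obtain R where R: "S \<subseteq> cball 0 R" using S(2)[unfolded bounded_iff] by force
  obtain C where C: "C \<ge> 0" "\<And>z. \<bar>f' e z\<bar> \<le> C" using bdd_meas_bound[OF C1_bdd_D(2)[OF f]] by blast
  note [measurable] = bdd_measD[OF C1_bdd_D(1)[OF f]] bdd_measD[OF C1_bdd_D(2)[OF f, of e]]
  define s where "s n z = (f (z + (1 / real (Suc n)) *\<^sub>R e) - f z) * real (Suc n)" for n z
  have [measurable]: "s n \<in> borel_measurable borel" for n unfolding s_def by measurable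
  have intf: "integrable lborel f"
    using integrable_bdd_meas_supp[OF C1_bdd_D(1)[OF f] S] .
  have "(\<lambda>n. LINT z|lborel. s n z) \<longlonglongrightarrow> (LINT z|lborel. f' e z)"
  proof (rule integral_dominated_convergence[where w="\<lambda>z. C * indicat_real (cball 0 (R + norm e)) z"])
    show "integrable lborel (\<lambda>z. C * indicat_real (cball 0 (R + norm e)) z)"
      by (intro integrable_mult_right integrable_indicator_cball)
    have "(\<lambda>n. s n z) \<longlonglongrightarrow> f' e z" for z
      unfolding s_def
      using tendsto_difference_quotient_seq[OF C1_bdd_D(3)[OF f, of z e 0, simplified]] by simp
    then show "AE z in lborel. (\<lambda>n. s n z) \<longlonglongrightarrow> f' e z" by simp
    fix n
    have "\<bar>s n z\<bar> \<le> C * indicat_real (cball 0 (R + norm e)) z" for z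
    proof (cases "z \<in> cball 0 (R + norm e)")
      case True
      have "\<bar>s n z\<bar> = \<bar>f (z + (1 / real (Suc n)) *\<^sub>R e) - f z\<bar> * real (Suc n)"
        by (simp add: s_def abs_mult)
      also have "\<dots> \<le> C * \<bar>1 / real (Suc n)\<bar> * real (Suc n)"
        by (intro mult_right_mono C1_bdd_line_bound[OF f]) (use C in auto)
      finally show ?thesis using True by simp
    next
      case False
      have "norm (z + (1 / real (Suc n)) *\<^sub>R e) \<ge> norm z - norm ((1 / real (Suc n)) *\<^sub>R e)"
        by (metis norm_diff_ineq)
      moreover have "norm ((1 / real (Suc n)) *\<^sub>R e) \<le> norm e"
        by (simp add: divide_le_eq mult_le_cancel_left1 distrib_left)
      ultimately have "z + (1 / real (Suc n)) *\<^sub>R e \<notin> S" "z \<notin> S"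
        using False norm_ge_zero[of e] R[THEN subsetD, of z]
          R[THEN subsetD, of "z + (1 / real (Suc n)) *\<^sub>R e"] unfolding mem_cball_0 by linarith+
      then show ?thesis using False S(1) by (simp add: s_def supp_in_def)
    qed
    then show "AE z in lborel. norm (s n z) \<le> C * indicat_real (cball 0 (R + norm e)) z" by simp
  qed auto
  moreover have "(LINT z|lborel. s n z) = 0" for n
  proof -
    have "(LINT z|lborel. s n z) = ((LINT z|lborel. f (z + (1 / real (Suc n)) *\<^sub>R e)) - (LINT z|lborel. f z)) * real (Suc n)"
      unfolding s_def using integrable_shift[OF intf] intf
      by (simp add: Bochner_Integration.integral_diff)
    then show ?thesis by (simp add: integral_shift)
  qed
  ultimately show ?thesis by (simp add: LIMSEQ_const_iff)
qed

text \<open>The derivative of the product has integral 0; the product inherits its support from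
  \<open>f\<close>, so the support of \<open>g\<close> is free.\<close>

lemma integral_by_parts:
  assumes f: "C1_bdd f f'" and g: "C1_bdd g g'" and S: "supp_in f S" "closed S" "bounded S"
  shows "(LINT z|lborel. f z * g' e z) = - (LINT z|lborel. f' e z * g z)"
proof -
  have "(LINT z|lborel. f' e z * g z + f z * g' e z) = 0"
    by (rule integral_derivative_eq_0[OF C1_bdd_mult[OF f g] _ S(3)]) (use S in \<open>auto simp: supp_in_def\<close>)
  moreover have "integrable lborel (\<lambda>z. f' e z * g z)" "integrable lborel (\<lambda>z. f z * g' e z)"
    using C1_bdd_supp_deriv[OF f S(1,2), of e] S(1)
    by (auto intro!: integrable_bdd_meas_supp[OF _ _ S(3)] bdd_meas_mult C1_bdd_D[OF f] C1_bdd_D[OF g]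
        simp: supp_in_def)
  ultimately show ?thesis by simp
qed

text \<open>A finite power instead of a \<open>bump\<close>: its derivative is controlled by the
  power \<open>N - 1\<close> of the same base, and this relation is what allows gradient terms to be
  absorbed.\<close>

definition cutoff :: "'a::real_inner \<Rightarrow> real \<Rightarrow> nat \<Rightarrow> 'a \<Rightarrow> real" where
  "cutoff c r N z = max 0 (r\<^sup>2 - (norm (z - c))\<^sup>2) ^ N"

definition dcutoff :: "'a::real_inner \<Rightarrow> real \<Rightarrow> nat \<Rightarrow> 'a \<Rightarrow> 'a \<Rightarrow> real" where
  "dcutoff c r N e z = - 2 * real N * max 0 (r\<^sup>2 - (norm (z - c))\<^sup>2) ^ (N - 1) * ((z - c) \<bullet> e)"

text \<open>At 0 the difference quotient is at most \<open>\<bar>h\<bar> ^ (N - 1)\<close>, which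
  tends to 0 as \<open>N \<ge> 2\<close>.\<close>

lemma DERIV_max_power:
  assumes "N \<ge> 2"
  shows "((\<lambda>x::real. max 0 x ^ N) has_real_derivative real N * max 0 x ^ (N - 1)) (at x)"
proof -
  consider "x > 0" | "x < 0" | "x = 0" by linarith
  then show ?thesis
  proof cases
    case 1
    have "((\<lambda>x. x ^ N) has_real_derivative real N * max 0 x ^ (N - 1)) (at x)"
      using 1 by (auto intro!: derivative_eq_intros)
    then show ?thesis
      by (rule has_field_derivative_transform_within_open[where S="{0<..}"]) (use 1 in auto)
  next
    case 2
    have "real N * max 0 x ^ (N - 1) = 0" using 2 assms by (simp add: zero_power)
    then have "((\<lambda>x. 0) has_real_derivative real N * max 0 x ^ (N - 1)) (at x)"
      by (simp only: DERIV_const)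
    then show ?thesis
      by (rule has_field_derivative_transform_within_open[where S="{..<0}"]) (use 2 assms in auto)
  next
    case 3
    have "(\<lambda>h::real. (max 0 (0 + h) ^ N - max 0 0 ^ N) / h) \<midarrow>0\<rightarrow> 0"
    proof (rule Lim_null_comparison)
      show "eventually (\<lambda>h::real. norm ((max 0 (0 + h) ^ N - max 0 0 ^ N) / h) \<le> \<bar>h\<bar> ^ (N - 1)) (at 0)"
      proof (intro always_eventually allI)
        fix h :: real
        obtain m where N: "N = Suc (Suc m)" using assms by (metis Suc_le_D numeral_2_eq_2 Suc_le_mono)
        show "norm ((max 0 (0 + h) ^ N - max 0 0 ^ N) / h) \<le> \<bar>h\<bar> ^ (N - 1)"
        proof (cases "h > 0")
          case False
          then have "max 0 (0 + h) ^ N - max 0 0 ^ N = 0" by (simp add: N)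
          then show ?thesis by (simp only:) simp
        qed (simp add: N abs_mult)
      qed
      show "((\<lambda>h::real. \<bar>h\<bar> ^ (N - 1)) \<longlongrightarrow> 0) (at 0)"
        using assms by (auto intro!: tendsto_eq_intros)
    qed
    then show ?thesis unfolding 3 DERIV_def using assms by (simp add: zero_power)
  qed
qed

lemma cutoff_supp: "r > 0 \<Longrightarrow> N > 0 \<Longrightarrow> supp_in (cutoff c r N) (cball c r)"
  by (auto simp: supp_in_def cutoff_def dist_norm norm_minus_commute max_def power_mono not_le)

lemma cutoff_nonneg: "0 \<le> cutoff c r N z"
  by (simp add: cutoff_def)

lemma cutoff_le: "cutoff c r N z \<le> (r\<^sup>2) ^ N"
  by (auto simp: cutoff_def intro!: power_mono)

lemma C1_bdd_cutoff:
  fixes c :: "'a::euclidean_space"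
  assumes N: "N \<ge> 2" and "r > 0"
  shows "C1_bdd (cutoff c r N) (dcutoff c r N)"
  unfolding C1_bdd_def
proof (intro conjI allI)
  have "continuous_on UNIV (cutoff c r N)" unfolding cutoff_def by (intro continuous_intros)
  then show "bdd_meas (cutoff c r N)"
    by (intro bdd_measI[where C="(r\<^sup>2) ^ N"] borel_measurable_continuous_onI)
      (use cutoff_nonneg[of c r N] cutoff_le[of c r N] in auto)
  fix e
  have "continuous_on UNIV (dcutoff c r N e)" unfolding dcutoff_def by (intro continuous_intros)
  moreover have "\<bar>dcutoff c r N e z\<bar> \<le> 2 * real N * (r\<^sup>2) ^ (N - 1) * (r * norm e)" for z
  proof (cases "norm (z - c) \<le> r")
    case True
    have "\<bar>(z - c) \<bullet> e\<bar> \<le> r * norm e"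
      using True by (meson Cauchy_Schwarz_ineq2 mult_right_mono norm_ge_zero order_trans)
    then show ?thesis
      by (auto simp: dcutoff_def abs_mult intro!: mult_mono power_mono)
  next
    case False
    then have "r\<^sup>2 \<le> (norm (z - c))\<^sup>2" using \<open>r > 0\<close> by (intro power_mono) auto
    then have "dcutoff c r N e z = 0" using N by (simp add: dcutoff_def max_absorb1 zero_power)
    then show ?thesis using \<open>r > 0\<close> by simp
  qed
  ultimately show "bdd_meas (dcutoff c r N e)"
    by (intro bdd_measI borel_measurable_continuous_onI)
  fix z
  have "((\<lambda>t. r\<^sup>2 - (norm (z + t *\<^sub>R e - c))\<^sup>2) has_real_derivative - 2 * ((z - c) \<bullet> e)) (at 0)"
  proof -
    have eq: "(norm (z + t *\<^sub>R e - c))\<^sup>2 = (norm (z - c))\<^sup>2 + 2 * t * ((z - c) \<bullet> e) + t\<^sup>2 * (norm e)\<^sup>2" for t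
    proof -
      have "z + t *\<^sub>R e - c = (z - c) + t *\<^sub>R e" by simp
      then show ?thesis
        by (simp only: power2_norm_eq_inner inner_add_left inner_add_right inner_scaleR_left inner_scaleR_right
            inner_commute[of e "z - c"]) (simp add: power2_eq_square distrib_left)
    qed
    show ?thesis unfolding eq by (auto intro!: derivative_eq_intros)
  qed
  from DERIV_chain2[where f="\<lambda>x. max 0 x ^ N", OF DERIV_max_power[OF N] this]
  have "((\<lambda>t. max 0 (r\<^sup>2 - (norm (z + t *\<^sub>R e - c))\<^sup>2) ^ N) has_real_derivative
     real N * max 0 (r\<^sup>2 - (norm (z - c))\<^sup>2) ^ (N - 1) * (- 2 * ((z - c) \<bullet> e))) (at 0)" by simp
  moreover have "real N * max 0 (r\<^sup>2 - (norm (z - c))\<^sup>2) ^ (N - 1) * (- 2 * ((z - c) \<bullet> e)) = dcutoff c r N e z"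
    by (simp add: dcutoff_def)
  ultimately show "((\<lambda>t. cutoff c r N (z + t *\<^sub>R e)) has_real_derivative dcutoff c r N e z) (at 0)"
    unfolding cutoff_def by (simp only:)
qed

section \<open>Convergence tools and mollification\<close>

text \<open>Shifting preserves the integral, so replacing \<open>f\<close> by \<open>s\<close> costs
  the \<open>L^1\<close> distance twice.\<close>

lemma integral_abs_translation_le:
  fixes f s :: "'a::euclidean_space \<Rightarrow> real"
  assumes f: "integrable lborel f" and s: "integrable lborel s"
  shows "(LINT z|lborel. \<bar>f (z + y) - f z\<bar>)
     \<le> 2 * (LINT z|lborel. \<bar>f z - s z\<bar>) + (LINT z|lborel. \<bar>s (z + y) - s z\<bar>)"
proof -
  have [measurable]: "f \<in> borel_measurable borel" "s \<in> borel_measurable borel"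
    using f s by auto
  note [simp] = f s integrable_shift[OF f] integrable_shift[OF s]
  have "(LINT z|lborel. \<bar>f (z + y) - f z\<bar>)
    \<le> (LINT z|lborel. \<bar>f (z + y) - s (z + y)\<bar> + \<bar>f z - s z\<bar> + \<bar>s (z + y) - s z\<bar>)"
    by (intro integral_mono) auto
  also have "\<dots> = (LINT z|lborel. \<bar>f (z + y) - s (z + y)\<bar>) + (LINT z|lborel. \<bar>f z - s z\<bar>)
      + (LINT z|lborel. \<bar>s (z + y) - s z\<bar>)"
    by simp
  also have "(LINT z|lborel. \<bar>f (z + y) - s (z + y)\<bar>) = (LINT z|lborel. \<bar>f z - s z\<bar>)"
    by (rule integral_shift[where f="\<lambda>z. \<bar>f z - s z\<bar>"]) measurable
  finally show ?thesis by simp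
qed

lemma L1_translation_approx:
  fixes f :: "'a::euclidean_space \<Rightarrow> real"
  assumes f: "integrable lborel f"
    and ap: "\<And>e. e > 0 \<Longrightarrow> \<exists>s. integrable lborel s \<and> (LINT z|lborel. \<bar>f z - s z\<bar>) \<le> e \<and>
       ((\<lambda>y. LINT z|lborel. \<bar>s (z + y) - s z\<bar>) \<longlongrightarrow> 0) (at 0)"
  shows "((\<lambda>y. LINT z|lborel. \<bar>f (z + y) - f z\<bar>) \<longlongrightarrow> 0) (at 0)"
proof (rule tendstoI)
  fix e :: real assume "e > 0"
  then obtain s where s: "integrable lborel s" "(LINT z|lborel. \<bar>f z - s z\<bar>) \<le> e / 4"
    "((\<lambda>y. LINT z|lborel. \<bar>s (z + y) - s z\<bar>) \<longlongrightarrow> 0) (at 0)" using ap[of "e/4"] by auto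
  have "\<forall>\<^sub>F y in at 0. dist (LINT z|lborel. \<bar>s (z + y) - s z\<bar>) 0 < e / 2"
    using tendstoD[OF s(3), of "e/2"] \<open>e > 0\<close> by simp
  then show "\<forall>\<^sub>F y in at 0. dist (LINT z|lborel. \<bar>f (z + y) - f z\<bar>) 0 < e"
  proof eventually_elim
    case (elim y)
    have "0 \<le> (LINT z|lborel. \<bar>f (z + y) - f z\<bar>)" by simp
    then show ?case
      using elim integral_abs_translation_le[OF f s(1), of y] s(2) by (simp add: dist_real_def)
  qed
qed

text \<open>For indicators the distance is twice the measure minus twice the overlap. The overlap
  converges because points of an open \<open>U\<close> stay in \<open>U\<close> under small shifts,
  while points outside \<open>U\<close> contribute nothing to it.\<close>

lemma L1_translation_open:
  fixes U :: "'a::euclidean_space set"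
  assumes "open U" "emeasure lborel U < \<infinity>"
  shows "((\<lambda>y. LINT z|lborel. \<bar>indicat_real U (z + y) - indicat_real U z\<bar>) \<longlongrightarrow> 0) (at 0)"
  unfolding tendsto_at_iff_sequentially
proof (intro allI impI)
  fix X :: "nat \<Rightarrow> 'a" assume X: "X \<longlonglongrightarrow> 0"
  have [measurable]: "U \<in> sets borel" using assms(1) by simp
  have int: "integrable lborel (indicat_real U)"
    using assms(2) by (intro integrable_real_indicator) auto
  have int': "integrable lborel (\<lambda>z. indicat_real U (z + y))" for y by (rule integrable_shift[OF int])
  have int2: "integrable lborel (\<lambda>z. indicat_real U (z + y) * indicat_real U z)" for y
    by (rule Bochner_Integration.integrable_bound[OF int]) (auto simp: indicator_def)
  have eq: "(LINT z|lborel. \<bar>indicat_real U (z + y) - indicat_real U z\<bar>)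
     = 2 * (LINT z|lborel. indicat_real U z) - 2 * (LINT z|lborel. indicat_real U (z + y) * indicat_real U z)" for y
  proof -
    have "(LINT z|lborel. \<bar>indicat_real U (z + y) - indicat_real U z\<bar>)
      = (LINT z|lborel. indicat_real U (z + y) + indicat_real U z - 2 * (indicat_real U (z + y) * indicat_real U z))"
      by (rule Bochner_Integration.integral_cong) (auto simp: indicator_def)
    also have "\<dots> = (LINT z|lborel. indicat_real U (z + y)) + (LINT z|lborel. indicat_real U z)
       - 2 * (LINT z|lborel. indicat_real U (z + y) * indicat_real U z)"
      using int int' int2 by (simp del: Bochner_Integration.integral_indicator)
    also have "(LINT z|lborel. indicat_real U (z + y)) = (LINT z|lborel. indicat_real U z)"
      by (rule integral_shift) measurable
    finally show ?thesis by simp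
  qed
  have "(\<lambda>n. LINT z|lborel. indicat_real U (z + X n) * indicat_real U z) \<longlonglongrightarrow> (LINT z|lborel. indicat_real U z)"
  proof (rule integral_dominated_convergence[where w="indicat_real U"])
    have "(\<lambda>n. indicat_real U (z + X n) * indicat_real U z) \<longlonglongrightarrow> indicat_real U z" for z
    proof (cases "z \<in> U")
      case True
      have "(\<lambda>n. z + X n) \<longlonglongrightarrow> z + 0" by (intro tendsto_intros X)
      then have "\<forall>\<^sub>F n in sequentially. z + X n \<in> U"
        using topological_tendstoD[OF _ assms(1)] True by fastforce
      then have "\<forall>\<^sub>F n in sequentially. indicat_real U (z + X n) * indicat_real U z = indicat_real U z"
        by eventually_elim (auto simp: True)
      then show ?thesis by (rule tendsto_eventually)
    qed simp
    then show "AE z in lborel. (\<lambda>n. indicat_real U (z + X n) * indicat_real U z) \<longlonglongrightarrow> indicat_real U z" by simp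
  qed (use int in \<open>auto simp: indicator_def\<close>)
  from tendsto_diff[OF tendsto_const[of "2 * (LINT z|lborel. indicat_real U z)"] tendsto_mult_left[OF this, of 2]]
  show "((\<lambda>y. LINT z|lborel. \<bar>indicat_real U (z + y) - indicat_real U z\<bar>) \<circ> X) \<longlonglongrightarrow> 0"
    unfolding comp_def eq by simp
qed

text \<open>Indicators are approximated from outside by open sets of finite measure, using outer
  regularity; sums follow from the triangle inequality, and dominated pointwise limits are limits in
  \<open>L^1\<close>.\<close>

lemma L1_translation:
  fixes f :: "'a::euclidean_space \<Rightarrow> real"
  assumes "integrable lborel f"
  shows "((\<lambda>y. LINT z|lborel. \<bar>f (z + y) - f z\<bar>) \<longlongrightarrow> 0) (at 0)"
  using assms
proof (induction rule: integrable_induct)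
  case (base A c)
  have [measurable]: "A \<in> sets borel" using base by simp
  show ?case
  proof (rule L1_translation_approx)
    show "integrable lborel (\<lambda>x. indicat_real A x *\<^sub>R c)"
      using base by (intro integrable_scaleR_left integrable_real_indicator) auto
    fix e :: real assume "e > 0"
    \<comment> \<open>The 1 in the denominator covers \<open>c = 0\<close>.\<close>
    define d where "d = e / (\<bar>c\<bar> + 1)"
    have "d > 0" using \<open>e > 0\<close> by (simp add: d_def add_nonneg_pos)
    then obtain U where U: "open U" "A \<subseteq> U" "emeasure lborel (U - A) < ennreal d"
      using outer_regular_lborel[of A d] by auto
    have [measurable]: "U \<in> sets borel" using U by simp
    have fin: "emeasure lborel (U - A) < top"
      using U(3) by (rule less_trans) simp
    have "emeasure lborel ((U - A) \<union> A) \<le> emeasure lborel (U - A) + emeasure lborel A"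
      by (rule emeasure_subadditive) auto
    also have "\<dots> < top" using fin base(2) by (simp add: ennreal_add_less_top)
    also have "(U - A) \<union> A = U" using U(2) by auto
    finally have Ufin: "emeasure lborel U < \<infinity>" by simp
    have m: "measure lborel (U - A) \<le> d"
      using U(3) \<open>d > 0\<close> by (simp add: measure_def enn2real_leI)
    show "\<exists>s. integrable lborel s \<and> (LINT z|lborel. \<bar>indicat_real A z *\<^sub>R c - s z\<bar>) \<le> e \<and>
       ((\<lambda>y. LINT z|lborel. \<bar>s (z + y) - s z\<bar>) \<longlongrightarrow> 0) (at 0)"
    proof (intro exI conjI)
      show "integrable lborel (\<lambda>z. c * indicat_real U z)"
        using Ufin by (intro integrable_mult_right integrable_real_indicator) auto
      have "(LINT z|lborel. \<bar>indicat_real A z *\<^sub>R c - c * indicat_real U z\<bar>)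
        = (LINT z|lborel. \<bar>c\<bar> * indicat_real (U - A) z)"
        using U(2) by (intro Bochner_Integration.integral_cong) (auto simp: indicator_def)
      also have "\<dots> = \<bar>c\<bar> * measure lborel (U - A)" by simp
      also have "\<dots> \<le> \<bar>c\<bar> * d" by (intro mult_left_mono m) auto
      also have "\<dots> \<le> e" using \<open>e > 0\<close> by (simp add: d_def field_simps)
      finally show "(LINT z|lborel. \<bar>indicat_real A z *\<^sub>R c - c * indicat_real U z\<bar>) \<le> e" .
      have "((\<lambda>y. \<bar>c\<bar> * (LINT z|lborel. \<bar>indicat_real U (z + y) - indicat_real U z\<bar>)) \<longlongrightarrow> \<bar>c\<bar> * 0) (at 0)"
        by (intro tendsto_mult_left L1_translation_open U Ufin)
      moreover have "\<bar>c * indicat_real U (z + y) - c * indicat_real U z\<bar>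
         = \<bar>c\<bar> * \<bar>indicat_real U (z + y) - indicat_real U z\<bar>" for y z
        by (simp add: abs_mult[symmetric] right_diff_distrib)
      ultimately show "((\<lambda>y. LINT z|lborel. \<bar>c * indicat_real U (z + y) - c * indicat_real U z\<bar>) \<longlongrightarrow> 0) (at 0)"
        by simp
    qed
  qed
next
  case (add f g)
  note [simp] = integrable_shift[OF add.hyps(1)] integrable_shift[OF add.hyps(2)] add.hyps
  show ?case
  proof (rule Lim_null_comparison)
    show "\<forall>\<^sub>F y in at 0. norm (LINT z|lborel. \<bar>f (z + y) + g (z + y) - (f z + g z)\<bar>)
       \<le> (LINT z|lborel. \<bar>f (z + y) - f z\<bar>) + (LINT z|lborel. \<bar>g (z + y) - g z\<bar>)"
    proof (intro always_eventually allI)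
      fix y
      have "(LINT z|lborel. \<bar>f (z + y) + g (z + y) - (f z + g z)\<bar>)
        \<le> (LINT z|lborel. \<bar>f (z + y) - f z\<bar> + \<bar>g (z + y) - g z\<bar>)"
        by (intro integral_mono) auto
      also have "\<dots> = (LINT z|lborel. \<bar>f (z + y) - f z\<bar>) + (LINT z|lborel. \<bar>g (z + y) - g z\<bar>)"
        by simp
      finally show "norm (LINT z|lborel. \<bar>f (z + y) + g (z + y) - (f z + g z)\<bar>)
       \<le> (LINT z|lborel. \<bar>f (z + y) - f z\<bar>) + (LINT z|lborel. \<bar>g (z + y) - g z\<bar>)" by simp
    qed
    show "((\<lambda>y. (LINT z|lborel. \<bar>f (z + y) - f z\<bar>) + (LINT z|lborel. \<bar>g (z + y) - g z\<bar>)) \<longlongrightarrow> 0) (at 0)"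
      using tendsto_add[OF add.IH] by simp
  qed
next
  case (lim f s)
  show ?case
  proof (rule L1_translation_approx[OF lim.hyps(4)])
    fix e :: real assume "e > 0"
    have "(\<lambda>i. LINT z|lborel. \<bar>f z - s i z\<bar>) \<longlonglongrightarrow> (LINT z|(lborel::'a measure). 0)"
    \<comment> \<open>The induction supplies approximations with
      \<open>\<bar>s i z\<bar> \<le> 2 * \<bar>f z\<bar>\<close>, hence the factor 3.\<close>
    proof (rule integral_dominated_convergence[where w="\<lambda>z. 3 * \<bar>f z\<bar>"])
      show "AE z in lborel. (\<lambda>i. \<bar>f z - s i z\<bar>) \<longlonglongrightarrow> 0"
      proof (rule AE_I2)
        fix z
        have "(\<lambda>i. \<bar>f z - s i z\<bar>) \<longlonglongrightarrow> \<bar>f z - f z\<bar>"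
          by (intro tendsto_intros lim.hyps(2)) simp
        then show "(\<lambda>i. \<bar>f z - s i z\<bar>) \<longlonglongrightarrow> 0" by simp
      qed
      show "AE z in lborel. norm \<bar>f z - s i z\<bar> \<le> 3 * \<bar>f z\<bar>" for i
      proof (rule AE_I2)
        fix z show "norm \<bar>f z - s i z\<bar> \<le> 3 * \<bar>f z\<bar>" using lim.hyps(3)[of z i] by (auto simp: abs_if split: if_splits)
      qed
    qed (use lim.hyps(1,4) in auto)
    then have "\<forall>\<^sub>F i in sequentially. (LINT z|lborel. \<bar>f z - s i z\<bar>) < e"
      using order_tendstoD(2)[of _ 0 sequentially e] \<open>e > 0\<close> by simp
    then obtain i where "(LINT z|lborel. \<bar>f z - s i z\<bar>) < e"
      using eventually_happens'[OF sequentially_bot] by blast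
    then show "\<exists>s. integrable lborel s \<and> (LINT z|lborel. \<bar>f z - s z\<bar>) \<le> e \<and>
       ((\<lambda>y. LINT z|lborel. \<bar>s (z + y) - s z\<bar>) \<longlongrightarrow> 0) (at 0)"
      using lim.hyps(1) lim.IH by (intro exI[of _ "s i"]) auto
  qed
qed

text \<open>The dominating functions vary with \<open>n\<close> and converge in \<open>L\<^sup>1\<close>; the proof truncates \<open>F n\<close> at \<open>G0\<close>.\<close>

lemma integral_tendsto_generalized_dominated:
  fixes F :: "nat \<Rightarrow> 'a \<Rightarrow> real"
  assumes [measurable]: "\<And>n. F n \<in> borel_measurable M" "F0 \<in> borel_measurable M"
    and G: "\<And>n. integrable M (G n)" "integrable M G0"
    and bd: "\<And>n. AE z in M. \<bar>F n z\<bar> \<le> G n z" "AE z in M. \<bar>F0 z\<bar> \<le> G0 z"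
    and conv: "AE z in M. (\<lambda>n. F n z) \<longlonglongrightarrow> F0 z"
    and L1: "(\<lambda>n. LINT z|M. \<bar>G n z - G0 z\<bar>) \<longlonglongrightarrow> 0"
  shows "integrable M F0" "\<And>n. integrable M (F n)" "(\<lambda>n. LINT z|M. F n z) \<longlonglongrightarrow> (LINT z|M. F0 z)"
proof -
  show int0: "integrable M F0"
    by (rule Bochner_Integration.integrable_bound[OF G(2)]) (use bd(2) in auto)
  show int: "integrable M (F n)" for n
    by (rule Bochner_Integration.integrable_bound[OF G(1)[of n]]) (use bd(1)[of n] in auto)
  have [measurable]: "G n \<in> borel_measurable M" "G0 \<in> borel_measurable M" for n using G by auto
  define c where "c n z = max (- G0 z) (min (G0 z) (F n z))" for n z
  have [measurable]: "c n \<in> borel_measurable M" for n unfolding c_def by measurable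
  have c: "(\<lambda>n. LINT z|M. c n z) \<longlonglongrightarrow> (LINT z|M. F0 z)"
  proof (rule integral_dominated_convergence[where w="G0"])
    show "AE z in M. (\<lambda>n. c n z) \<longlonglongrightarrow> F0 z"
      using conv bd(2)
    proof eventually_elim
      case (elim z)
      have "(\<lambda>n. c n z) \<longlonglongrightarrow> max (- G0 z) (min (G0 z) (F0 z))"
        unfolding c_def by (intro tendsto_intros elim)
      moreover have "max (- G0 z) (min (G0 z) (F0 z)) = F0 z" using elim(2) by auto
      ultimately show ?case by simp
    qed
    show "AE z in M. norm (c n z) \<le> G0 z" for n
      using bd(2) by eventually_elim (auto simp: c_def abs_le_iff)
  qed (use G in auto)
  have cint: "integrable M (c n)" for n
    by (rule Bochner_Integration.integrable_bound[OF G(2)]) (use bd(2) in \<open>auto simp: c_def abs_le_iff\<close>)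
  have "(\<lambda>n. (LINT z|M. F n z) - (LINT z|M. c n z)) \<longlonglongrightarrow> 0"
  proof (rule Lim_null_comparison[OF always_eventually L1], intro allI)
    fix n
    have "norm ((LINT z|M. F n z) - (LINT z|M. c n z)) = norm (LINT z|M. F n z - c n z)"
      using int cint by simp
    also have "\<dots> \<le> (LINT z|M. norm (F n z - c n z))" by (rule integral_norm_bound)
    \<comment> \<open>Clipping \<open>F n\<close> to the interval from \<open>- G0\<close> to
      \<open>G0\<close> moves it by at most \<open>\<bar>G n - G0\<bar>\<close>, because
      \<open>\<bar>F n\<bar> \<le> G n\<close>.\<close>
    also have "\<dots> \<le> (LINT z|M. \<bar>G n z - G0 z\<bar>)"
    proof (rule integral_mono_AE)
      show "AE z in M. norm (F n z - c n z) \<le> \<bar>G n z - G0 z\<bar>"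
        using bd(1)[of n] bd(2) by eventually_elim (auto simp: c_def max_def min_def)
    qed (use int cint G in auto)
    finally show "norm ((LINT z|M. F n z) - (LINT z|M. c n z)) \<le> (LINT z|M. \<bar>G n z - G0 z\<bar>)" .
  qed
  from tendsto_add[OF this c] show "(\<lambda>n. LINT z|M. F n z) \<longlonglongrightarrow> (LINT z|M. F0 z)" by simp
qed

text \<open>The bound, linear in \<open>t\<close>, makes \<open>G\<close> a majorant of all
  difference quotients, so dominated convergence along an arbitrary null sequence applies.\<close>

lemma DERIV_integral:
  fixes k :: "real \<Rightarrow> 'a \<Rightarrow> real"
  assumes D: "\<And>w. ((\<lambda>t. k t w) has_real_derivative k' w) (at 0)"
    and int: "\<And>t. integrable M (k t)"
    and bd: "\<And>t w. \<bar>k t w - k 0 w\<bar> \<le> \<bar>t\<bar> * G w"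
    and G: "integrable M G" and [measurable]: "k' \<in> borel_measurable M"
  shows "((\<lambda>t. LINT w|M. k t w) has_real_derivative (LINT w|M. k' w)) (at 0)"
  unfolding DERIV_def tendsto_at_iff_sequentially comp_def
proof (intro allI impI)
  fix X :: "nat \<Rightarrow> real" assume X0: "\<forall>i. X i \<in> UNIV - {0}" and X: "X \<longlonglongrightarrow> 0"
  have [measurable]: "k t \<in> borel_measurable M" for t using int by auto
  have "(\<lambda>i. LINT w|M. (k (X i) w - k 0 w) / X i) \<longlonglongrightarrow> (LINT w|M. k' w)"
  proof (rule integral_dominated_convergence[OF _ _ G])
    show "AE w in M. (\<lambda>i. (k (X i) w - k 0 w) / X i) \<longlonglongrightarrow> k' w"
      using D X0 X by (auto simp: DERIV_def tendsto_at_iff_sequentially comp_def)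
    show "AE w in M. norm ((k (X i) w - k 0 w) / X i) \<le> G w" for i
      using bd[of "X i"] X0 by (auto simp: divide_le_eq mult.commute)
  qed auto
  then show "(\<lambda>i. ((LINT w|M. k (0 + X i) w) - (LINT w|M. k 0 w)) / X i) \<longlonglongrightarrow> (LINT w|M. k' w)"
    using int by (simp add: Bochner_Integration.integral_diff)
qed

section \<open>Mollification\<close>

definition moll_const :: "'a::euclidean_space itself \<Rightarrow> real \<Rightarrow> real" where
  "moll_const _ \<epsilon> = (LINT w|lborel. bump \<epsilon> (w::'a))"

definition mollker :: "real \<Rightarrow> 'a::euclidean_space \<Rightarrow> real" where
  "mollker \<epsilon> y = bump \<epsilon> y / moll_const TYPE('a) \<epsilon>"

definition dmollker :: "real \<Rightarrow> 'a::euclidean_space \<Rightarrow> 'a \<Rightarrow> real" where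
  "dmollker \<epsilon> e y = dbump \<epsilon> e y / moll_const TYPE('a) \<epsilon>"

text \<open>For fixed \<open>z\<close> this pairs \<open>f\<close> with the kernel as a function of
  \<open>w\<close>; that function is a test function, which is how weak statements become pointwise
  ones.\<close>

definition moll :: "real \<Rightarrow> ('a::euclidean_space \<Rightarrow> real) \<Rightarrow> 'a \<Rightarrow> real" where
  "moll \<epsilon> f z = (LINT w|lborel. mollker \<epsilon> (z - w) * f w)"

definition dmoll :: "real \<Rightarrow> ('a::euclidean_space \<Rightarrow> real) \<Rightarrow> 'a \<Rightarrow> 'a \<Rightarrow> real" where
  "dmoll \<epsilon> f e z = (LINT w|lborel. dmollker \<epsilon> e (z - w) * f w)"

lemma bdd_meas_continuous_supp:
  fixes f :: "'a::euclidean_space \<Rightarrow> real"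
  assumes "continuous_on UNIV f" "supp_in f (cball c R)"
  shows "bdd_meas f"
proof -
  have "compact (f ` cball c R)"
    using assms(1) by (intro compact_continuous_image) (auto intro: continuous_on_subset)
  then have "bounded (f ` cball c R)" by (rule compact_imp_bounded)
  then obtain C where C: "\<forall>x\<in>f ` cball c R. norm x \<le> C" unfolding bounded_iff by blast
  have "\<bar>f z\<bar> \<le> \<bar>C\<bar>" for z
  proof (cases "z \<in> cball c R")
    case True
    then show ?thesis using C by force
  next
    case False
    then show ?thesis using assms(2) by (simp add: supp_in_def)
  qed
  then show ?thesis
    by (intro bdd_measI borel_measurable_continuous_onI assms)
qed

lemma supp_in_bump: "\<epsilon> > 0 \<Longrightarrow> supp_in (bump \<epsilon> :: 'a::euclidean_space \<Rightarrow> real) (cball 0 \<epsilon>)"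
  and supp_in_dbump: "\<epsilon> > 0 \<Longrightarrow> supp_in (dbump \<epsilon> e :: 'a::euclidean_space \<Rightarrow> real) (cball 0 \<epsilon>)"
  by (auto simp: supp_in_def bump_zero dbump_zero)

lemma bdd_meas_bump: "\<epsilon> > 0 \<Longrightarrow> bdd_meas (bump \<epsilon> :: 'a::euclidean_space \<Rightarrow> real)"
  and bdd_meas_dbump: "\<epsilon> > 0 \<Longrightarrow> bdd_meas (dbump \<epsilon> e :: 'a::euclidean_space \<Rightarrow> real)"
  by (rule bdd_meas_continuous_supp[OF continuous_bump supp_in_bump]
      bdd_meas_continuous_supp[OF continuous_dbump supp_in_dbump]; assumption)+

text \<open>A vanishing integral would force the nonnegative \<open>bump\<close> to vanish almost
  everywhere, but it is positive on a ball, which is not negligible.\<close>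

lemma moll_const_pos:
  assumes "\<epsilon> > 0" shows "moll_const TYPE('a::euclidean_space) \<epsilon> > 0"
proof (rule ccontr)
  have int: "integrable lborel (bump \<epsilon> :: 'a \<Rightarrow> real)"
    by (rule integrable_bdd_meas_supp[OF bdd_meas_bump[OF assms] supp_in_bump[OF assms]]) simp
  assume "\<not> moll_const TYPE('a) \<epsilon> > 0"
  moreover have "moll_const TYPE('a) \<epsilon> \<ge> 0"
    unfolding moll_const_def by (intro Bochner_Integration.integral_nonneg bump_nonneg)
  ultimately have "(LINT w|lborel. bump \<epsilon> (w::'a)) = 0" by (simp add: moll_const_def)
  then have "AE w in lborel. bump \<epsilon> (w::'a) = 0"
    using integral_nonneg_eq_0_iff_AE[OF int] bump_nonneg by auto
  then have "AE w in lborel. (w::'a) \<notin> ball 0 \<epsilon>"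
    by eventually_elim (use bump_pos[of _ \<epsilon>] in force)
  then have "ball (0::'a) \<epsilon> \<in> null_sets lborel"
    by (subst (asm) AE_iff_null_sets[symmetric]) auto
  then have "negligible (ball (0::'a) \<epsilon>)"
    by (simp add: negligible_iff_null_sets null_sets_completionI)
  then show False using open_not_negligible[of "ball (0::'a) \<epsilon>"] assms by simp
qed

lemma mollker_nonneg: "\<epsilon> > 0 \<Longrightarrow> 0 \<le> mollker \<epsilon> (y :: 'a::euclidean_space)"
  using moll_const_pos[of \<epsilon>, where 'a='a] by (simp add: mollker_def bump_nonneg less_imp_le)

lemma mollker_minus: "mollker \<epsilon> (z - w) = mollker \<epsilon> (w - z)"
  by (simp add: mollker_def bump_def norm_minus_commute)

lemma supp_in_mollker: "\<epsilon> > 0 \<Longrightarrow> supp_in (mollker \<epsilon> :: 'a::euclidean_space \<Rightarrow> real) (cball 0 \<epsilon>)"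
  using supp_in_bump[of \<epsilon>] by (auto simp: supp_in_def mollker_def)

lemma C1_bdd_mollker:
  assumes "\<epsilon> > 0"
  shows "C1_bdd (mollker \<epsilon> :: 'a::euclidean_space \<Rightarrow> real) (dmollker \<epsilon>)"
  unfolding C1_bdd_def
proof (intro conjI allI)
  show "bdd_meas (mollker \<epsilon> :: 'a \<Rightarrow> real)"
    unfolding mollker_def divide_inverse by (intro bdd_meas_intros bdd_meas_bump assms)
  show "bdd_meas (dmollker \<epsilon> e)" for e :: 'a
    unfolding dmollker_def divide_inverse by (intro bdd_meas_intros bdd_meas_dbump assms)
  show "((\<lambda>t. mollker \<epsilon> (z + t *\<^sub>R e)) has_real_derivative dmollker \<epsilon> e z) (at 0)" for e z :: 'a
    unfolding mollker_def dmollker_def by (intro DERIV_cdivide bump_DERIV)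
qed

lemma integrable_mollker: "\<epsilon> > 0 \<Longrightarrow> integrable lborel (mollker \<epsilon> :: 'a::euclidean_space \<Rightarrow> real)"
  by (rule integrable_bdd_meas_supp[OF C1_bdd_D(1)[OF C1_bdd_mollker] supp_in_mollker]) auto

lemma integral_mollker: "\<epsilon> > 0 \<Longrightarrow> (LINT y|lborel. mollker \<epsilon> (y :: 'a::euclidean_space)) = 1"
  using moll_const_pos[of \<epsilon>, where 'a='a] by (simp add: mollker_def moll_const_def)

lemma measurable_mollker [measurable]: "mollker \<epsilon> \<in> borel_measurable borel"
  unfolding mollker_def divide_inverse
  by (intro borel_measurable_continuous_onI continuous_intros continuous_bump)

lemma measurable_dmollker [measurable]: "dmollker \<epsilon> e \<in> borel_measurable borel"
  unfolding dmollker_def divide_inverse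
  by (intro borel_measurable_continuous_onI continuous_intros continuous_dbump)

lemma moll_eq_shift:
  assumes [measurable]: "f \<in> borel_measurable borel"
  shows "moll \<epsilon> f z = (LINT y|lborel. mollker \<epsilon> y * f (z + y))"
proof -
  have "(LINT y|lborel. mollker \<epsilon> y * f (z + y)) = (LINT w|lborel. mollker \<epsilon> (w + - z) * f (z + (w + - z)))"
    by (rule integral_shift[symmetric]) measurable
  then show ?thesis by (simp add: moll_def mollker_minus[of \<epsilon> z])
qed

lemma bdd_meas_shift_minus: "bdd_meas f \<Longrightarrow> bdd_meas (\<lambda>w. f (z - w))"
  by (auto simp: bdd_meas_def)

lemma integrable_moll:
  assumes "\<epsilon> > 0" "integrable lborel f"
  shows "integrable lborel (\<lambda>w. mollker \<epsilon> (z - w) * f w)" "integrable lborel (\<lambda>w. dmollker \<epsilon> e (z - w) * f w)"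
  by (intro integrable_bdd_meas_mult bdd_meas_shift_minus C1_bdd_D[OF C1_bdd_mollker[OF assms(1)]] assms)+

lemma integrable_moll_shift:
  assumes "\<epsilon> > 0" "integrable lborel f"
  shows "integrable lborel (\<lambda>y. mollker \<epsilon> y * f (z + y))"
  using integrable_bdd_meas_mult[OF C1_bdd_D(1)[OF C1_bdd_mollker[OF assms(1)]] integrable_shift[OF assms(2), of z]]
  by (simp add: add.commute)

lemma measurable_moll [measurable]:
  assumes [measurable]: "f \<in> borel_measurable borel"
  shows "moll \<epsilon> f \<in> borel_measurable borel" "dmoll \<epsilon> f e \<in> borel_measurable borel"
  unfolding moll_def dmoll_def by measurable

lemma moll_bound:
  assumes "\<epsilon> > 0" "integrable lborel f" "\<And>y. \<bar>f y\<bar> \<le> M"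
  shows "\<bar>moll \<epsilon> f z\<bar> \<le> M"
proof -
  have [measurable]: "f \<in> borel_measurable borel" using assms(2) by auto
  have "norm (moll \<epsilon> f z) \<le> (LINT y|lborel. norm (mollker \<epsilon> y * f (z + y)))"
    unfolding moll_eq_shift[OF \<open>f \<in> borel_measurable borel\<close>] by (rule integral_norm_bound)
  also have "\<dots> \<le> (LINT y|lborel. mollker \<epsilon> (y::'a) * M)"
    using integrable_mollker[OF assms(1), where 'a='a] integrable_moll_shift[OF assms(1,2), of z]
      mollker_nonneg[OF assms(1), where 'a='a] assms(3)
    by (intro integral_mono integrable_norm) (auto simp: abs_mult intro!: mult_left_mono)
  also have "\<dots> = M" using integral_mollker[OF assms(1), where 'a='a] by simp
  finally show ?thesis by simp
qed

lemma moll_abs_le: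
  assumes "\<epsilon> > 0" "integrable lborel f" "integrable lborel g" "\<And>y. \<bar>f y\<bar> \<le> g y"
  shows "\<bar>moll \<epsilon> f z\<bar> \<le> moll \<epsilon> g z"
proof -
  have "norm (moll \<epsilon> f z) \<le> (LINT w|lborel. norm (mollker \<epsilon> (z - w) * f w))"
    unfolding moll_def by (rule integral_norm_bound)
  also have "\<dots> \<le> moll \<epsilon> g z" unfolding moll_def
    using integrable_moll[OF assms(1,2)] integrable_moll[OF assms(1,3)]
      mollker_nonneg[OF assms(1), where 'a='a] assms(4)
    by (intro integral_mono integrable_norm) (auto simp: abs_mult intro!: mult_left_mono)
  finally show ?thesis by simp
qed

lemma moll_add_const:
  assumes "\<epsilon> > 0" "integrable lborel f"
  shows "(LINT w|lborel. mollker \<epsilon> (z - w) * (f w + c)) = moll \<epsilon> f z + c"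
proof -
  have i: "integrable lborel (\<lambda>w. mollker \<epsilon> (z - w))"
    unfolding mollker_minus[of \<epsilon> z] using integrable_shift[OF integrable_mollker[OF assms(1)], of "-z"] by simp
  have "(LINT w|lborel. mollker \<epsilon> (w + - z)) = (LINT w|lborel. mollker \<epsilon> (w::'a))"
    by (rule integral_shift) measurable
  then have "(LINT w|lborel. mollker \<epsilon> (z - w)) = 1"
    using integral_mollker[OF assms(1), where 'a='a] by (simp add: mollker_minus[of \<epsilon> z])
  then show ?thesis using integrable_moll(1)[OF assms, of z] i
    by (simp add: distrib_left moll_def)
qed

text \<open>Dominates products of mollified fluxes and gradients by a mollified integrable function, so
  that no convergence of the factors in \<open>L\<^sup>p\<close> is needed.\<close>

lemma moll_mult_le:
  assumes \<epsilon>: "\<epsilon> > 0" "\<epsilon>' > 0" and int: "integrable lborel f" "integrable lborel g" "integrable lborel H"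
    and bd: "\<And>w w'. \<bar>f w\<bar> * \<bar>g w'\<bar> \<le> H w + H w'"
  shows "\<bar>moll \<epsilon> f z * moll \<epsilon>' g z'\<bar> \<le> moll \<epsilon> H z + moll \<epsilon>' H z'"
proof -
  note i = integrable_moll(1)[OF \<epsilon>(1) int(1), of z] integrable_moll(1)[OF \<epsilon>(2) int(2), of z']
    integrable_moll(1)[OF \<epsilon>(1) int(3), of z] integrable_moll(1)[OF \<epsilon>(2) int(3), of z']
  have i1: "integrable lborel (\<lambda>w. mollker \<epsilon>' (z' - w))"
    unfolding mollker_minus[of \<epsilon>' z'] using integrable_shift[OF integrable_mollker[OF \<epsilon>(2)], of "-z'"] by simp
  have i2: "integrable lborel (\<lambda>w. mollker \<epsilon> (z - w))"
    unfolding mollker_minus[of \<epsilon> z] using integrable_shift[OF integrable_mollker[OF \<epsilon>(1)], of "-z"] by simp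
  have 1: "\<bar>f w * moll \<epsilon>' g z'\<bar> \<le> H w + moll \<epsilon>' H z'" for w
  proof -
    have "norm (f w * moll \<epsilon>' g z') = norm (LINT w'|lborel. f w * (mollker \<epsilon>' (z' - w') * g w'))"
      unfolding moll_def by simp
    also have "\<dots> \<le> (LINT w'|lborel. norm (f w * (mollker \<epsilon>' (z' - w') * g w')))"
      by (rule integral_norm_bound)
    also have "\<dots> \<le> (LINT w'|lborel. mollker \<epsilon>' (z' - w') * (H w' + H w))"
    proof (rule integral_mono)
      show "norm (f w * (mollker \<epsilon>' (z' - w') * g w')) \<le> mollker \<epsilon>' (z' - w') * (H w' + H w)" for w'
        using mult_left_mono[OF bd[of w w'] mollker_nonneg[OF \<epsilon>(2), of "z' - w'"]] mollker_nonneg[OF \<epsilon>(2), of "z' - w'"]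
        by (simp add: abs_mult mult.left_commute add.commute mult.assoc)
    qed (use i i1 in \<open>auto simp: distrib_left\<close>)
    also have "\<dots> = moll \<epsilon>' H z' + H w" by (rule moll_add_const[OF \<epsilon>(2) int(3)])
    finally show ?thesis by simp
  qed
  have "norm (moll \<epsilon> f z * moll \<epsilon>' g z') = norm (LINT w|lborel. (mollker \<epsilon> (z - w) * f w) * moll \<epsilon>' g z')"
    unfolding moll_def[of \<epsilon> f] by simp
  also have "\<dots> \<le> (LINT w|lborel. norm ((mollker \<epsilon> (z - w) * f w) * moll \<epsilon>' g z'))"
    by (rule integral_norm_bound)
  also have "\<dots> \<le> (LINT w|lborel. mollker \<epsilon> (z - w) * (H w + moll \<epsilon>' H z'))"
  proof (rule integral_mono)
    show "norm ((mollker \<epsilon> (z - w) * f w) * moll \<epsilon>' g z') \<le> mollker \<epsilon> (z - w) * (H w + moll \<epsilon>' H z')" for w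
      using mult_left_mono[OF 1[of w] mollker_nonneg[OF \<epsilon>(1), of "z - w"]] mollker_nonneg[OF \<epsilon>(1), of "z - w"]
      by (simp add: abs_mult mult.assoc)
  qed (use i i2 in \<open>auto simp: distrib_left\<close>)
  also have "\<dots> = moll \<epsilon> H z + moll \<epsilon>' H z'" by (rule moll_add_const[OF \<epsilon>(1) int(3)])
  finally show ?thesis by simp
qed

text \<open>Differentiation under the integral: the kernel is Lipschitz along each line, and its
  Lipschitz constant times \<open>\<bar>f\<bar>\<close> is the majorant.\<close>

lemma C1_bdd_moll:
  fixes f :: "'a::euclidean_space \<Rightarrow> real"
  assumes "\<epsilon> > 0" and f: "integrable lborel f"
  shows "C1_bdd (moll \<epsilon> f) (dmoll \<epsilon> f)"
  unfolding C1_bdd_def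
proof (intro conjI allI)
  note [measurable] = borel_measurable_integrable[OF f]
  note c = C1_bdd_mollker[OF assms(1), where 'a='a]
  have gen: "bdd_meas (\<lambda>z. LINT w|lborel. k (z - w) * f w)" if k: "bdd_meas k" for k
  proof -
    have [measurable]: "k \<in> borel_measurable borel" using k by (rule bdd_measD)
    obtain C where C: "C \<ge> 0" "\<And>z. \<bar>k z\<bar> \<le> C" using bdd_meas_bound[OF k] by blast
    have "\<bar>LINT w|lborel. k (z - w) * f w\<bar> \<le> (LINT w|lborel. C * \<bar>f w\<bar>)" for z
    proof -
      have "norm (LINT w|lborel. k (z - w) * f w) \<le> (LINT w|lborel. norm (k (z - w) * f w))"
        by (rule integral_norm_bound)
      also have "\<dots> \<le> (LINT w|lborel. C * \<bar>f w\<bar>)"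
        by (rule integral_mono[OF integrable_norm[OF integrable_bdd_meas_mult[OF bdd_meas_shift_minus[OF k] f]]])
          (use f C in \<open>auto simp: abs_mult intro!: mult_right_mono\<close>)
      finally show ?thesis by simp
    qed
    then show ?thesis by (intro bdd_measI) measurable
  qed
  show "bdd_meas (moll \<epsilon> f)" unfolding moll_def by (rule gen[OF C1_bdd_D(1)[OF c]])
  fix e
  show "bdd_meas (dmoll \<epsilon> f e)" unfolding dmoll_def by (rule gen[OF C1_bdd_D(2)[OF c]])
  fix z
  obtain C where C: "C \<ge> 0" "\<And>z. \<bar>dmollker \<epsilon> e z\<bar> \<le> C" using bdd_meas_bound[OF C1_bdd_D(2)[OF c]] by blast
  show "((\<lambda>t. moll \<epsilon> f (z + t *\<^sub>R e)) has_real_derivative dmoll \<epsilon> f e z) (at 0)"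
    unfolding moll_def dmoll_def
  proof (rule DERIV_integral)
    show "((\<lambda>t. mollker \<epsilon> (z + t *\<^sub>R e - w) * f w) has_real_derivative dmollker \<epsilon> e (z - w) * f w) (at 0)" for w
      using DERIV_cmult_right[OF C1_bdd_D(3)[OF c, of "z - w" e 0], of "f w"] by (simp add: algebra_simps)
    show "\<bar>mollker \<epsilon> (z + t *\<^sub>R e - w) * f w - mollker \<epsilon> (z + 0 *\<^sub>R e - w) * f w\<bar> \<le> \<bar>t\<bar> * (C * \<bar>f w\<bar>)" for t w
    proof -
      have "\<bar>mollker \<epsilon> ((z - w) + t *\<^sub>R e) - mollker \<epsilon> (z - w)\<bar> \<le> C * \<bar>t\<bar>"
        by (rule C1_bdd_line_bound[OF c C(2)])
      from mult_right_mono[OF this, of "\<bar>f w\<bar>"] show ?thesis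
        by (simp add: abs_mult[symmetric] algebra_simps)
    qed
    show "integrable lborel (\<lambda>w. C * \<bar>f w\<bar>)" using f by auto
  qed (auto intro: integrable_moll assms)
qed

text \<open>Tonelli exchanges the integrals, and the kernel has mass 1 on the ball of radius
  \<epsilon>; hence a bound valid for each small shift \<open>y\<close> survives averaging.
  Nonnegative integrals avoid asking for integrability in advance.\<close>

lemma nn_integral_moll_le:
  assumes \<epsilon>: "\<epsilon> > 0" and [measurable]: "a \<in> borel_measurable (borel \<Otimes>\<^sub>M borel)"
    and bd: "\<And>y. norm y \<le> \<epsilon> \<Longrightarrow> (\<integral>\<^sup>+ z. a (z, y :: 'a::euclidean_space) \<partial>(lborel :: 'b::euclidean_space measure)) \<le> \<eta>"
  shows "(\<integral>\<^sup>+ z. (\<integral>\<^sup>+ y. ennreal (mollker \<epsilon> y) * a (z, y) \<partial>lborel) \<partial>lborel) \<le> \<eta>"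
proof -
  have "(\<integral>\<^sup>+ z. (\<integral>\<^sup>+ y. ennreal (mollker \<epsilon> y) * a (z, y) \<partial>lborel) \<partial>lborel)
    = (\<integral>\<^sup>+ y. (\<integral>\<^sup>+ z. ennreal (mollker \<epsilon> y) * a (z, y) \<partial>lborel) \<partial>lborel)"
    by (rule lborel_pair.Fubini'[symmetric]) measurable
  also have "\<dots> = (\<integral>\<^sup>+ y. ennreal (mollker \<epsilon> y) * (\<integral>\<^sup>+ z. a (z, y) \<partial>lborel) \<partial>lborel)"
    by (intro nn_integral_cong nn_integral_cmult) measurable
  also have "\<dots> \<le> (\<integral>\<^sup>+ y. ennreal (mollker \<epsilon> (y::'a)) * \<eta> \<partial>lborel)"
  proof (rule nn_integral_mono)
    fix y :: 'a
    show "ennreal (mollker \<epsilon> y) * (\<integral>\<^sup>+ z. a (z, y) \<partial>lborel) \<le> ennreal (mollker \<epsilon> y) * \<eta>"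
    proof (cases "norm y \<le> \<epsilon>")
      case True
      then show ?thesis by (intro mult_left_mono bd) auto
    next
      case False
      then show ?thesis using supp_in_mollker[OF \<epsilon>, where 'a='a] by (simp add: supp_in_def)
    qed
  qed
  also have "\<dots> = (\<integral>\<^sup>+ y. ennreal (mollker \<epsilon> (y::'a)) \<partial>lborel) * \<eta>"
    by (rule nn_integral_multc) measurable
  also have "(\<integral>\<^sup>+ y. ennreal (mollker \<epsilon> (y::'a)) \<partial>lborel) = 1"
    using nn_integral_eq_integral[OF integrable_mollker[OF \<epsilon>, where 'a='a]] mollker_nonneg[OF \<epsilon>, where 'a='a]
      integral_mollker[OF \<epsilon>, where 'a='a] by simp
  finally show ?thesis by simp
qed

lemma integral_le_of_nn_integral_le:
  fixes f :: "'a \<Rightarrow> real"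
  assumes "f \<in> borel_measurable M" "\<And>z. 0 \<le> f z" "(\<integral>\<^sup>+ z. ennreal (f z) \<partial>M) \<le> ennreal C" "0 \<le> C"
  shows "integrable M f" "(LINT z|M. f z) \<le> C"
proof -
  show "integrable M f"
    using assms by (intro integrableI_nonneg) (auto simp: le_less_trans[OF _ ennreal_less_top])
  then show "(LINT z|M. f z) \<le> C"
    using assms nn_integral_eq_integral[of M f] by simp
qed

lemma integral_moll_le:
  fixes f :: "'a::euclidean_space \<Rightarrow> real"
  assumes \<epsilon>: "\<epsilon> > 0" and f: "integrable lborel f" and nn: "\<And>z. 0 \<le> f z"
  shows "integrable lborel (moll \<epsilon> f)" "(LINT z|lborel. moll \<epsilon> f z) \<le> (LINT z|lborel. f z)"
proof -
  have [measurable]: "f \<in> borel_measurable borel" using f by auto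
  have "(\<integral>\<^sup>+ z. ennreal (moll \<epsilon> f z) \<partial>lborel)
    \<le> (\<integral>\<^sup>+ z. (\<integral>\<^sup>+ y. ennreal (mollker \<epsilon> y) * ennreal (f (fst (z, y) + snd (z, y))) \<partial>lborel) \<partial>lborel)"
  proof (rule nn_integral_mono)
    fix z
    have "ennreal (moll \<epsilon> f z) = (\<integral>\<^sup>+ y. ennreal (mollker \<epsilon> y * f (z + y)) \<partial>lborel)"
      unfolding moll_eq_shift[OF \<open>f \<in> borel_measurable borel\<close>]
      using integrable_moll_shift[OF \<epsilon> f] mollker_nonneg[OF \<epsilon>, where 'a='a] nn
      by (intro nn_integral_eq_integral[symmetric]) auto
    then show "ennreal (moll \<epsilon> f z) \<le> (\<integral>\<^sup>+ y. ennreal (mollker \<epsilon> y) * ennreal (f (fst (z, y) + snd (z, y))) \<partial>lborel)"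
      by (simp add: ennreal_mult mollker_nonneg[OF \<epsilon>] nn)
  qed
  also have "\<dots> \<le> ennreal (LINT z|lborel. f z)"
  proof (rule nn_integral_moll_le[OF \<epsilon>, where a="\<lambda>p. ennreal (f (fst p + snd p))"])
    fix y :: 'a
    have "(\<integral>\<^sup>+ z. ennreal (f (z + y)) \<partial>lborel) = (\<integral>\<^sup>+ z. ennreal (f z) \<partial>lborel)"
      by (rule nn_integral_shift[where f="\<lambda>z. ennreal (f z)"]) measurable
    also have "\<dots> = ennreal (LINT z|lborel. f z)"
      using nn by (intro nn_integral_eq_integral f) auto
    finally show "(\<integral>\<^sup>+ z. ennreal (f (fst (z, y) + snd (z, y))) \<partial>lborel) \<le> ennreal (LINT z|lborel. f z)" by simp
  qed measurable
  finally have 1: "(\<integral>\<^sup>+ z. ennreal (moll \<epsilon> f z) \<partial>lborel) \<le> ennreal (LINT z|lborel. f z)" .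
  have 2: "0 \<le> moll \<epsilon> f z" for z
    unfolding moll_def using mollker_nonneg[OF \<epsilon>, where 'a='a] nn by (intro Bochner_Integration.integral_nonneg) auto
  have 3: "0 \<le> (LINT z|lborel. f z)" using nn by (intro Bochner_Integration.integral_nonneg) auto
  from integral_le_of_nn_integral_le[OF _ 2 1 3]
  show "integrable lborel (moll \<epsilon> f)" "(LINT z|lborel. moll \<epsilon> f z) \<le> (LINT z|lborel. f z)" by auto
qed

text \<open>\<open>moll \<epsilon> f - f\<close> is the kernel average of
  \<open>f (z + y) - f z\<close>. Two weights occur later: the constant 1 for convergence in
  \<open>L^1\<close>, and a cutoff for estimates that hold only inside a ball.\<close>

lemma integral_moll_diff_le:
  fixes f :: "'a::euclidean_space \<Rightarrow> real"
  assumes \<epsilon>: "\<epsilon> > 0" and f: "integrable lborel f" and w: "bdd_meas w" "\<And>z. 0 \<le> w z" and "0 \<le> \<eta>"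
    and bd: "\<And>y. norm y \<le> \<epsilon> \<Longrightarrow> (LINT z|lborel. w z * \<bar>f (z + y) - f z\<bar>) \<le> \<eta>"
  shows "integrable lborel (\<lambda>z. w z * \<bar>moll \<epsilon> f z - f z\<bar>)"
    "(LINT z|lborel. w z * \<bar>moll \<epsilon> f z - f z\<bar>) \<le> \<eta>"
proof -
  have [measurable]: "f \<in> borel_measurable borel" "w \<in> borel_measurable borel"
    using f bdd_measD[OF w(1)] by auto
  have "(\<integral>\<^sup>+ z. ennreal (w z * \<bar>moll \<epsilon> f z - f z\<bar>) \<partial>lborel)
    \<le> (\<integral>\<^sup>+ z. (\<integral>\<^sup>+ y. ennreal (mollker \<epsilon> y) * ennreal (w (fst (z, y)) * \<bar>f (fst (z, y) + snd (z, y)) - f (fst (z, y))\<bar>) \<partial>lborel) \<partial>lborel)"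
  proof (rule nn_integral_mono)
    fix z
    have i: "integrable lborel (\<lambda>y. mollker \<epsilon> y * f (z + y))" "integrable lborel (\<lambda>y::'a. mollker \<epsilon> y * f z)"
      using integrable_moll_shift[OF \<epsilon> f] integrable_mollker[OF \<epsilon>, where 'a='a] by auto
    have "(LINT y|lborel. mollker \<epsilon> (y::'a) * f z) = (LINT y|lborel. mollker \<epsilon> (y::'a)) * f z"
      by (rule integral_mult_left_zero)
    then have "(LINT y|lborel. mollker \<epsilon> (y::'a) * f z) = f z"
      unfolding integral_mollker[OF \<epsilon>] by simp
    then have "moll \<epsilon> f z - f z = (LINT y|lborel. mollker \<epsilon> y * f (z + y) - mollker \<epsilon> y * f z)"
      using i by (simp add: moll_eq_shift)
    then have "w z * (moll \<epsilon> f z - f z) = (LINT y|lborel. w z * (mollker \<epsilon> y * f (z + y) - mollker \<epsilon> y * f z))"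
      by simp
    then have "ennreal (norm (w z * (moll \<epsilon> f z - f z))) \<le> (\<integral>\<^sup>+ y. ennreal (norm (w z * (mollker \<epsilon> y * f (z + y) - mollker \<epsilon> y * f z))) \<partial>lborel)"
      using i by (simp only:) (intro integral_norm_bound_ennreal integrable_mult_right Bochner_Integration.integrable_diff)
    also have "\<dots> = (\<integral>\<^sup>+ y. ennreal (mollker \<epsilon> y) * ennreal (w z * \<bar>f (z + y) - f z\<bar>) \<partial>lborel)"
    proof (rule nn_integral_cong)
      fix y
      have "norm (w z * (mollker \<epsilon> y * f (z + y) - mollker \<epsilon> y * f z)) = mollker \<epsilon> y * (w z * \<bar>f (z + y) - f z\<bar>)"
        using mollker_nonneg[OF \<epsilon>, of y] w(2)[of z]
        by (simp add: abs_mult right_diff_distrib[symmetric])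
      then show "ennreal (norm (w z * (mollker \<epsilon> y * f (z + y) - mollker \<epsilon> y * f z))) = ennreal (mollker \<epsilon> y) * ennreal (w z * \<bar>f (z + y) - f z\<bar>)"
        using mollker_nonneg[OF \<epsilon>, of y] w(2)[of z] by (simp add: ennreal_mult)
    qed
    finally show "ennreal (w z * \<bar>moll \<epsilon> f z - f z\<bar>) \<le> (\<integral>\<^sup>+ y. ennreal (mollker \<epsilon> y) * ennreal (w (fst (z, y)) * \<bar>f (fst (z, y) + snd (z, y)) - f (fst (z, y))\<bar>) \<partial>lborel)"
      using w(2)[of z] by (simp add: abs_mult)
  qed
  also have "\<dots> \<le> ennreal \<eta>"
  proof (rule nn_integral_moll_le[OF \<epsilon>, where a="\<lambda>p. ennreal (w (fst p) * \<bar>f (fst p + snd p) - f (fst p)\<bar>)"])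
    fix y :: 'a assume y: "norm y \<le> \<epsilon>"
    have "integrable lborel (\<lambda>z. w z * \<bar>f (z + y) - f z\<bar>)"
      using f integrable_shift[OF f, of y] by (intro integrable_bdd_meas_mult w) auto
    from nn_integral_eq_integral[OF this] have "(\<integral>\<^sup>+ z. ennreal (w z * \<bar>f (z + y) - f z\<bar>) \<partial>lborel) \<le> ennreal \<eta>"
      using w(2) bd[OF y] by (simp add: ennreal_leI)
    then show "(\<integral>\<^sup>+ z. ennreal (w (fst (z, y)) * \<bar>f (fst (z, y) + snd (z, y)) - f (fst (z, y))\<bar>) \<partial>lborel) \<le> ennreal \<eta>"
      by simp
  qed measurable
  finally have 1: "(\<integral>\<^sup>+ z. ennreal (w z * \<bar>moll \<epsilon> f z - f z\<bar>) \<partial>lborel) \<le> ennreal \<eta>" .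
  from integral_le_of_nn_integral_le[OF _ _ 1 \<open>0 \<le> \<eta>\<close>] w(2)
  show "integrable lborel (\<lambda>z. w z * \<bar>moll \<epsilon> f z - f z\<bar>)"
    "(LINT z|lborel. w z * \<bar>moll \<epsilon> f z - f z\<bar>) \<le> \<eta>" by auto
qed

lemma moll_L1_tendsto:
  fixes f :: "'a::euclidean_space \<Rightarrow> real"
  assumes f: "integrable lborel f" and \<epsilon>: "\<And>n. \<epsilon> n > 0" "\<epsilon> \<longlonglongrightarrow> 0"
  shows "integrable lborel (\<lambda>z. \<bar>moll (\<epsilon> n) f z - f z\<bar>)"
    "(\<lambda>n. LINT z|lborel. \<bar>moll (\<epsilon> n) f z - f z\<bar>) \<longlonglongrightarrow> 0"
proof -
  note c1 = bdd_meas_const[of 1]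
  have ftr: "integrable lborel (\<lambda>z. \<bar>f (z + y) - f z\<bar>)" for y
    using f integrable_shift[OF f, of y] by auto
  \<comment> \<open>Comparison with the function 0 gives a crude bound for every shift, enough for
    integrability.\<close>
  have "(LINT z|lborel. 1 * \<bar>f (z + y) - f z\<bar>) \<le> 2 * (LINT z|lborel. \<bar>f z\<bar>)" for y
    using integral_abs_translation_le[OF f, of "\<lambda>_. 0" y] by simp
  from integral_moll_diff_le(1)[OF \<epsilon>(1) f c1 _ _ this]
  show "integrable lborel (\<lambda>z. \<bar>moll (\<epsilon> n) f z - f z\<bar>)" by simp
  show "(\<lambda>n. LINT z|lborel. \<bar>moll (\<epsilon> n) f z - f z\<bar>) \<longlonglongrightarrow> 0"
  proof (rule LIMSEQ_I)
    fix e :: real assume "e > 0"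
    from tendstoD[OF L1_translation[OF f] half_gt_zero[OF this]]
    obtain d where d: "d > 0" "\<And>y. y \<noteq> 0 \<Longrightarrow> norm y < d \<Longrightarrow> (LINT z|lborel. \<bar>f (z + y) - f z\<bar>) < e / 2"
      by (auto simp: eventually_at dist_norm)
    obtain N where N: "\<And>n. n \<ge> N \<Longrightarrow> \<epsilon> n < d"
      using order_tendstoD(2)[OF \<epsilon>(2) d(1)] by (auto simp: eventually_sequentially)
    show "\<exists>N. \<forall>n\<ge>N. norm ((LINT z|lborel. \<bar>moll (\<epsilon> n) f z - f z\<bar>) - 0) < e"
    proof (intro exI allI impI)
      fix n assume "n \<ge> N"
      have "(LINT z|lborel. 1 * \<bar>f (z + y) - f z\<bar>) \<le> e / 2" if "norm y \<le> \<epsilon> n" for y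
        using d(2)[of y] that N[OF \<open>n \<ge> N\<close>] \<open>e > 0\<close> by (cases "y = 0") auto
      from integral_moll_diff_le(2)[OF \<epsilon>(1) f c1 _ _ this] \<open>e > 0\<close>
      have "(LINT z|lborel. \<bar>moll (\<epsilon> n) f z - f z\<bar>) \<le> e / 2" by simp
      moreover have "0 \<le> (LINT z|lborel. \<bar>moll (\<epsilon> n) f z - f z\<bar>)" by simp
      ultimately show "norm ((LINT z|lborel. \<bar>moll (\<epsilon> n) f z - f z\<bar>) - 0) < e" using \<open>e > 0\<close> by simp
    qed
  qed
qed

text \<open>The sum of the \<open>L^1\<close> errors over \<open>K\<close> tends to 0, so one
  subsequence of radii serves the whole finite family. The bound by \<open>d\<close> keeps the
  kernels inside a prescribed neighbourhood.\<close>

lemma moll_AE_tendsto: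
  fixes f :: "'k \<Rightarrow> 'a::euclidean_space \<Rightarrow> real"
  assumes K: "finite K" and f: "\<And>k. k \<in> K \<Longrightarrow> integrable lborel (f k)" and "d > 0"
  obtains \<epsilon> :: "nat \<Rightarrow> real" where "\<And>n. \<epsilon> n > 0" "\<And>n. \<epsilon> n < d" "\<epsilon> \<longlonglongrightarrow> 0"
    "\<And>k. k \<in> K \<Longrightarrow> AE z in lborel. (\<lambda>n. moll (\<epsilon> n) (f k) z) \<longlonglongrightarrow> f k z"
proof -
  \<comment> \<open>The shift by 2 makes the radius smaller than \<open>d\<close> already for
    \<open>n = 0\<close>.\<close>
  define \<epsilon> where "\<epsilon> n = d / real (n + 2)" for n
  have pos: "\<epsilon> n > 0" "\<epsilon> n < d" for n using \<open>d > 0\<close> by (auto simp: \<epsilon>_def field_simps add_pos_nonneg)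
  have lim: "\<epsilon> \<longlonglongrightarrow> 0"
    using LIMSEQ_ignore_initial_segment[OF lim_const_over_n[of d], of 2]
    unfolding \<epsilon>_def by simp
  define s where "s n z = (\<Sum>k\<in>K. \<bar>moll (\<epsilon> n) (f k) z - f k z\<bar>)" for n z
  have nn: "0 \<le> s n z" for n z by (auto simp: s_def intro: sum_nonneg)
  have "integrable lborel (s n)" for n
    unfolding s_def by (intro Bochner_Integration.integrable_sum moll_L1_tendsto(1) f pos lim)
  moreover have "(\<lambda>n. LINT z|lborel. norm (s n z)) \<longlonglongrightarrow> 0"
  proof -
    have "(LINT z|lborel. norm (s n z)) = (\<Sum>k\<in>K. LINT z|lborel. \<bar>moll (\<epsilon> n) (f k) z - f k z\<bar>)" for n
      using nn by (simp add: s_def moll_L1_tendsto(1)[OF f pos(1) lim])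
    moreover have "(\<lambda>n. \<Sum>k\<in>K. LINT z|lborel. \<bar>moll (\<epsilon> n) (f k) z - f k z\<bar>) \<longlonglongrightarrow> (\<Sum>k\<in>K. 0)"
      by (intro tendsto_sum moll_L1_tendsto(2) f pos lim)
    ultimately show ?thesis by simp
  qed
  ultimately obtain r where r: "strict_mono r" "AE z in lborel. (\<lambda>n. s (r n) z) \<longlonglongrightarrow> 0"
    using tendsto_L1_AE_subseq[of lborel s] by blast
  show thesis
  proof (rule that[of "\<epsilon> \<circ> r"])
    show "(\<epsilon> \<circ> r) \<longlonglongrightarrow> 0" using LIMSEQ_subseq_LIMSEQ[OF lim r(1)] .
    fix k assume k: "k \<in> K"
    show "AE z in lborel. (\<lambda>n. moll ((\<epsilon> \<circ> r) n) (f k) z) \<longlonglongrightarrow> f k z"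
      using r(2)
    proof eventually_elim
      case (elim z)
      have "\<bar>moll (\<epsilon> (r n)) (f k) z - f k z\<bar> \<le> s (r n) z" for n
        unfolding s_def using member_le_sum[OF k, of "\<lambda>k. \<bar>moll (\<epsilon> (r n)) (f k) z - f k z\<bar>"] K by simp
      then have "(\<lambda>n. moll (\<epsilon> (r n)) (f k) z - f k z) \<longlonglongrightarrow> 0"
        by (intro Lim_null_comparison[OF _ elim]) auto
      then show ?case by (simp add: LIM_zero_iff)
    qed
  qed (use pos in auto)
qed

section \<open>Comparison of two supersolutions\<close>

definition ex :: "'n \<Rightarrow> (real^'n) \<times> real" where "ex k = (axis k 1, 0)"
definition et :: "(real^'n) \<times> real" where "et = (0, 1)"

lemma integral_mult_derivative:
  assumes f: "C1_bdd f f'" and g: "C1_bdd g g'" and S: "supp_in f (cball c r)"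
  shows "integrable lborel (\<lambda>z. f z * g' e z)" "integrable lborel (\<lambda>z. f' e z * g z)"
    "(LINT z|lborel. f z * g' e z) = - (LINT z|lborel. f' e z * g z)"
proof -
  show "(LINT z|lborel. f z * g' e z) = - (LINT z|lborel. f' e z * g z)"
    by (rule integral_by_parts[OF f g S]) auto
  show "integrable lborel (\<lambda>z. f z * g' e z)" "integrable lborel (\<lambda>z. f' e z * g z)"
    using C1_bdd_supp_deriv[OF f S, of e] S
    by (auto intro!: integrable_bdd_meas_supp[OF _ _ bounded_cball[of c r]] bdd_meas_mult
        C1_bdd_D[OF f] C1_bdd_D[OF g] simp: supp_in_def)
qed

text \<open>The sum of the two time terms is \<open>\<zeta>\<close> times the time derivative of
  \<open>\<kappa> (U + V) - G (U - V)\<close>, where \<open>G' = T\<close>.\<close>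

lemma smooth_comparison:
  fixes U V \<zeta> :: "(real^'n) \<times> real \<Rightarrow> real" and Q S :: "'n \<Rightarrow> (real^'n) \<times> real \<Rightarrow> real"
  assumes U: "C1_bdd U U'" and V: "C1_bdd V V'"
    and Q: "\<And>k. C1_bdd (Q k) (Q' k)" and S: "\<And>k. C1_bdd (S k) (S' k)"
    and \<zeta>: "C1_bdd \<zeta> \<zeta>'" "supp_in \<zeta> (cball c r)" "\<And>z. 0 \<le> \<zeta> z"
    and M: "\<And>z. \<bar>U z\<bar> \<le> M" "\<And>z. \<bar>V z\<bar> \<le> M"
    and NU: "\<And>z. z \<in> cball c r \<Longrightarrow> U' et z - (\<Sum>k\<in>UNIV. Q' k (ex k) z) \<ge> 0"
    and NV: "\<And>z. z \<in> cball c r \<Longrightarrow> V' et z - (\<Sum>k\<in>UNIV. S' k (ex k) z) \<ge> 0"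
    and G: "\<And>x. (G has_real_derivative T x) (at x)" "G 0 = 0"
    and T: "\<And>x. (T has_real_derivative \<tau> x) (at x)" "continuous_on UNIV \<tau>"
    and \<kappa>: "\<And>s. \<bar>s\<bar> \<le> 2 * M \<Longrightarrow> \<bar>T s\<bar> \<le> \<kappa>"
  shows "(LINT z|lborel. \<zeta> z * \<tau> (U z - V z) * (\<Sum>k\<in>UNIV. (Q k z - S k z) * (U' (ex k) z - V' (ex k) z)))
    \<le> 4 * M * \<kappa> * (LINT z|lborel. \<bar>\<zeta>' et z\<bar>)
      + 2 * \<kappa> * (\<Sum>k\<in>UNIV. LINT z|lborel. \<bar>\<zeta>' (ex k) z\<bar> * (\<bar>Q k z\<bar> + \<bar>S k z\<bar>))"
proof -
  define W where "W z = U z - V z" for z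
  define W' where "W' e z = U' e z - V' e z" for e z
  have W: "C1_bdd W W'" unfolding W_def[abs_def] W'_def[abs_def] by (rule C1_bdd_diff[OF U V])
  have Tc: "continuous_on UNIV T"
    by (intro continuous_at_imp_continuous_on ballI DERIV_isCont[OF T(1)])
  have TW: "C1_bdd (\<lambda>z. T (W z)) (\<lambda>e z. \<tau> (W z) * W' e z)" by (rule C1_bdd_comp[OF W T])
  have GW: "C1_bdd (\<lambda>z. G (W z)) (\<lambda>e z. T (W z) * W' e z)" by (rule C1_bdd_comp[OF W G(1) Tc])
  define \<Psi>1 where "\<Psi>1 z = \<zeta> z * (\<kappa> - T (W z))" for z
  define \<Psi>2 where "\<Psi>2 z = \<zeta> z * (\<kappa> + T (W z))" for z
  define \<Psi>1' where "\<Psi>1' e z = \<zeta>' e z * (\<kappa> - T (W z)) + \<zeta> z * (0 - \<tau> (W z) * W' e z)" for e z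
  define \<Psi>2' where "\<Psi>2' e z = \<zeta>' e z * (\<kappa> + T (W z)) + \<zeta> z * (0 + \<tau> (W z) * W' e z)" for e z
  define B where "B z = \<kappa> * (U z + V z) - G (W z)" for z
  \<comment> \<open>The shape with \<open>0 * (U z + V z)\<close> is the one the product rule
    produces; the whole equals \<open>(\<kappa> - T) * U' + (\<kappa> + T) * V'\<close>, the time
    terms of the two tests.\<close>
  define B' where "B' e z = (0 * (U z + V z) + \<kappa> * (U' e z + V' e z)) - T (W z) * W' e z" for e z
  have \<Psi>1: "C1_bdd \<Psi>1 \<Psi>1'" unfolding \<Psi>1_def[abs_def] \<Psi>1'_def[abs_def]
    by (intro C1_bdd_mult C1_bdd_diff C1_bdd_const \<zeta> TW)
  have \<Psi>2: "C1_bdd \<Psi>2 \<Psi>2'" unfolding \<Psi>2_def[abs_def] \<Psi>2'_def[abs_def]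
    by (intro C1_bdd_mult C1_bdd_add C1_bdd_const \<zeta> TW)
  have B: "C1_bdd B B'" unfolding B_def[abs_def] B'_def[abs_def]
    by (intro C1_bdd_diff C1_bdd_mult C1_bdd_add C1_bdd_const U V GW)
  have s1: "supp_in \<Psi>1 (cball c r)" and s2: "supp_in \<Psi>2 (cball c r)"
    using \<zeta>(2) by (auto simp: supp_in_def \<Psi>1_def \<Psi>2_def)
  have M0: "0 \<le> M" using M(1)[of 0] by (meson abs_ge_zero order_trans)
  have W2: "\<bar>W z\<bar> \<le> 2 * M" for z using M(1)[of z] M(2)[of z] by (simp add: W_def)
  have T\<kappa>: "\<bar>T (W z)\<bar> \<le> \<kappa>" for z by (rule \<kappa>[OF W2])
  have \<kappa>0: "0 \<le> \<kappa>" using T\<kappa>[of 0] by simp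
  \<comment> \<open>Mean value inequality for \<open>G\<close>, whose derivative \<open>T\<close> is
    at most \<kappa> in absolute value on the range of \<open>W\<close>.\<close>
  have GB: "\<bar>G (W z)\<bar> \<le> 2 * M * \<kappa>" for z
  proof -
    have "norm (G (W z) - G 0) \<le> \<kappa> * norm (W z - 0)"
    proof (rule field_differentiable_bound[of "{- (2*M)..2*M}"])
      show "norm (T x) \<le> \<kappa>" if "x \<in> {- (2*M)..2*M}" for x using \<kappa>[of x] that by (simp add: abs_le_iff)
    qed (use G M0 W2[of z] in \<open>auto simp: abs_le_iff intro: has_field_derivative_at_within\<close>)
    also have "\<dots> \<le> \<kappa> * (2 * M)" using W2[of z] \<kappa>0 by (intro mult_left_mono) auto
    finally show ?thesis using G(2) by (simp add: algebra_simps)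
  qed
  have BB: "\<bar>B z\<bar> \<le> 4 * M * \<kappa>" for z
  proof -
    have "\<bar>\<kappa> * (U z + V z)\<bar> \<le> \<kappa> * (2 * M)"
      using M(1)[of z] M(2)[of z] \<kappa>0 by (auto simp: abs_mult intro!: mult_left_mono)
    then show ?thesis using GB[of z] unfolding B_def by (simp add: algebra_simps)
  qed
  note i1 = integral_mult_derivative[OF \<Psi>1 Q s1] and i2 = integral_mult_derivative[OF \<Psi>2 S s2]
    and ib = integral_mult_derivative[OF \<zeta>(1) B \<zeta>(2)]
  \<comment> \<open>\<open>I\<close> is the monotone term to be estimated; \<open>J k\<close>
    collects what remains when the spatial derivative hits \<zeta>.\<close>
  define I where "I z = \<zeta> z * \<tau> (W z) * (\<Sum>k\<in>UNIV. (Q k z - S k z) * W' (ex k) z)" for z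
  define J where "J k z = \<zeta>' (ex k) z * ((\<kappa> - T (W z)) * Q k z + (\<kappa> + T (W z)) * S k z)" for k z
  have bq: "bdd_meas (Q k)" "bdd_meas (S k)" for k using Q S C1_bdd_D by blast+
  have bT: "bdd_meas (\<lambda>z. T (W z))" "bdd_meas (\<lambda>z. \<tau> (W z))"
    using C1_bdd_D(1)[OF TW] bdd_meas_comp[OF C1_bdd_D(1)[OF W] T(2)] by auto
  have intI: "integrable lborel I" unfolding I_def[abs_def]
    by (rule integrable_bdd_meas_supp[OF _ _ bounded_cball[of c r]])
      (intro bdd_meas_mult bdd_meas_sum bdd_meas_diff bq bT C1_bdd_D(1)[OF \<zeta>(1)] C1_bdd_D(2)[OF W],
       use \<zeta>(2) in \<open>auto simp: supp_in_def\<close>)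
  have sd: "supp_in (\<zeta>' e) (cball c r)" for e by (rule C1_bdd_supp_deriv[OF \<zeta>(1,2)]) simp
  have intJ: "integrable lborel (J k)" for k unfolding J_def[abs_def]
    by (rule integrable_bdd_meas_supp[OF _ _ bounded_cball[of c r]])
      (intro bdd_meas_mult bdd_meas_add bdd_meas_diff bdd_meas_const bq bT C1_bdd_D(2)[OF \<zeta>(1)],
       use sd in \<open>auto simp: supp_in_def\<close>)
  \<comment> \<open>The two tested inequalities, added before any integration by parts; the
    integrand is nonnegative at every point.\<close>
  have "0 \<le> (LINT z|lborel. \<zeta> z * B' et z - (\<Sum>k\<in>UNIV. \<Psi>1 z * Q' k (ex k) z + \<Psi>2 z * S' k (ex k) z))"
  proof (rule Bochner_Integration.integral_nonneg)
    fix z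
    have eq: "\<zeta> z * B' et z - (\<Sum>k\<in>UNIV. \<Psi>1 z * Q' k (ex k) z + \<Psi>2 z * S' k (ex k) z)
      = \<zeta> z * ((\<kappa> - T (W z)) * (U' et z - (\<Sum>k\<in>UNIV. Q' k (ex k) z)) + (\<kappa> + T (W z)) * (V' et z - (\<Sum>k\<in>UNIV. S' k (ex k) z)))"
    proof -
      have "(\<Sum>k\<in>UNIV. \<Psi>1 z * Q' k (ex k) z + \<Psi>2 z * S' k (ex k) z)
        = \<Psi>1 z * (\<Sum>k\<in>UNIV. Q' k (ex k) z) + \<Psi>2 z * (\<Sum>k\<in>UNIV. S' k (ex k) z)"
        by (simp only: sum.distrib sum_distrib_left)
      then show ?thesis by (simp add: B'_def W'_def \<Psi>1_def \<Psi>2_def algebra_simps)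
    qed
    show "0 \<le> \<zeta> z * B' et z - (\<Sum>k\<in>UNIV. \<Psi>1 z * Q' k (ex k) z + \<Psi>2 z * S' k (ex k) z)"
    proof (cases "z \<in> cball c r")
      case True
      have "0 \<le> \<kappa> - T (W z)" "0 \<le> \<kappa> + T (W z)" using T\<kappa>[of z] by (auto simp: abs_le_iff)
      then show ?thesis unfolding eq using NU[OF True] NV[OF True] \<zeta>(3)[of z]
        by (intro mult_nonneg_nonneg add_nonneg_nonneg[OF mult_nonneg_nonneg mult_nonneg_nonneg])
    next
      case False
      then show ?thesis unfolding eq using supp_inD[OF \<zeta>(2) False] by simp
    qed
  qed
  also have "\<dots> = (LINT z|lborel. \<zeta> z * B' et z)
      - (\<Sum>k\<in>UNIV. (LINT z|lborel. \<Psi>1 z * Q' k (ex k) z) + (LINT z|lborel. \<Psi>2 z * S' k (ex k) z))"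
    using i1(1) i2(1) ib(1) by simp
  also have "\<dots> = - (LINT z|lborel. \<zeta>' et z * B z)
      + (\<Sum>k\<in>UNIV. (LINT z|lborel. \<Psi>1' (ex k) z * Q k z) + (LINT z|lborel. \<Psi>2' (ex k) z * S k z))"
    unfolding i1(3) i2(3) ib(3) sum.distrib sum_negf by simp
  also have "(\<Sum>k\<in>UNIV. (LINT z|lborel. \<Psi>1' (ex k) z * Q k z) + (LINT z|lborel. \<Psi>2' (ex k) z * S k z))
     = (LINT z|lborel. (\<Sum>k\<in>UNIV. \<Psi>1' (ex k) z * Q k z + \<Psi>2' (ex k) z * S k z))"
    using i1(2) i2(2) by simp
  also have "\<dots> = (LINT z|lborel. (\<Sum>k\<in>UNIV. J k z) - I z)"
  proof (rule Bochner_Integration.integral_cong[OF refl])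
    fix z
    have "\<Psi>1' (ex k) z * Q k z + \<Psi>2' (ex k) z * S k z = J k z - \<zeta> z * \<tau> (W z) * ((Q k z - S k z) * W' (ex k) z)" for k
      by (simp add: \<Psi>1'_def \<Psi>2'_def J_def algebra_simps)
    then show "(\<Sum>k\<in>UNIV. \<Psi>1' (ex k) z * Q k z + \<Psi>2' (ex k) z * S k z) = (\<Sum>k\<in>UNIV. J k z) - I z"
      by (simp add: I_def sum_subtractf sum_distrib_left)
  qed
  also have "\<dots> = (\<Sum>k\<in>UNIV. LINT z|lborel. J k z) - (LINT z|lborel. I z)"
    using intI intJ by simp
  finally have main: "(LINT z|lborel. I z) \<le> - (LINT z|lborel. \<zeta>' et z * B z) + (\<Sum>k\<in>UNIV. LINT z|lborel. J k z)"
    by simp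
  have b1: "- (LINT z|lborel. \<zeta>' et z * B z) \<le> 4 * M * \<kappa> * (LINT z|lborel. \<bar>\<zeta>' et z\<bar>)"
  proof -
    have "- (LINT z|lborel. \<zeta>' et z * B z) = (LINT z|lborel. - (\<zeta>' et z * B z))" by simp
    also have "\<dots> \<le> (LINT z|lborel. 4 * M * \<kappa> * \<bar>\<zeta>' et z\<bar>)"
    proof (rule integral_mono)
      show "integrable lborel (\<lambda>z. 4 * M * \<kappa> * \<bar>\<zeta>' et z\<bar>)"
        by (intro integrable_mult_right integrable_abs
            integrable_bdd_meas_supp[OF C1_bdd_D(2)[OF \<zeta>(1)] sd bounded_cball])
      fix z
      have "- (\<zeta>' et z * B z) \<le> \<bar>\<zeta>' et z\<bar> * \<bar>B z\<bar>" by (metis abs_ge_minus_self abs_mult)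
      also have "\<dots> \<le> \<bar>\<zeta>' et z\<bar> * (4 * M * \<kappa>)" by (intro mult_left_mono BB) auto
      finally show "- (\<zeta>' et z * B z) \<le> 4 * M * \<kappa> * \<bar>\<zeta>' et z\<bar>" by (simp add: mult.commute)
    qed (use ib(2) in auto)
    finally show ?thesis by simp
  qed
  have b2: "(LINT z|lborel. J k z) \<le> 2 * \<kappa> * (LINT z|lborel. \<bar>\<zeta>' (ex k) z\<bar> * (\<bar>Q k z\<bar> + \<bar>S k z\<bar>))" for k
  proof -
    have "(LINT z|lborel. J k z) \<le> (LINT z|lborel. 2 * \<kappa> * (\<bar>\<zeta>' (ex k) z\<bar> * (\<bar>Q k z\<bar> + \<bar>S k z\<bar>)))"
    proof (rule integral_mono[OF intJ])
      show "integrable lborel (\<lambda>z. 2 * \<kappa> * (\<bar>\<zeta>' (ex k) z\<bar> * (\<bar>Q k z\<bar> + \<bar>S k z\<bar>)))"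
        by (rule integrable_mult_right, rule integrable_bdd_meas_supp[OF _ _ bounded_cball[of c r]])
          (intro bdd_meas_mult bdd_meas_add bdd_meas_abs bq C1_bdd_D(2)[OF \<zeta>(1)],
           use sd in \<open>auto simp: supp_in_def\<close>)
      fix z
      have "\<bar>(\<kappa> - T (W z)) * Q k z + (\<kappa> + T (W z)) * S k z\<bar> \<le> (2 * \<kappa>) * \<bar>Q k z\<bar> + (2 * \<kappa>) * \<bar>S k z\<bar>"
        using T\<kappa>[of z] by (intro order_trans[OF abs_triangle_ineq] add_mono) (auto simp: abs_mult abs_le_iff intro!: mult_right_mono)
      from mult_left_mono[OF this, of "\<bar>\<zeta>' (ex k) z\<bar>"]
      have "\<bar>J k z\<bar> \<le> \<bar>\<zeta>' (ex k) z\<bar> * ((2 * \<kappa>) * \<bar>Q k z\<bar> + (2 * \<kappa>) * \<bar>S k z\<bar>)"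
        by (simp add: J_def abs_mult)
      then show "J k z \<le> 2 * \<kappa> * (\<bar>\<zeta>' (ex k) z\<bar> * (\<bar>Q k z\<bar> + \<bar>S k z\<bar>))"
        by (simp add: algebra_simps)
    qed
    then show ?thesis by simp
  qed
  have "(\<Sum>k\<in>UNIV. LINT z|lborel. J k z) \<le> 2 * \<kappa> * (\<Sum>k\<in>UNIV. LINT z|lborel. \<bar>\<zeta>' (ex k) z\<bar> * (\<bar>Q k z\<bar> + \<bar>S k z\<bar>))"
    unfolding sum_distrib_left by (intro sum_mono b2)
  with main b1 show ?thesis unfolding I_def W_def W'_def by linarith
qed

section \<open>The flux and elementary inequalities for powers\<close>

definition flux :: "real \<Rightarrow> real^'n \<Rightarrow> real^'n" where
  "flux p a = norm a powr (p - 2) *\<^sub>R a"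

lemma norm_flux: assumes "p > 2" shows "norm (flux p a) = norm a powr (p - 1)"
proof (cases "a = 0")
  case False
  have "norm a * norm a powr (p - 2) = norm a powr (1 + (p - 2))"
    by (rule powr_mult_base) simp
  then show ?thesis by (simp add: flux_def mult.commute)
qed (use assms in \<open>auto simp: flux_def\<close>)

lemma flux_inner: assumes "p > 2" shows "flux p a \<bullet> a = norm a powr p"
proof (cases "a = 0")
  case False
  then have "norm a powr p = norm a powr (p - 2) * norm a powr 2"
    by (simp add: powr_add[symmetric] del: powr_numeral)
  then show ?thesis using False by (simp add: flux_def power2_norm_eq_inner[symmetric] powr_numeral)
qed (use assms in \<open>auto simp: flux_def\<close>)

lemma powr_le_one_plus: assumes "0 \<le> x" "0 < q" "q \<le> p" shows "x powr q \<le> 1 + x powr (p::real)"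
proof (cases "x \<le> 1")
  case True
  then have "x powr q \<le> 1" using assms powr_mono2[of q x 1] by simp
  then show ?thesis by (simp add: add_increasing2)
next
  case False
  then have "x powr q \<le> x powr p" using assms by (intro powr_mono) auto
  then show ?thesis by simp
qed

text \<open>Both arguments are replaced by their maximum: a Young inequality without sharp
  constants.\<close>

lemma powr_mult_le_add:
  assumes "0 \<le> x" "0 \<le> y" "1 < p" shows "x powr (p - 1) * y \<le> x powr p + y powr (p::real)"
proof -
  define m where "m = max x y"
  have "x powr (p - 1) * y \<le> m powr (p - 1) * m"
    using assms by (intro mult_mono powr_mono2) (auto simp: m_def)
  also have "\<dots> = m powr p"
  proof (cases "m = 0")
    case False
    then have "m > 0" using assms by (auto simp: m_def max_def split: if_splits)
    have "m powr (p - 1) * m powr 1 = m powr p" by (simp add: powr_add[symmetric] del: powr_one')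
    then show ?thesis using \<open>m > 0\<close> by simp
  qed (use assms in auto)
  also have "\<dots> \<le> x powr p + y powr p" by (auto simp: m_def max_def)
  finally show ?thesis .
qed

lemma moll_diff:
  assumes "\<epsilon> > 0" "integrable lborel f" "integrable lborel g"
  shows "moll \<epsilon> (\<lambda>w. f w - g w) z = moll \<epsilon> f z - moll \<epsilon> g z"
  using integrable_moll(1)[OF assms(1,2)] integrable_moll(1)[OF assms(1,3)]
  by (simp add: moll_def right_diff_distrib)

text \<open>The right-hand side of the comparison has this form, with \<open>f\<close> a component
  of a flux, so convergence in \<open>L^1\<close> suffices there.\<close>

lemma moll_weighted_tendsto:
  fixes f :: "'a::euclidean_space \<Rightarrow> real"
  assumes f: "integrable lborel f" and w: "bdd_meas w" and \<epsilon>: "\<And>n. \<epsilon> n > 0" "\<epsilon> \<longlonglongrightarrow> 0"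
  shows "(\<lambda>n. LINT z|lborel. w z * \<bar>moll (\<epsilon> n) f z\<bar>) \<longlonglongrightarrow> (LINT z|lborel. w z * \<bar>f z\<bar>)"
proof -
  have [measurable]: "f \<in> borel_measurable borel" using f by auto
  obtain C where C: "C \<ge> 0" "\<And>z. \<bar>w z\<bar> \<le> C" using bdd_meas_bound[OF w] by blast
  have d: "integrable lborel (\<lambda>z. \<bar>moll (\<epsilon> n) f z - f z\<bar>)" for n
    by (rule moll_L1_tendsto(1)[OF f \<epsilon>])
  have m: "integrable lborel (moll (\<epsilon> n) f)" for n
    by (rule Bochner_Integration.integrable_bound[OF Bochner_Integration.integrable_add[OF d[of n] integrable_abs[OF f]]]) auto
  have i: "integrable lborel (\<lambda>z. w z * \<bar>moll (\<epsilon> n) f z\<bar>)" "integrable lborel (\<lambda>z. w z * \<bar>f z\<bar>)" for n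
    by (intro integrable_bdd_meas_mult[OF w] integrable_abs m f)+
  have "(\<lambda>n. (LINT z|lborel. w z * \<bar>moll (\<epsilon> n) f z\<bar>) - (LINT z|lborel. w z * \<bar>f z\<bar>)) \<longlonglongrightarrow> 0"
  proof (rule Lim_null_comparison)
    show "(\<lambda>n. C * (LINT z|lborel. \<bar>moll (\<epsilon> n) f z - f z\<bar>)) \<longlonglongrightarrow> 0"
      using tendsto_mult_left[OF moll_L1_tendsto(2)[OF f \<epsilon>], of C] by simp
    show "\<forall>\<^sub>F n in sequentially. norm ((LINT z|lborel. w z * \<bar>moll (\<epsilon> n) f z\<bar>) - (LINT z|lborel. w z * \<bar>f z\<bar>))
      \<le> C * (LINT z|lborel. \<bar>moll (\<epsilon> n) f z - f z\<bar>)"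
    proof (intro always_eventually allI)
      fix n
      have "norm ((LINT z|lborel. w z * \<bar>moll (\<epsilon> n) f z\<bar>) - (LINT z|lborel. w z * \<bar>f z\<bar>))
        = norm (LINT z|lborel. w z * \<bar>moll (\<epsilon> n) f z\<bar> - w z * \<bar>f z\<bar>)"
        using i by simp
      also have "\<dots> \<le> (LINT z|lborel. norm (w z * \<bar>moll (\<epsilon> n) f z\<bar> - w z * \<bar>f z\<bar>))"
        by (rule integral_norm_bound)
      also have "\<dots> \<le> (LINT z|lborel. C * \<bar>moll (\<epsilon> n) f z - f z\<bar>)"
      proof (rule integral_mono)
        fix z
        have "norm (w z * \<bar>moll (\<epsilon> n) f z\<bar> - w z * \<bar>f z\<bar>) = \<bar>w z\<bar> * \<bar>\<bar>moll (\<epsilon> n) f z\<bar> - \<bar>f z\<bar>\<bar>"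
          by (simp add: abs_mult right_diff_distrib[symmetric])
        also have "\<dots> \<le> C * \<bar>moll (\<epsilon> n) f z - f z\<bar>"
          using C by (intro mult_mono) auto
        finally show "norm (w z * \<bar>moll (\<epsilon> n) f z\<bar> - w z * \<bar>f z\<bar>) \<le> C * \<bar>moll (\<epsilon> n) f z - f z\<bar>" .
      qed (use i d in auto)
      finally show "norm ((LINT z|lborel. w z * \<bar>moll (\<epsilon> n) f z\<bar>) - (LINT z|lborel. w z * \<bar>f z\<bar>))
        \<le> C * (LINT z|lborel. \<bar>moll (\<epsilon> n) f z - f z\<bar>)" by simp
    qed
  qed
  then show ?thesis by (simp add: LIM_zero_iff)
qed

text \<open>A common bound for the components of the gradient, of the flux, and of their products.\<close>

definition energy :: "real \<Rightarrow> (real^'n) \<times> real \<Rightarrow> real \<Rightarrow> ((real^'n) \<times> real \<Rightarrow> real^'n) \<Rightarrow> (real^'n) \<times> real \<Rightarrow> real" where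
  "energy p c R g z = indicat_real (ball c R) z * (1 + norm (g z) powr p)"

text \<open>Borel representatives, cut off to a ball so that convolutions over the whole space make sense.\<close>

locale ball_supersol =
  fixes p M R :: real and c :: "(real^'n) \<times> real" and u :: "(real^'n) \<times> real \<Rightarrow> real"
    and g :: "(real^'n) \<times> real \<Rightarrow> real^'n"
  assumes p: "p > 2" and R: "R > 0"
    and mu: "u \<in> borel_measurable borel" and mg: "g \<in> borel_measurable borel"
    and uM: "\<And>z. \<bar>u z\<bar> \<le> M"
    and out: "\<And>z. z \<notin> ball c R \<Longrightarrow> u z = 0" "\<And>z. z \<notin> ball c R \<Longrightarrow> g z = 0"
    and gp: "integrable lborel (\<lambda>z. norm (g z) powr p)"
    and weak_grad: "\<And>\<phi> k. test_fun (ball c R) \<phi> \<Longrightarrow>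
       (LINT z|lborel. u z * gradx \<phi> z $ k) = - (LINT z|lborel. g z $ k * \<phi> z)"
    and weak_eq: "\<And>\<phi>. test_fun (ball c R) \<phi> \<Longrightarrow> (\<And>z. 0 \<le> \<phi> z) \<Longrightarrow>
       0 \<le> - (LINT z|lborel. u z * dt \<phi> z) + (LINT z|lborel. flux p (g z) \<bullet> gradx \<phi> z)"
begin

lemma M_nonneg: "0 \<le> M" using uM[of 0] by (meson abs_ge_zero order_trans)

lemma measurable_flux [measurable]: "(\<lambda>z. flux p (g z)) \<in> borel_measurable borel"
  using mg unfolding flux_def by measurable

lemma measurable_components [measurable]:
  "(\<lambda>z. g z $ k) \<in> borel_measurable borel" "(\<lambda>z. flux p (g z) $ k) \<in> borel_measurable borel"
  using measurable_compose[OF mg borel_measurable_nth] measurable_compose[OF measurable_flux borel_measurable_nth]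
  by auto

lemma integrable_indicator_ball: "integrable lborel (indicat_real (ball c R))"
  using emeasure_bounded_finite[OF bounded_ball, of c R]
  by (intro integrable_real_indicator) auto

lemma integrable_energy: "integrable lborel (energy p c R g)"
proof -
  have "energy p c R g = (\<lambda>z. indicat_real (ball c R) z + norm (g z) powr p)"
    using p out(2) by (auto simp: energy_def indicator_def fun_eq_iff)
  then show ?thesis using integrable_indicator_ball gp by simp
qed

lemma energy_nonneg: "0 \<le> energy p c R g z"
  by (simp add: energy_def)

text \<open>The summand 1 in \<open>energy\<close> absorbs the exponents 1 and \<open>p - 1\<close>,
  which lie below \<open>p\<close>.\<close>

lemma component_le_energy: "\<bar>g z $ k\<bar> \<le> energy p c R g z" "\<bar>flux p (g z) $ k\<bar> \<le> energy p c R g z"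
proof -
  show "\<bar>g z $ k\<bar> \<le> energy p c R g z"
  proof (cases "z \<in> ball c R")
    case True
    then show ?thesis using component_le_norm_cart[of "g z" k] powr_le_one_plus[of "norm (g z)" 1 p] p
      by (simp add: energy_def)
  qed (simp add: out energy_def)
  show "\<bar>flux p (g z) $ k\<bar> \<le> energy p c R g z"
  proof (cases "z \<in> ball c R")
    case True
    then show ?thesis using component_le_norm_cart[of "flux p (g z)" k] powr_le_one_plus[of "norm (g z)" "p - 1" p] p
      by (simp add: energy_def norm_flux)
  qed (simp add: out energy_def flux_def)
qed

lemma powr_le_energy: "norm (g z) powr p \<le> energy p c R g z"
  using p out(2)[of z] by (cases "z \<in> ball c R") (auto simp: energy_def)

lemma integrable_u: "integrable lborel u"
  by (rule Bochner_Integration.integrable_bound[OF integrable_mult_right[OF integrable_indicator_ball, of M]])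
    (use mu uM out(1) M_nonneg in \<open>auto simp: indicator_def\<close>)

lemma integrable_components:
  "integrable lborel (\<lambda>z. g z $ k)" "integrable lborel (\<lambda>z. flux p (g z) $ k)"
  using component_le_energy
  by (auto intro!: Bochner_Integration.integrable_bound[OF integrable_energy] simp: energy_nonneg)

text \<open>The kernel at \<open>z\<close> is supported in \<open>cball z \<epsilon>\<close>, which
  the distance condition places inside \<open>ball c R\<close>.\<close>

lemma test_fun_mollker:
  assumes "\<epsilon> > 0" "dist c z + \<epsilon> < R"
  shows "test_fun (ball c R) (\<lambda>w. mollker \<epsilon> (z - w))"
proof -
  have "{w. mollker \<epsilon> (z - w) \<noteq> 0} \<subseteq> cball z \<epsilon>"
  proof
    fix w assume "w \<in> {w. mollker \<epsilon> (z - w) \<noteq> 0}"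
    then have "z - w \<in> cball 0 \<epsilon>" using supp_inD[OF supp_in_mollker[OF assms(1)]] by blast
    then show "w \<in> cball z \<epsilon>" by (simp add: dist_norm norm_minus_commute)
  qed
  then have *: "closure {w. mollker \<epsilon> (z - w) \<noteq> 0} \<subseteq> cball z \<epsilon>" by (rule closure_minimal) simp
  moreover have "cball z \<epsilon> \<subseteq> ball c R"
  proof
    fix w assume "w \<in> cball z \<epsilon>"
    then show "w \<in> ball c R" using dist_triangle[of c w z] assms(2) by (simp add: mem_ball mem_cball)
  qed
  moreover have "compact (closure {w. mollker \<epsilon> (z - w) \<noteq> 0})"
    by (simp add: compact_eq_bounded_closed bounded_subset[OF bounded_cball *])
  moreover have "smooth (\<lambda>w. mollker \<epsilon> (z - w))"
    using smooth_bump[of \<epsilon> z] unfolding smooth_def mollker_def divide_inverse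
    by (intro allI C_k_mult C_k_const) auto
  ultimately show ?thesis by (auto simp: test_fun_def)
qed

lemma frechet_mollker: "frechet_derivative (\<lambda>w. mollker \<epsilon> (z - w)) (at w) e = - dmollker \<epsilon> e (z - (w::(real^'n) \<times> real))"
proof -
  have "((\<lambda>w. mollker \<epsilon> (z - w)) has_derivative (\<lambda>e. - dmollker \<epsilon> e (z - w))) (at w)"
    unfolding mollker_def dmollker_def divide_inverse
    using has_derivative_mult_left[OF bump_has_derivative[of \<epsilon> z w]] by simp
  from frechet_derivative_at[OF this] show ?thesis by (metis)
qed

text \<open>Testing with the kernel: the sign from differentiating in \<open>w\<close> instead of
  \<open>z\<close> cancels the sign in the definition of the weak gradient.\<close>

lemma moll_weak_grad:
  assumes "\<epsilon> > 0" "dist c z + \<epsilon> < R"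
  shows "dmoll \<epsilon> u (ex k) z = moll \<epsilon> (\<lambda>z. g z $ k) z"
proof -
  have "gradx (\<lambda>w. mollker \<epsilon> (z - w)) w $ k = - dmollker \<epsilon> (ex k) (z - w)" for w
    by (simp add: gradx_def frechet_mollker ex_def)
  then show ?thesis using weak_grad[OF test_fun_mollker[OF assms], of k]
    by (simp add: dmoll_def moll_def mult.commute)
qed

text \<open>The kernel is a nonnegative test function, so the weak inequality becomes a pointwise
  one. The flux is mollified as a whole; it is not the flux of the mollified gradient.\<close>

lemma moll_supersol:
  assumes "\<epsilon> > 0" "dist c z + \<epsilon> < R"
  shows "0 \<le> dmoll \<epsilon> u et z - (\<Sum>k\<in>UNIV. dmoll \<epsilon> (\<lambda>z. flux p (g z) $ k) (ex k) z)"
proof -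
  have 1: "gradx (\<lambda>w. mollker \<epsilon> (z - w)) w $ k = - dmollker \<epsilon> (ex k) (z - w)" for w k
    by (simp add: gradx_def frechet_mollker ex_def)
  have 2: "dt (\<lambda>w. mollker \<epsilon> (z - w)) w = - dmollker \<epsilon> et (z - w)" for w
    by (simp add: dt_def frechet_mollker et_def)
  have "flux p (g w) \<bullet> gradx (\<lambda>w. mollker \<epsilon> (z - w)) w = - (\<Sum>k\<in>UNIV. dmollker \<epsilon> (ex k) (z - w) * flux p (g w) $ k)" for w
    by (simp add: inner_vec_def 1 sum_negf mult.commute)
  then have "(LINT w|lborel. flux p (g w) \<bullet> gradx (\<lambda>w. mollker \<epsilon> (z - w)) w)
    = - (\<Sum>k\<in>UNIV. dmoll \<epsilon> (\<lambda>z. flux p (g z) $ k) (ex k) z)"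
    using integrable_moll(2)[OF assms(1) integrable_components(2)] by (simp add: dmoll_def)
  then show ?thesis using weak_eq[OF test_fun_mollker[OF assms] mollker_nonneg[OF assms(1)]]
    by (simp add: dmoll_def 2 mult.commute)
qed

end

text \<open>Both functions are mollified with the same radii, which then tend to 0 in
  \<open>smooth_comparison\<close>. On the left the products of fluxes and gradients are dominated
  by mollified energies, which converge in \<open>L^1\<close>; on the right each flux component
  converges in \<open>L^1\<close>.\<close>

lemma comparison:
  fixes \<zeta> :: "(real^'n) \<times> real \<Rightarrow> real"
  assumes su: "ball_supersol p M R c u g" and sv: "ball_supersol p M R c v h"
    and r: "r < R" and \<zeta>: "C1_bdd \<zeta> \<zeta>'" "supp_in \<zeta> (cball c r)" "\<And>z. 0 \<le> \<zeta> z"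
    and G: "\<And>x. (G has_real_derivative T x) (at x)" "G 0 = 0"
    and T: "\<And>x. (T has_real_derivative \<tau> x) (at x)" "continuous_on UNIV \<tau>"
    and \<kappa>: "\<And>s. \<bar>s\<bar> \<le> 2 * M \<Longrightarrow> \<bar>T s\<bar> \<le> \<kappa>"
  shows "integrable lborel (\<lambda>z. \<zeta> z * \<tau> (u z - v z) * ((flux p (g z) - flux p (h z)) \<bullet> (g z - h z)))"
    "(LINT z|lborel. \<zeta> z * \<tau> (u z - v z) * ((flux p (g z) - flux p (h z)) \<bullet> (g z - h z)))
    \<le> 4 * M * \<kappa> * (LINT z|lborel. \<bar>\<zeta>' et z\<bar>)
      + 2 * \<kappa> * (\<Sum>k\<in>UNIV. LINT z|lborel. \<bar>\<zeta>' (ex k) z\<bar> * (\<bar>flux p (g z) $ k\<bar> + \<bar>flux p (h z) $ k\<bar>))"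
proof -
  interpret u: ball_supersol p M R c u g by fact
  interpret v: ball_supersol p M R c v h by fact
  note [measurable] = u.mu v.mu u.mg v.mg bdd_measD[OF C1_bdd_D(1)[OF \<zeta>(1)]]
  have [measurable]: "\<tau> \<in> borel_measurable borel" by (rule borel_measurable_continuous_onI[OF T(2)])
  define H where "H z = energy p c R g z + energy p c R h z" for z
  have iH: "integrable lborel H" unfolding H_def using u.integrable_energy v.integrable_energy by simp
  have H0: "0 \<le> H z" for z unfolding H_def using u.energy_nonneg v.energy_nonneg by simp
  define Au where "Au k z = flux p (g z) $ k" for k z
  define Av where "Av k z = flux p (h z) $ k" for k z
  define gu where "gu k z = g z $ k" for k z
  define gv where "gv k z = h z $ k" for k z
  note defs = Au_def[abs_def] Av_def[abs_def] gu_def[abs_def] gv_def[abs_def]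
  have int: "integrable lborel (Au k)" "integrable lborel (Av k)" "integrable lborel (gu k)" "integrable lborel (gv k)" for k
    unfolding defs by (intro u.integrable_components v.integrable_components)+
  \<comment> \<open>Four products of a flux with a gradient, each at most \<open>H w + H w'\<close>;
    two different points occur because the kernel averages each factor separately.\<close>
  have cross: "\<bar>Au k w - Av k w\<bar> * \<bar>gu k w' - gv k w'\<bar> \<le> 4 * H w + 4 * H w'" for k w w'
  proof -
    have aux: "norm (flux p (a w)) * norm (b w') \<le> H w + H w'"
      if "a = g \<or> a = h" "b = g \<or> b = h" for a b
    proof -
      have "norm (flux p (a w)) * norm (b w') \<le> norm (a w) powr p + norm (b w') powr p"
        using powr_mult_le_add[of "norm (a w)" "norm (b w')" p] u.p by (simp add: norm_flux)
      moreover have "norm (a w) powr p \<le> H w"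
        using that(1) u.powr_le_energy[of w] v.powr_le_energy[of w] u.energy_nonneg[of w] v.energy_nonneg[of w]
        by (auto simp: H_def)
      moreover have "norm (b w') powr p \<le> H w'"
        using that(2) u.powr_le_energy[of w'] v.powr_le_energy[of w'] u.energy_nonneg[of w'] v.energy_nonneg[of w']
        by (auto simp: H_def)
      ultimately show ?thesis by linarith
    qed
    have "\<bar>Au k w - Av k w\<bar> \<le> norm (flux p (g w)) + norm (flux p (h w))"
      using component_le_norm_cart[of "flux p (g w)" k] component_le_norm_cart[of "flux p (h w)" k]
      by (simp add: Au_def Av_def)
    moreover have "\<bar>gu k w' - gv k w'\<bar> \<le> norm (g w') + norm (h w')"
      using component_le_norm_cart[of "g w'" k] component_le_norm_cart[of "h w'" k]
      by (simp add: gu_def gv_def)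
    ultimately have "\<bar>Au k w - Av k w\<bar> * \<bar>gu k w' - gv k w'\<bar>
      \<le> (norm (flux p (g w)) + norm (flux p (h w))) * (norm (g w') + norm (h w'))"
      by (intro mult_mono) auto
    also have "\<dots> \<le> 4 * H w + 4 * H w'"
      using aux[of g g] aux[of g h] aux[of h g] aux[of h h] by (simp add: algebra_simps)
    finally show ?thesis .
  qed
  \<comment> \<open>One family over a finite index set, so that a single sequence of radii gives
    convergence of all six kinds of functions.\<close>
  define F where "F i k = (if i = (0::nat) then u else if i = 1 then v else if i = 2 then Au k else
      if i = 3 then Av k else if i = 4 then gu k else gv k)" for i and k :: 'n
  have iF: "integrable lborel (F (fst j) (snd j))" for j
    unfolding F_def using int u.integrable_u v.integrable_u by simp
  obtain \<epsilon> :: "nat \<Rightarrow> real" where \<epsilon>: "\<And>n. \<epsilon> n > 0" "\<And>n. \<epsilon> n < R - r" "\<epsilon> \<longlonglongrightarrow> 0"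
    and conv: "\<And>j. j \<in> {0..5} \<times> UNIV \<Longrightarrow> AE z in lborel. (\<lambda>n. moll (\<epsilon> n) (F (fst j) (snd j)) z) \<longlonglongrightarrow> F (fst j) (snd j) z"
  proof (rule moll_AE_tendsto[of "{0..5::nat} \<times> (UNIV :: 'n set)" "\<lambda>j. F (fst j) (snd j)" "R - r"])
  qed (use iF r in auto)
  have allconv: "AE z in lborel. \<forall>j\<in>{0..5}\<times>UNIV. (\<lambda>n. moll (\<epsilon> n) (F (fst j) (snd j)) z) \<longlonglongrightarrow> F (fst j) (snd j) z"
    by (rule AE_finite_allI[OF _ conv]) auto
  define L where "L n z = \<zeta> z * \<tau> (moll (\<epsilon> n) u z - moll (\<epsilon> n) v z) *
     (\<Sum>k\<in>UNIV. (moll (\<epsilon> n) (Au k) z - moll (\<epsilon> n) (Av k) z) * (moll (\<epsilon> n) (gu k) z - moll (\<epsilon> n) (gv k) z))" for n z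
  define L0 where "L0 z = \<zeta> z * \<tau> (u z - v z) * (\<Sum>k\<in>UNIV. (Au k z - Av k z) * (gu k z - gv k z))" for z
  obtain C\<zeta> where C\<zeta>: "C\<zeta> \<ge> 0" "\<And>z. \<bar>\<zeta> z\<bar> \<le> C\<zeta>" using bdd_meas_bound[OF C1_bdd_D(1)[OF \<zeta>(1)]] by blast
  \<comment> \<open>Mollification preserves the bound \<open>M\<close>, so \<tau> is only evaluated
    on this compact interval.\<close>
  have "compact (\<tau> ` {-(2*M)..2*M})"
    using T(2) by (intro compact_continuous_image) (auto intro: continuous_on_subset)
  then have "bounded (\<tau> ` {-(2*M)..2*M})" by (rule compact_imp_bounded)
  then obtain C where "\<forall>x\<in>\<tau> ` {-(2*M)..2*M}. norm x \<le> C" unfolding bounded_iff by blast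
  then have C: "\<bar>\<tau> (a - b)\<bar> \<le> \<bar>C\<bar>" if "\<bar>a\<bar> \<le> M" "\<bar>b\<bar> \<le> M" for a b
  proof -
    have "a - b \<in> {-(2*M)..2*M}" using that by auto
    then have "norm (\<tau> (a - b)) \<le> C" using \<open>\<forall>x\<in>_. norm x \<le> C\<close> by blast
    then show ?thesis by simp
  qed
  \<comment> \<open>8 is the total coefficient in \<open>4 * H w + 4 * H w'\<close> when the two
    points coincide.\<close>
  define K where "K = C\<zeta> * \<bar>C\<bar> * (8 * real CARD('n))"
  have K0: "0 \<le> K" using C\<zeta> by (simp add: K_def)
  have bound: "\<bar>\<zeta> z * \<tau> (a - b) * (\<Sum>k\<in>UNIV. d k)\<bar> \<le> K * e"
    if "\<bar>a\<bar> \<le> M" "\<bar>b\<bar> \<le> M" "\<And>k::'n. \<bar>d k\<bar> \<le> 8 * e" "0 \<le> e" for z a b e and d :: "'n \<Rightarrow> real"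
  proof -
    have "\<bar>\<Sum>k\<in>UNIV. d k\<bar> \<le> (\<Sum>k\<in>(UNIV::'n set). 8 * e)"
      by (rule order_trans[OF sum_abs sum_mono]) (rule that(3))
    then have "\<bar>\<Sum>k\<in>UNIV. d k\<bar> \<le> real CARD('n) * (8 * e)" by simp
    then have "\<bar>\<zeta> z * \<tau> (a - b) * (\<Sum>k\<in>UNIV. d k)\<bar> \<le> (C\<zeta> * \<bar>C\<bar>) * (real CARD('n) * (8 * e))"
      unfolding abs_mult using C\<zeta> C[OF that(1,2)] that(4) by (intro mult_mono) auto
    then show ?thesis by (simp add: K_def algebra_simps)
  qed
  have mb: "\<bar>moll (\<epsilon> n) u z\<bar> \<le> M" "\<bar>moll (\<epsilon> n) v z\<bar> \<le> M" for n z
    using moll_bound[OF \<epsilon>(1) u.integrable_u u.uM] moll_bound[OF \<epsilon>(1) v.integrable_u v.uM] by auto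
  have [measurable]: "Au k \<in> borel_measurable borel" "Av k \<in> borel_measurable borel"
    "gu k \<in> borel_measurable borel" "gv k \<in> borel_measurable borel" for k using int[of k] by auto
  have LL: "(\<lambda>n. LINT z|lborel. L n z) \<longlonglongrightarrow> (LINT z|lborel. L0 z)" "integrable lborel L0"
  proof -
    have mH0: "0 \<le> moll (\<epsilon> n) H z" for n z
      unfolding moll_def using mollker_nonneg[OF \<epsilon>(1), where 'a="(real^'n) \<times> real"] H0
      by (intro Bochner_Integration.integral_nonneg) auto
    have b: "AE z in lborel. \<bar>L n z\<bar> \<le> K * moll (\<epsilon> n) H z" for n
    proof (rule AE_I2)
      fix z
      have "\<bar>(moll (\<epsilon> n) (Au k) z - moll (\<epsilon> n) (Av k) z) * (moll (\<epsilon> n) (gu k) z - moll (\<epsilon> n) (gv k) z)\<bar> \<le> 8 * moll (\<epsilon> n) H z" for k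
      proof -
        have "\<bar>moll (\<epsilon> n) (\<lambda>w. Au k w - Av k w) z * moll (\<epsilon> n) (\<lambda>w. gu k w - gv k w) z\<bar>
          \<le> moll (\<epsilon> n) (\<lambda>w. 4 * H w) z + moll (\<epsilon> n) (\<lambda>w. 4 * H w) z"
          by (rule moll_mult_le[OF \<epsilon>(1) \<epsilon>(1)]) (use int iH cross in auto)
        moreover have "moll (\<epsilon> n) (\<lambda>w. 4 * H w) z = 4 * moll (\<epsilon> n) H z"
          by (simp add: moll_def mult.left_commute)
        ultimately show ?thesis using int by (simp add: moll_diff[OF \<epsilon>(1)])
      qed
      then show "\<bar>L n z\<bar> \<le> K * moll (\<epsilon> n) H z" unfolding L_def by (intro bound mb mH0)
    qed
    have b0: "AE z in lborel. \<bar>L0 z\<bar> \<le> K * H z"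
    proof (rule AE_I2)
      fix z
      have "\<bar>(Au k z - Av k z) * (gu k z - gv k z)\<bar> \<le> 8 * H z" for k
        using cross[of k z z] by (simp add: abs_mult)
      then show "\<bar>L0 z\<bar> \<le> K * H z" unfolding L0_def by (intro bound u.uM v.uM H0)
    qed
    have c: "AE z in lborel. (\<lambda>n. L n z) \<longlonglongrightarrow> L0 z"
      using allconv
    proof eventually_elim
      case (elim z)
      have e: "(\<lambda>n. moll (\<epsilon> n) (F i k) z) \<longlonglongrightarrow> F i k z" if "i \<le> 5" for i k
        using elim[rule_format, of "(i, k)"] that by simp
      have "(\<lambda>n. moll (\<epsilon> n) u z) \<longlonglongrightarrow> u z" "(\<lambda>n. moll (\<epsilon> n) v z) \<longlonglongrightarrow> v z"
        "(\<lambda>n. moll (\<epsilon> n) (Au k) z) \<longlonglongrightarrow> Au k z" "(\<lambda>n. moll (\<epsilon> n) (Av k) z) \<longlonglongrightarrow> Av k z"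
        "(\<lambda>n. moll (\<epsilon> n) (gu k) z) \<longlonglongrightarrow> gu k z" "(\<lambda>n. moll (\<epsilon> n) (gv k) z) \<longlonglongrightarrow> gv k z" for k
        using e[of 0] e[of 1] e[of 2 k] e[of 3 k] e[of 4 k] e[of 5 k] by (simp_all add: F_def)
      then show ?case unfolding L_def L0_def
        by (intro tendsto_intros isCont_tendsto_compose[where g=\<tau>])
          (use T(2) in \<open>auto simp: continuous_on_eq_continuous_at\<close>)
    qed
    have iG: "integrable lborel (\<lambda>z. K * moll (\<epsilon> n) H z)" for n
      using integral_moll_le(1)[OF \<epsilon>(1) iH H0] by simp
    have l: "(\<lambda>n. LINT z|lborel. \<bar>K * moll (\<epsilon> n) H z - K * H z\<bar>) \<longlonglongrightarrow> 0"
    proof -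
      have "\<bar>K * moll (\<epsilon> n) H z - K * H z\<bar> = K * \<bar>moll (\<epsilon> n) H z - H z\<bar>" for n z
        using K0 by (simp add: abs_mult right_diff_distrib[symmetric])
      then show ?thesis using tendsto_mult_left[OF moll_L1_tendsto(2)[OF iH \<epsilon>(1,3)], of K] by simp
    qed
    have "L n \<in> borel_measurable lborel" "L0 \<in> borel_measurable lborel" for n
      unfolding L_def L0_def by measurable
    from integral_tendsto_generalized_dominated[OF this iG _ b b0 c l]
    show "(\<lambda>n. LINT z|lborel. L n z) \<longlonglongrightarrow> (LINT z|lborel. L0 z)" "integrable lborel L0"
      using iH by auto
  qed
  have ineq: "(LINT z|lborel. L n z) \<le> 4 * M * \<kappa> * (LINT z|lborel. \<bar>\<zeta>' et z\<bar>)
      + 2 * \<kappa> * (\<Sum>k\<in>UNIV. (LINT z|lborel. \<bar>\<zeta>' (ex k) z\<bar> * \<bar>moll (\<epsilon> n) (Au k) z\<bar>)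
        + (LINT z|lborel. \<bar>\<zeta>' (ex k) z\<bar> * \<bar>moll (\<epsilon> n) (Av k) z\<bar>))" for n
  proof -
    \<comment> \<open>\<open>\<epsilon> n < R - r\<close> makes every point of the support of
      \<zeta> admissible for the pointwise relations.\<close>
    have near: "dist c z + \<epsilon> n < R" if "z \<in> cball c r" for z using that \<epsilon>(2)[of n] by simp
    have "(LINT z|lborel. L n z) = (LINT z|lborel. \<zeta> z * \<tau> (moll (\<epsilon> n) u z - moll (\<epsilon> n) v z) *
       (\<Sum>k\<in>UNIV. (moll (\<epsilon> n) (Au k) z - moll (\<epsilon> n) (Av k) z) * (dmoll (\<epsilon> n) u (ex k) z - dmoll (\<epsilon> n) v (ex k) z)))"
    proof (rule Bochner_Integration.integral_cong[OF refl])
      fix z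
      show "L n z = \<zeta> z * \<tau> (moll (\<epsilon> n) u z - moll (\<epsilon> n) v z) *
       (\<Sum>k\<in>UNIV. (moll (\<epsilon> n) (Au k) z - moll (\<epsilon> n) (Av k) z) * (dmoll (\<epsilon> n) u (ex k) z - dmoll (\<epsilon> n) v (ex k) z))"
      proof (cases "z \<in> cball c r")
        case True
        then show ?thesis
          by (simp add: L_def u.moll_weak_grad[OF \<epsilon>(1) near] v.moll_weak_grad[OF \<epsilon>(1) near] gu_def[abs_def] gv_def[abs_def])
      next
        case False
        then show ?thesis using supp_inD[OF \<zeta>(2) False] by (simp add: L_def)
      qed
    qed
    also have "\<dots> \<le> 4 * M * \<kappa> * (LINT z|lborel. \<bar>\<zeta>' et z\<bar>)
      + 2 * \<kappa> * (\<Sum>k\<in>UNIV. LINT z|lborel. \<bar>\<zeta>' (ex k) z\<bar> * (\<bar>moll (\<epsilon> n) (Au k) z\<bar> + \<bar>moll (\<epsilon> n) (Av k) z\<bar>))"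
    proof (rule smooth_comparison[OF C1_bdd_moll[OF \<epsilon>(1) u.integrable_u] C1_bdd_moll[OF \<epsilon>(1) v.integrable_u]
        C1_bdd_moll[OF \<epsilon>(1) int(1)] C1_bdd_moll[OF \<epsilon>(1) int(2)] \<zeta> mb _ _ G T \<kappa>])
      fix z assume z: "z \<in> cball c r"
      show "0 \<le> dmoll (\<epsilon> n) u et z - (\<Sum>k\<in>UNIV. dmoll (\<epsilon> n) (Au k) (ex k) z)"
        using u.moll_supersol[OF \<epsilon>(1) near[OF z]] unfolding Au_def[abs_def] .
      show "0 \<le> dmoll (\<epsilon> n) v et z - (\<Sum>k\<in>UNIV. dmoll (\<epsilon> n) (Av k) (ex k) z)"
        using v.moll_supersol[OF \<epsilon>(1) near[OF z]] unfolding Av_def[abs_def] .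
    qed
    also have "(\<Sum>k\<in>UNIV. LINT z|lborel. \<bar>\<zeta>' (ex k) z\<bar> * (\<bar>moll (\<epsilon> n) (Au k) z\<bar> + \<bar>moll (\<epsilon> n) (Av k) z\<bar>))
       = (\<Sum>k\<in>UNIV. (LINT z|lborel. \<bar>\<zeta>' (ex k) z\<bar> * \<bar>moll (\<epsilon> n) (Au k) z\<bar>) + (LINT z|lborel. \<bar>\<zeta>' (ex k) z\<bar> * \<bar>moll (\<epsilon> n) (Av k) z\<bar>))"
    proof (rule sum.cong[OF refl])
      fix k
      have "integrable lborel (\<lambda>z. \<bar>\<zeta>' (ex k) z\<bar> * \<bar>moll (\<epsilon> n) f z\<bar>)" if "integrable lborel f" for f
        using C1_bdd_supp_deriv[OF \<zeta>(1,2), of "ex k"] C1_bdd_D(1)[OF C1_bdd_moll[OF \<epsilon>(1) that]]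
        by (intro integrable_bdd_meas_supp[OF _ _ bounded_cball[of c r]] bdd_meas_mult bdd_meas_abs C1_bdd_D(2)[OF \<zeta>(1)])
          (auto simp: supp_in_def)
      from this[OF int(1), of k] this[OF int(2), of k]
      show "(LINT z|lborel. \<bar>\<zeta>' (ex k) z\<bar> * (\<bar>moll (\<epsilon> n) (Au k) z\<bar> + \<bar>moll (\<epsilon> n) (Av k) z\<bar>))
       = (LINT z|lborel. \<bar>\<zeta>' (ex k) z\<bar> * \<bar>moll (\<epsilon> n) (Au k) z\<bar>) + (LINT z|lborel. \<bar>\<zeta>' (ex k) z\<bar> * \<bar>moll (\<epsilon> n) (Av k) z\<bar>)"
        by (simp add: distrib_left)
    qed
    finally show ?thesis by simp
  qed
  have inner_eq: "(flux p (g z) - flux p (h z)) \<bullet> (g z - h z) = (\<Sum>k\<in>UNIV. (Au k z - Av k z) * (gu k z - gv k z))" for z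
    by (simp add: inner_vec_def defs)
  show "integrable lborel (\<lambda>z. \<zeta> z * \<tau> (u z - v z) * ((flux p (g z) - flux p (h z)) \<bullet> (g z - h z)))"
    using LL(2) unfolding inner_eq L0_def[abs_def] .
  have lim2: "(\<lambda>n. 4 * M * \<kappa> * (LINT z|lborel. \<bar>\<zeta>' et z\<bar>)
      + 2 * \<kappa> * (\<Sum>k\<in>UNIV. (LINT z|lborel. \<bar>\<zeta>' (ex k) z\<bar> * \<bar>moll (\<epsilon> n) (Au k) z\<bar>)
        + (LINT z|lborel. \<bar>\<zeta>' (ex k) z\<bar> * \<bar>moll (\<epsilon> n) (Av k) z\<bar>)))
    \<longlonglongrightarrow> 4 * M * \<kappa> * (LINT z|lborel. \<bar>\<zeta>' et z\<bar>)
      + 2 * \<kappa> * (\<Sum>k\<in>UNIV. (LINT z|lborel. \<bar>\<zeta>' (ex k) z\<bar> * \<bar>Au k z\<bar>)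
        + (LINT z|lborel. \<bar>\<zeta>' (ex k) z\<bar> * \<bar>Av k z\<bar>))"
    by (intro tendsto_intros moll_weighted_tendsto int bdd_meas_abs C1_bdd_D(2)[OF \<zeta>(1)] \<epsilon>)
  have "(LINT z|lborel. L0 z) \<le> 4 * M * \<kappa> * (LINT z|lborel. \<bar>\<zeta>' et z\<bar>)
      + 2 * \<kappa> * (\<Sum>k\<in>UNIV. (LINT z|lborel. \<bar>\<zeta>' (ex k) z\<bar> * \<bar>Au k z\<bar>)
        + (LINT z|lborel. \<bar>\<zeta>' (ex k) z\<bar> * \<bar>Av k z\<bar>))"
    by (rule LIMSEQ_le[OF LL(1) lim2]) (use ineq in auto)
  also have "(\<Sum>k\<in>UNIV. (LINT z|lborel. \<bar>\<zeta>' (ex k) z\<bar> * \<bar>Au k z\<bar>) + (LINT z|lborel. \<bar>\<zeta>' (ex k) z\<bar> * \<bar>Av k z\<bar>))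
     = (\<Sum>k\<in>UNIV. LINT z|lborel. \<bar>\<zeta>' (ex k) z\<bar> * (\<bar>flux p (g z) $ k\<bar> + \<bar>flux p (h z) $ k\<bar>))"
  proof (rule sum.cong[OF refl])
    fix k
    have "integrable lborel (\<lambda>z. \<bar>\<zeta>' (ex k) z\<bar> * \<bar>f z\<bar>)" if "integrable lborel f" for f
      using that by (intro integrable_bdd_meas_mult bdd_meas_abs C1_bdd_D(2)[OF \<zeta>(1)]) auto
    from this[OF int(1), of k] this[OF int(2), of k]
    show "(LINT z|lborel. \<bar>\<zeta>' (ex k) z\<bar> * \<bar>Au k z\<bar>) + (LINT z|lborel. \<bar>\<zeta>' (ex k) z\<bar> * \<bar>Av k z\<bar>)
     = (LINT z|lborel. \<bar>\<zeta>' (ex k) z\<bar> * (\<bar>flux p (g z) $ k\<bar> + \<bar>flux p (h z) $ k\<bar>))"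
      by (simp add: distrib_left Au_def Av_def)
  qed
  finally show "(LINT z|lborel. \<zeta> z * \<tau> (u z - v z) * ((flux p (g z) - flux p (h z)) \<bullet> (g z - h z)))
    \<le> 4 * M * \<kappa> * (LINT z|lborel. \<bar>\<zeta>' et z\<bar>)
      + 2 * \<kappa> * (\<Sum>k\<in>UNIV. LINT z|lborel. \<bar>\<zeta>' (ex k) z\<bar> * (\<bar>flux p (g z) $ k\<bar> + \<bar>flux p (h z) $ k\<bar>))"
    unfolding inner_eq L0_def .
qed

section \<open>The Caccioppoli inequality\<close>

lemma ball_supersol_zero:
  assumes "p > 2" "R > 0" "M \<ge> 0"
  shows "ball_supersol p M R c (\<lambda>_. 0) (\<lambda>_. 0)"
  by unfold_locales (use assms in \<open>auto simp: flux_def\<close>)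

text \<open>Here \<open>d ^ N\<close> is the cutoff and \<open>s\<close> the norm of the gradient; \<open>N \<ge> p\<close> keeps the last term bounded
  where the cutoff vanishes.\<close>

lemma young_absorb:
  fixes s d D B p :: real
  assumes "0 \<le> s" "0 \<le> d" "d \<le> D" "0 \<le> B" "p > 1" "real N \<ge> p"
  shows "B * d ^ (N - 1) * s powr (p - 1) \<le> d ^ N * s powr p / 2 + B * (2 * B) powr (p - 1) * D powr (N - p)"
proof -
  have N: "N \<ge> 2" using assms by linarith
  have dN: "d ^ N = d * d ^ (N - 1)" using N by (cases N) auto
  have rest: "0 \<le> B * (2 * B) powr (p - 1) * D powr (N - p)" using assms by simp
  show ?thesis
  \<comment> \<open>If \<open>s * d\<close> is at least \<open>2 * B\<close>, half of the main term
    absorbs the left side; otherwise \<open>s \<le> 2 * B / d\<close> bounds it explicitly.\<close>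
  proof (cases "2 * B \<le> s * d")
    case True
    have "s * s powr (p - 1) = s powr (1 + (p - 1))" by (rule powr_mult_base) (use assms in auto)
    then have sp: "s powr p = s * s powr (p - 1)" by simp
    have "B * (d ^ (N - 1) * s powr (p - 1)) \<le> (s * d / 2) * (d ^ (N - 1) * s powr (p - 1))"
      using True assms by (intro mult_right_mono) auto
    also have "\<dots> = d ^ N * s powr p / 2" unfolding dN sp by (simp add: algebra_simps)
    finally show ?thesis using rest by (simp add: mult.assoc)
  next
    case False
    show ?thesis
    proof (cases "d = 0")
      case True
      then have z: "d ^ (N - 1) = 0" "d ^ N = 0" using N by auto
      show ?thesis unfolding z using rest by simp
    next
      case d0: False
      then have d: "d > 0" using assms by simp
      have "s \<le> 2 * B / d" using False d by (simp add: field_simps)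
      then have "s powr (p - 1) \<le> (2 * B / d) powr (p - 1)" using assms by (intro powr_mono2) auto
      also have "\<dots> = (2 * B) powr (p - 1) / d powr (p - 1)" using assms d by (simp add: powr_divide)
      finally have "B * d ^ (N - 1) * s powr (p - 1) \<le> B * d ^ (N - 1) * ((2 * B) powr (p - 1) / d powr (p - 1))"
        using assms by (intro mult_left_mono) auto
      also have "\<dots> = B * (2 * B) powr (p - 1) * (d powr real (N - 1) / d powr (p - 1))"
        using d by (simp add: powr_realpow)
      \<comment> \<open>The exponent \<open>(N - 1) - (p - 1) = N - p\<close> is nonnegative, which
        allows \<open>d\<close> to be replaced by \<open>D\<close> afterwards.\<close>
      also have "d powr real (N - 1) / d powr (p - 1) = d powr (N - p)"
        using N by (simp add: powr_diff[symmetric] of_nat_diff)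
      also have "B * (2 * B) powr (p - 1) * d powr (N - p) \<le> B * (2 * B) powr (p - 1) * D powr (N - p)"
        using assms by (intro mult_left_mono powr_mono2) auto
      finally show ?thesis using assms by (simp add: add_increasing)
    qed
  qed
qed

text \<open>The power \<open>N - 1\<close> of the cutoff base is kept: it is what
  \<open>young_absorb\<close> trades against the gradient.\<close>

lemma dcutoff_bound:
  assumes "N \<ge> 2" "r > 0"
  shows "\<bar>dcutoff c r N e z\<bar> \<le> 2 * real N * r * norm e * max 0 (r\<^sup>2 - (norm (z - c))\<^sup>2) ^ (N - 1)"
proof (cases "norm (z - c) \<le> r")
  case True
  have "\<bar>(z - c) \<bullet> e\<bar> \<le> r * norm e"
    using True by (meson Cauchy_Schwarz_ineq2 mult_right_mono norm_ge_zero order_trans)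
  then have "(2 * real N * max 0 (r\<^sup>2 - (norm (z - c))\<^sup>2) ^ (N - 1)) * \<bar>(z - c) \<bullet> e\<bar>
    \<le> (2 * real N * max 0 (r\<^sup>2 - (norm (z - c))\<^sup>2) ^ (N - 1)) * (r * norm e)"
    by (intro mult_left_mono) auto
  then show ?thesis by (simp add: dcutoff_def abs_mult mult_ac)
next
  case False
  then have "r\<^sup>2 \<le> (norm (z - c))\<^sup>2" using assms by (intro power_mono) auto
  then have "dcutoff c r N e z = 0" using assms by (simp add: dcutoff_def max_absorb1 zero_power)
  then show ?thesis using assms by simp
qed

lemma norm_ex [simp]: "norm (ex k) = 1"
  by (simp add: ex_def norm_Pair norm_axis_1)

lemma cutoff_ge: "norm (z - c) \<le> r' \<Longrightarrow> 0 \<le> r' \<Longrightarrow> r' \<le> r \<Longrightarrow> (r\<^sup>2 - r'\<^sup>2) ^ N \<le> cutoff c r N z"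
  unfolding cutoff_def by (intro power_mono) (auto intro!: max.coboundedI2 power_mono)

text \<open>In the comparison with the zero solution \<kappa> is \<open>2 * M\<close>. Part of the
  flux term is absorbed by the left side, and the rest depends only on data fixed before
  \<open>u\<close>; hence one constant for all supersolutions.\<close>

lemma caccioppoli:
  fixes c :: "(real^'n) \<times> real"
  assumes p: "p > 2" and r: "0 < r" "r < R" and M: "M \<ge> 0"
  shows "\<exists>C. \<forall>u g. ball_supersol p M R c u g \<longrightarrow>
    (LINT z|lborel. indicat_real (ball c r) z * norm (g z) powr p) \<le> C"
proof -
  define r1 where "r1 = (r + R) / 2"
  have r1: "r < r1" "r1 < R" "0 < r1" using r by (auto simp: r1_def)
  define N where "N = nat \<lceil>p\<rceil>"
  have N: "real N \<ge> p" "N \<ge> 2" using p by (auto simp: N_def) linarith+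
  define \<zeta> where "\<zeta> = cutoff c r1 N"
  define \<zeta>' where "\<zeta>' = dcutoff c r1 N"
  have \<zeta>: "C1_bdd \<zeta> \<zeta>'" "supp_in \<zeta> (cball c r1)" "\<And>z. 0 \<le> \<zeta> z"
    unfolding \<zeta>_def \<zeta>'_def using C1_bdd_cutoff[OF N(2) r1(3)] cutoff_supp[OF r1(3), of N c] N(2) cutoff_nonneg by auto
  note sd = C1_bdd_supp_deriv[OF \<zeta>(1,2) closed_cball]
  \<comment> \<open>\<open>4 * M\<close> is the factor \<open>2 * \<kappa>\<close>; the rest sums
    the bound of \<open>dcutoff_bound\<close> over the coordinate directions.\<close>
  define B where "B = 4 * M * (real CARD('n) * (2 * real N * r1))"
  have B0: "0 \<le> B" using M r1 by (simp add: B_def)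
  define C' where "C' = B * (2 * B) powr (p - 1) * (r1\<^sup>2) powr (N - p)"
  define C1 where "C1 = 8 * M * M * (LINT z|lborel. \<bar>\<zeta>' et z\<bar>)"
  define V where "V = (LINT z|lborel. indicat_real (cball c r1) z)"
  \<comment> \<open>A lower bound of \<zeta> on the inner ball, by which the weight is removed at
    the end.\<close>
  define q where "q = (r1\<^sup>2 - r\<^sup>2) ^ N"
  have q: "q > 0" unfolding q_def using r r1 by (simp add: power_strict_mono)
  show ?thesis
  proof (intro exI allI impI)
    fix u g assume su: "ball_supersol p M R c u g"
    interpret u: ball_supersol p M R c u g by fact
    note sv = ball_supersol_zero[OF p u.R M, of c]
    have G: "((\<lambda>s. s\<^sup>2 / 2) has_real_derivative x) (at x)" for x :: real
      by (auto intro!: derivative_eq_intros)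
    have T: "((\<lambda>s. s) has_real_derivative 1) (at x)" for x :: real by (rule DERIV_ident)
    note cmp = comparison[OF su sv r1(2) \<zeta> G _ T]
    have int1: "integrable lborel (\<lambda>z. \<zeta> z * norm (g z) powr p)"
      and le1: "(LINT z|lborel. \<zeta> z * norm (g z) powr p) \<le> 4 * M * (2 * M) * (LINT z|lborel. \<bar>\<zeta>' et z\<bar>)
      + 2 * (2 * M) * (\<Sum>k\<in>UNIV. LINT z|lborel. \<bar>\<zeta>' (ex k) z\<bar> * \<bar>flux p (g z) $ k\<bar>)"
      using cmp[of "2 * M"] by (simp_all add: flux_inner[OF p] flux_def[of p 0])
    have ik: "integrable lborel (\<lambda>z. \<bar>\<zeta>' (ex k) z\<bar> * \<bar>flux p (g z) $ k\<bar>)" for k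
      by (intro integrable_bdd_meas_mult bdd_meas_abs C1_bdd_D(2)[OF \<zeta>(1)] integrable_abs u.integrable_components)
    have iV: "integrable lborel (indicat_real (cball c r1))" by (rule integrable_indicator_cball)
    have "2 * (2 * M) * (\<Sum>k\<in>UNIV. LINT z|lborel. \<bar>\<zeta>' (ex k) z\<bar> * \<bar>flux p (g z) $ k\<bar>)
      = (LINT z|lborel. 4 * M * (\<Sum>k\<in>UNIV. \<bar>\<zeta>' (ex k) z\<bar> * \<bar>flux p (g z) $ k\<bar>))"
      using ik by simp
    also have "\<dots> \<le> (LINT z|lborel. \<zeta> z * norm (g z) powr p / 2 + C' * indicat_real (cball c r1) z)"
    proof (rule integral_mono)
      show "integrable lborel (\<lambda>z. 4 * M * (\<Sum>k\<in>UNIV. \<bar>\<zeta>' (ex k) z\<bar> * \<bar>flux p (g z) $ k\<bar>))" using ik by simp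
      show "integrable lborel (\<lambda>z. \<zeta> z * norm (g z) powr p / 2 + C' * indicat_real (cball c r1) z)"
        using int1 iV by simp
      fix z
      show "4 * M * (\<Sum>k\<in>UNIV. \<bar>\<zeta>' (ex k) z\<bar> * \<bar>flux p (g z) $ k\<bar>) \<le> \<zeta> z * norm (g z) powr p / 2 + C' * indicat_real (cball c r1) z"
      proof (cases "z \<in> cball c r1")
        case True
        define d where "d = max 0 (r1\<^sup>2 - (norm (z - c))\<^sup>2)"
        have "(\<Sum>k\<in>UNIV. \<bar>\<zeta>' (ex k) z\<bar> * \<bar>flux p (g z) $ k\<bar>)
          \<le> (\<Sum>k\<in>(UNIV::'n set). (2 * real N * r1 * d ^ (N - 1)) * norm (g z) powr (p - 1))"
        proof (intro sum_mono mult_mono)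
          fix k :: 'n
          show "\<bar>\<zeta>' (ex k) z\<bar> \<le> 2 * real N * r1 * d ^ (N - 1)"
            using dcutoff_bound[OF N(2) r1(3), of c "ex k" z] by (simp add: \<zeta>'_def d_def)
          show "\<bar>flux p (g z) $ k\<bar> \<le> norm (g z) powr (p - 1)"
            using component_le_norm_cart[of "flux p (g z)" k] by (simp add: norm_flux[OF p])
        qed (use r1 in \<open>auto simp: d_def\<close>)
        then have "4 * M * (\<Sum>k\<in>UNIV. \<bar>\<zeta>' (ex k) z\<bar> * \<bar>flux p (g z) $ k\<bar>)
          \<le> 4 * M * (real CARD('n) * ((2 * real N * r1 * d ^ (N - 1)) * norm (g z) powr (p - 1)))"
          using M by (intro mult_left_mono) auto
        also have "\<dots> = B * d ^ (N - 1) * norm (g z) powr (p - 1)" by (simp add: B_def algebra_simps)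
        also have "\<dots> \<le> d ^ N * norm (g z) powr p / 2 + C'"
          unfolding C'_def using B0 p N r1 by (intro young_absorb) (auto simp: d_def)
        finally show ?thesis using True by (simp add: \<zeta>_def cutoff_def d_def)
      next
        case False
        then show ?thesis using supp_inD[OF sd False] supp_inD[OF \<zeta>(2) False] by simp
      qed
    qed
    also have "\<dots> = (LINT z|lborel. \<zeta> z * norm (g z) powr p) / 2 + C' * V"
      using int1 iV by (simp add: V_def del: Bochner_Integration.integral_indicator)
    \<comment> \<open>Half of the left side appears on the right and is subtracted, hence the factor
      2.\<close>
    finally have le2: "(LINT z|lborel. \<zeta> z * norm (g z) powr p) \<le> 2 * (C1 + C' * V)"
      using le1 by (simp add: C1_def)
    have iind: "integrable lborel (\<lambda>z. indicat_real (ball c r) z * norm (g z) powr p)"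
      by (rule Bochner_Integration.integrable_bound[OF u.gp]) (use u.mg in \<open>auto simp: indicator_def\<close>)
    have "q * (LINT z|lborel. indicat_real (ball c r) z * norm (g z) powr p)
      = (LINT z|lborel. q * (indicat_real (ball c r) z * norm (g z) powr p))" by simp
    also have "\<dots> \<le> (LINT z|lborel. \<zeta> z * norm (g z) powr p)"
    proof (rule integral_mono)
      fix z
      show "q * (indicat_real (ball c r) z * norm (g z) powr p) \<le> \<zeta> z * norm (g z) powr p"
      proof (cases "z \<in> ball c r")
        case True
        then have "q \<le> \<zeta> z" unfolding q_def \<zeta>_def
          using r r1 by (intro cutoff_ge) (auto simp: dist_norm norm_minus_commute)
        then show ?thesis using True by (simp add: mult_right_mono)
      next
        case False then show ?thesis using \<zeta>(3)[of z] by simp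
      qed
    qed (use iind int1 in auto)
    finally show "(LINT z|lborel. indicat_real (ball c r) z * norm (g z) powr p) \<le> 2 * (C1 + C' * V) / q"
      using le2 q by (simp add: pos_le_divide_eq mult.commute)
  qed
qed

text \<open>The inner product equals \<open>(\<alpha> + \<beta>) / 2 * (norm (a - b))\<^sup>2 +
  (\<alpha> - \<beta>) / 2 * ((norm a)\<^sup>2 - (norm b)\<^sup>2)\<close>. The last term is
  nonnegative since its two differences have the same sign, and
  \<open>norm (a - b) \<le> 2 * max (norm a) (norm b)\<close> bounds
  \<open>\<alpha> + \<beta>\<close> below. The constant is \<open>(1 / 2) powr (p - 2)\<close> times
  the remaining \<open>1 / 2\<close>.\<close>

lemma flux_monotone:
  assumes p: "p > 2"
  shows "2 powr (1 - p) * norm (a - b) powr p \<le> (flux p a - flux p b) \<bullet> (a - b)"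
proof -
  define \<alpha> where "\<alpha> = norm a powr (p - 2)"
  define \<beta> where "\<beta> = norm b powr (p - 2)"
  define m where "m = max (norm a) (norm b)"
  have eq: "(flux p a - flux p b) \<bullet> (a - b)
    = (\<alpha> + \<beta>) / 2 * (norm (a - b))\<^sup>2 + (\<alpha> - \<beta>) / 2 * ((norm a)\<^sup>2 - (norm b)\<^sup>2)"
    unfolding flux_def \<alpha>_def[symmetric] \<beta>_def[symmetric] power2_norm_eq_inner
    by (simp add: inner_diff_left inner_diff_right inner_commute[of b a]) (simp add: field_simps)
  have "0 \<le> (\<alpha> - \<beta>) * ((norm a)\<^sup>2 - (norm b)\<^sup>2)"
  proof (cases "norm a \<le> norm b")
    case True
    then have "\<alpha> \<le> \<beta>" "(norm a)\<^sup>2 \<le> (norm b)\<^sup>2"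
      unfolding \<alpha>_def \<beta>_def using p by (auto intro!: powr_mono2 power_mono)
    then show ?thesis by (intro mult_nonpos_nonpos) auto
  next
    case False
    then have "\<beta> \<le> \<alpha>" "(norm b)\<^sup>2 \<le> (norm a)\<^sup>2"
      unfolding \<alpha>_def \<beta>_def using p by (auto intro!: powr_mono2 power_mono)
    then show ?thesis by (intro mult_nonneg_nonneg) auto
  qed
  moreover have "2 powr (1 - p) * norm (a - b) powr p \<le> (\<alpha> + \<beta>) / 2 * (norm (a - b))\<^sup>2"
  proof (cases "a = b")
    case False
    define t where "t = norm (a - b)"
    have t: "t > 0" using False by (simp add: t_def)
    have "t \<le> 2 * m" using norm_triangle_ineq4[of a b] by (simp add: t_def m_def)
    then have "(t / 2) powr (p - 2) \<le> m powr (p - 2)" using t p by (intro powr_mono2) auto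
    also have "m powr (p - 2) \<le> \<alpha> + \<beta>" unfolding \<alpha>_def \<beta>_def m_def by (auto simp: max_def)
    finally have "(t / 2) powr (p - 2) / 2 * t\<^sup>2 \<le> (\<alpha> + \<beta>) / 2 * t\<^sup>2" by (intro mult_right_mono) auto
    moreover have "(t / 2) powr (p - 2) / 2 * t\<^sup>2 = 2 powr (1 - p) * t powr p"
    proof -
      have 1: "(t / 2) powr (p - 2) = t powr (p - 2) / 2 powr (p - 2)" using t by (simp add: powr_divide)
      have "t powr p = t powr (p - 2) * t powr 2" using t by (simp add: powr_add[symmetric] del: powr_numeral)
      then have 2: "t powr p = t powr (p - 2) * t\<^sup>2" using t by (simp add: powr_numeral)
      have "2 powr (1 - p) = inverse (2 powr (p - 2) * 2 powr (1::real))"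
        unfolding powr_add[symmetric] powr_minus[symmetric] by simp
      then have 3: "2 powr (1 - p) = inverse (2 powr (p - 2) * 2)" by simp
      have alg: "T / a / 2 * s = inverse (a * 2) * (T * s)" for T a s :: real
        by (cases "a = 0") (simp_all add: field_simps)
      show ?thesis by (simp only: 1 2 3 alg)
    qed
    ultimately show ?thesis by (simp add: t_def)
  qed (use p in auto)
  ultimately show ?thesis unfolding eq by simp
qed

text \<open>\<open>\<delta> * arctan (s / \<delta>)\<close> is a smooth truncation: its absolute
  value is at most \<open>\<delta> * pi / 2\<close>, and its derivative is at least
  \<open>1 / 2\<close> where \<open>\<bar>s\<bar> \<le> \<delta>\<close>. A sharp truncation would
  not be differentiable. The first function is its primitive vanishing at 0.\<close>

lemma arctan_primitive:
  fixes \<delta> :: real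
  assumes "\<delta> > 0"
  shows "((\<lambda>s. \<delta>\<^sup>2 * (s / \<delta> * arctan (s / \<delta>) - ln (1 + (s / \<delta>)\<^sup>2) / 2)) has_real_derivative \<delta> * arctan (x / \<delta>)) (at x)"
    "((\<lambda>s. \<delta> * arctan (s / \<delta>)) has_real_derivative 1 / (1 + (x / \<delta>)\<^sup>2)) (at x)"
proof -
  have g: "((\<lambda>y. y * arctan y - ln (1 + y\<^sup>2) / 2) has_real_derivative arctan y) (at y)" for y :: real
  proof -
    have "1 + y\<^sup>2 > 0" by (simp add: add_pos_nonneg)
    then have 1: "((\<lambda>y. ln (1 + y\<^sup>2)) has_real_derivative (2 * y) / (1 + y\<^sup>2)) (at y)"
      by (auto intro!: derivative_eq_intros)
    have 2: "((\<lambda>y. y * arctan y) has_real_derivative arctan y + y / (1 + y\<^sup>2)) (at y)"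
      by (auto intro!: derivative_eq_intros simp: inverse_eq_divide)
    have "2 * y / A / 2 = y / A" for A by simp
    then show ?thesis
      using DERIV_diff[OF 2 DERIV_cdivide[OF 1, of 2]] by (simp only: add_diff_cancel_right')
  qed
  have d: "((\<lambda>s. s / \<delta>) has_real_derivative 1 / \<delta>) (at x)" using assms by (auto intro!: derivative_eq_intros)
  from DERIV_cmult[OF DERIV_chain2[OF g d], of "\<delta>\<^sup>2"]
  show "((\<lambda>s. \<delta>\<^sup>2 * (s / \<delta> * arctan (s / \<delta>) - ln (1 + (s / \<delta>)\<^sup>2) / 2)) has_real_derivative \<delta> * arctan (x / \<delta>)) (at x)"
    using assms by (simp add: power2_eq_square)
  have "\<delta> * (A * (1 / \<delta>)) = A" for A using assms by simp
  then show "((\<lambda>s. \<delta> * arctan (s / \<delta>)) has_real_derivative 1 / (1 + (x / \<delta>)\<^sup>2)) (at x)"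
    using DERIV_cmult[OF DERIV_chain2[OF DERIV_arctan d], of \<delta>] by (simp only: inverse_eq_divide)
qed

lemma integral_energy_le:
  fixes c :: "(real^'n) \<times> real"
  assumes "ball_supersol p M R c u g" "(LINT z|lborel. norm (g z) powr p) \<le> K"
  shows "(LINT z|lborel. energy p c R g z) \<le> (LINT z|lborel. indicat_real (ball c R) z) + K"
proof -
  interpret u: ball_supersol p M R c u g by fact
  have "energy p c R g = (\<lambda>z. indicat_real (ball c R) z + norm (g z) powr p)"
    using u.p u.out(2) by (auto simp: energy_def indicator_def fun_eq_iff)
  then show ?thesis using u.integrable_indicator_ball u.gp assms(2)
    by (simp del: Bochner_Integration.integral_indicator)
qed

text \<open>The right-hand side of the comparison is proportional to \<kappa>, here a multiple of
  \<delta>, while on the left \<tau> has a lower bound free of \<delta> only where \<open>u\<close>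
  and \<open>v\<close> are close. \<open>K\<close> enters through the integrals of the fluxes, so
  the constant is common to all pairs.\<close>

lemma gradient_comparison:
  fixes c :: "(real^'n) \<times> real"
  assumes p: "p > 2" and r: "0 < r" "r < R" and M: "M \<ge> 0"
  shows "\<exists>C\<ge>0. \<forall>u g v h \<delta>. ball_supersol p M R c u g \<longrightarrow> ball_supersol p M R c v h \<longrightarrow> \<delta> > 0 \<longrightarrow>
    (LINT z|lborel. norm (g z) powr p) \<le> K \<longrightarrow> (LINT z|lborel. norm (h z) powr p) \<le> K \<longrightarrow>
    (LINT z|lborel. indicat_real (ball c r) z * (if \<bar>u z - v z\<bar> \<le> \<delta> then norm (g z - h z) powr p else 0)) \<le> C * \<delta>"
proof -
  define r1 where "r1 = (r + R) / 2"
  have r1: "r < r1" "r1 < R" "0 < r1" using r by (auto simp: r1_def)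
  define \<zeta> where "\<zeta> = cutoff c r1 2"
  define \<zeta>' where "\<zeta>' = dcutoff c r1 2"
  have \<zeta>: "C1_bdd \<zeta> \<zeta>'" "supp_in \<zeta> (cball c r1)" "\<And>z. 0 \<le> \<zeta> z"
    unfolding \<zeta>_def \<zeta>'_def using C1_bdd_cutoff[of 2 r1 c] cutoff_supp[OF r1(3), of 2 c] r1(3) cutoff_nonneg by auto
  define q where "q = (r1\<^sup>2 - r\<^sup>2) ^ 2"
  have q: "q > 0" unfolding q_def using r r1 by (simp add: power_strict_mono)
  have "\<exists>C. \<forall>k z. \<bar>\<zeta>' (ex k) z\<bar> \<le> C"
  proof -
    have "\<bar>\<zeta>' (ex k) z\<bar> \<le> 2 * real 2 * r1 * norm (ex k) * (r1\<^sup>2) ^ (2 - 1)" for k z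
      unfolding \<zeta>'_def using r1(3) by (intro order_trans[OF dcutoff_bound] mult_left_mono power_mono) auto
    then show ?thesis by auto
  qed
  then obtain D where D: "\<And>k z. \<bar>\<zeta>' (ex k) z\<bar> \<le> D" by blast
  have D0: "0 \<le> D" using D[of undefined undefined] by (meson abs_ge_zero order_trans)
  \<comment> \<open>The absolute value makes \<open>E\<close> nonnegative for every real
    \<open>K\<close>.\<close>
  define E where "E = \<bar>(LINT z|lborel. indicat_real (ball c R) z) + K\<bar>"
  define C0 where "C0 = 4 * M * (LINT z|lborel. \<bar>\<zeta>' et z\<bar>) + 2 * (real CARD('n) * (D * (2 * E)))"
  \<comment> \<open>The three lower bounds: of \<zeta> on the inner ball, of \<tau> where
    \<open>\<bar>u - v\<bar> \<le> \<delta>\<close>, and the constant of the monotonicity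
    inequality.\<close>
  define m where "m = q * (1 / 2) * 2 powr (1 - p)"
  have m: "m > 0" using q by (simp add: m_def)
  have C0: "0 \<le> C0" using M D0 by (simp add: C0_def E_def)
  show ?thesis
  proof (intro exI[of _ "pi / 2 * C0 / m"] conjI allI impI)
    show "0 \<le> pi / 2 * C0 / m" using C0 m by simp
    fix u g v h and \<delta> :: real
    assume su: "ball_supersol p M R c u g" and sv: "ball_supersol p M R c v h" and \<delta>: "\<delta> > 0"
      and K: "(LINT z|lborel. norm (g z) powr p) \<le> K" "(LINT z|lborel. norm (h z) powr p) \<le> K"
    interpret u: ball_supersol p M R c u g by fact
    interpret v: ball_supersol p M R c v h by fact
    note [measurable] = u.mu v.mu u.mg v.mg
    define \<tau> where "\<tau> x = 1 / (1 + (x / \<delta>)\<^sup>2)" for x :: real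
    have one: "1 + (x / \<delta>)\<^sup>2 > 0" for x :: real by (simp add: add_pos_nonneg)
    have \<tau>c: "continuous_on UNIV \<tau>" unfolding \<tau>_def
      using one \<delta> by (intro continuous_intros) (auto simp: less_imp_neq[symmetric])
    define \<kappa> where "\<kappa> = \<delta> * (pi / 2)"
    have T\<kappa>: "\<bar>\<delta> * arctan (s / \<delta>)\<bar> \<le> \<kappa>" for s
    proof -
      have "\<bar>arctan (s / \<delta>)\<bar> \<le> pi / 2" using arctan_bounded[of "s / \<delta>"] by linarith
      then show ?thesis using \<delta> by (simp add: \<kappa>_def abs_mult)
    qed
    define X where "X z = (flux p (g z) - flux p (h z)) \<bullet> (g z - h z)" for z
    have G0: "\<delta>\<^sup>2 * (0 / \<delta> * arctan (0 / \<delta>) - ln (1 + (0 / \<delta>)\<^sup>2) / 2) = 0" by simp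
    note cmp = comparison[OF su sv r1(2) \<zeta> arctan_primitive(1)[OF \<delta>] G0
       arctan_primitive(2)[OF \<delta>, folded \<tau>_def] \<tau>c T\<kappa>, folded X_def]
    have "(\<Sum>k\<in>UNIV. LINT z|lborel. \<bar>\<zeta>' (ex k) z\<bar> * (\<bar>flux p (g z) $ k\<bar> + \<bar>flux p (h z) $ k\<bar>))
      \<le> (\<Sum>k\<in>(UNIV::'n set). D * (2 * E))"
    proof (rule sum_mono)
      fix k :: 'n
      have "(LINT z|lborel. \<bar>\<zeta>' (ex k) z\<bar> * (\<bar>flux p (g z) $ k\<bar> + \<bar>flux p (h z) $ k\<bar>))
        \<le> (LINT z|lborel. D * (energy p c R g z + energy p c R h z))"
      proof (rule integral_mono)
        show "integrable lborel (\<lambda>z. \<bar>\<zeta>' (ex k) z\<bar> * (\<bar>flux p (g z) $ k\<bar> + \<bar>flux p (h z) $ k\<bar>))"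
          by (intro integrable_bdd_meas_mult bdd_meas_abs C1_bdd_D(2)[OF \<zeta>(1)] integrable_abs
              Bochner_Integration.integrable_add u.integrable_components v.integrable_components)
        show "integrable lborel (\<lambda>z. D * (energy p c R g z + energy p c R h z))"
          using u.integrable_energy v.integrable_energy by simp
        fix z
        show "\<bar>\<zeta>' (ex k) z\<bar> * (\<bar>flux p (g z) $ k\<bar> + \<bar>flux p (h z) $ k\<bar>) \<le> D * (energy p c R g z + energy p c R h z)"
          using D D0 u.component_le_energy(2)[of z k] v.component_le_energy(2)[of z k]
          by (intro mult_mono add_mono) auto
      qed
      also have "\<dots> = D * ((LINT z|lborel. energy p c R g z) + (LINT z|lborel. energy p c R h z))"
        using u.integrable_energy v.integrable_energy by simp
      also have "\<dots> \<le> D * (2 * E)"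
      proof (rule mult_left_mono[OF _ D0])
        have "(LINT z|lborel. energy p c R g z) \<le> E" "(LINT z|lborel. energy p c R h z) \<le> E"
          unfolding E_def using integral_energy_le[OF su K(1)] integral_energy_le[OF sv K(2)] by linarith+
        then show "(LINT z|lborel. energy p c R g z) + (LINT z|lborel. energy p c R h z) \<le> 2 * E" by simp
      qed
      finally show "(LINT z|lborel. \<bar>\<zeta>' (ex k) z\<bar> * (\<bar>flux p (g z) $ k\<bar> + \<bar>flux p (h z) $ k\<bar>)) \<le> D * (2 * E)" .
    qed
    then have "(\<Sum>k\<in>UNIV. LINT z|lborel. \<bar>\<zeta>' (ex k) z\<bar> * (\<bar>flux p (g z) $ k\<bar> + \<bar>flux p (h z) $ k\<bar>))
      \<le> real CARD('n) * (D * (2 * E))" by simp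
    then have "2 * \<kappa> * (\<Sum>k\<in>UNIV. LINT z|lborel. \<bar>\<zeta>' (ex k) z\<bar> * (\<bar>flux p (g z) $ k\<bar> + \<bar>flux p (h z) $ k\<bar>))
      \<le> 2 * \<kappa> * (real CARD('n) * (D * (2 * E)))"
      using \<delta> by (intro mult_left_mono) (auto simp: \<kappa>_def)
    with cmp(2) have main: "(LINT z|lborel. \<zeta> z * \<tau> (u z - v z) * X z) \<le> \<kappa> * C0"
      by (simp add: C0_def algebra_simps)
    let ?f = "\<lambda>z. indicat_real (ball c r) z * (if \<bar>u z - v z\<bar> \<le> \<delta> then norm (g z - h z) powr p else 0)"
    have le: "m * ?f z \<le> \<zeta> z * \<tau> (u z - v z) * X z" for z
    proof -
      have X: "2 powr (1 - p) * norm (g z - h z) powr p \<le> X z" unfolding X_def by (rule flux_monotone[OF p])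
      then have X0: "0 \<le> X z" by (rule order_trans[rotated]) simp
      have \<tau>0: "0 \<le> \<tau> s" for s using one[of s] by (simp add: \<tau>_def)
      show ?thesis
      proof (cases "z \<in> ball c r \<and> \<bar>u z - v z\<bar> \<le> \<delta>")
        case True
        have "q \<le> \<zeta> z" unfolding q_def \<zeta>_def
          using r r1 True by (intro cutoff_ge) (auto simp: dist_norm norm_minus_commute)
        moreover have "1 / 2 \<le> \<tau> (u z - v z)"
        proof -
          have "\<bar>(u z - v z) / \<delta>\<bar> \<le> 1" using True \<delta> by simp
          then have "((u z - v z) / \<delta>)\<^sup>2 \<le> 1" by (simp add: abs_square_le_1)
          then show ?thesis unfolding \<tau>_def using one by (intro frac_le) auto
        qed
        ultimately have "q * (1 / 2) * (2 powr (1 - p) * norm (g z - h z) powr p) \<le> \<zeta> z * \<tau> (u z - v z) * X z"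
          using q X \<zeta>(3)[of z] \<tau>0 by (intro mult_mono) auto
        then show ?thesis using True by (simp add: m_def mult.assoc)
      next
        case False
        then have "?f z = 0" by auto
        then show ?thesis using \<zeta>(3)[of z] \<tau>0[of "u z - v z"] X0 by (simp only:) simp
      qed
    qed
    have intf: "integrable lborel (\<lambda>z. m * ?f z)"
    proof (rule Bochner_Integration.integrable_bound[OF cmp(1)])
      show "AE z in lborel. norm (m * ?f z) \<le> norm (\<zeta> z * \<tau> (u z - v z) * X z)"
      proof (rule AE_I2)
        fix z
        have "0 \<le> m * ?f z" using m by simp
        then show "norm (m * ?f z) \<le> norm (\<zeta> z * \<tau> (u z - v z) * X z)" using le[of z] by simp
      qed
    next
      have [measurable]: "ball c r \<in> sets borel" by simp
      have "(\<lambda>z. m * ?f z) \<in> borel_measurable borel" by measurable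
      then show "(\<lambda>z. m * ?f z) \<in> borel_measurable lborel" by simp
    qed
    have "m * (LINT z|lborel. ?f z) = (LINT z|lborel. m * ?f z)" by simp
    also have "\<dots> \<le> (LINT z|lborel. \<zeta> z * \<tau> (u z - v z) * X z)"
      by (rule integral_mono[OF intf cmp(1)]) (rule le)
    finally have "m * (LINT z|lborel. ?f z) \<le> \<kappa> * C0" using main by linarith
    then show "(LINT z|lborel. ?f z) \<le> pi / 2 * C0 / m * \<delta>"
      using m by (simp add: \<kappa>_def field_simps)
  qed
qed

section \<open>Compactness\<close>

lemma decompose_ex_et: "(h :: (real^'n) \<times> real) = (\<Sum>k\<in>UNIV. (fst h $ k) *\<^sub>R ex k) + snd h *\<^sub>R et"
proof (rule prod_eqI)
  have "fst ((\<Sum>k\<in>UNIV. (fst h $ k) *\<^sub>R ex k) + snd h *\<^sub>R et) = (\<Sum>k\<in>UNIV. fst h $ k *s axis k 1)"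
    by (simp add: fst_sum ex_def et_def scalar_mult_eq_scaleR)
  then show "fst h = fst ((\<Sum>k\<in>UNIV. (fst h $ k) *\<^sub>R ex k) + snd h *\<^sub>R et)"
    by (simp add: basis_expansion)
  show "snd h = snd ((\<Sum>k\<in>UNIV. (fst h $ k) *\<^sub>R ex k) + snd h *\<^sub>R et)"
    by (simp add: snd_sum ex_def et_def)
qed

text \<open>\<open>C1_bdd\<close> records derivatives one direction at a time, so linearity in the
  direction is derived separately; it comes from \<open>dbump\<close>, a scalar multiple of
  \<open>y \<bullet> e\<close>.\<close>

lemma dmoll_linear:
  fixes f :: "(real^'n) \<times> real \<Rightarrow> real"
  assumes "\<epsilon> > 0" "integrable lborel f"
  shows "dmoll \<epsilon> f h z = (\<Sum>k\<in>UNIV. fst h $ k * dmoll \<epsilon> f (ex k) z) + snd h * dmoll \<epsilon> f et z"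
proof -
  have "dmollker \<epsilon> h y = (\<Sum>k\<in>UNIV. fst h $ k * dmollker \<epsilon> (ex k) y) + snd h * dmollker \<epsilon> et y" for y
  proof -
    have "y \<bullet> h = (\<Sum>k\<in>UNIV. fst h $ k * (y \<bullet> ex k)) + snd h * (y \<bullet> et)"
      by (subst decompose_ex_et[of h]) (simp add: inner_add_right inner_sum_right)
    note yh = this
    define K where "K = - 2 * flat 2 (\<epsilon>\<^sup>2 - (norm y)\<^sup>2) / moll_const TYPE((real^'n) \<times> real) \<epsilon>"
    have "dmollker \<epsilon> e y = K * (y \<bullet> e)" for e
      by (simp add: dmollker_def dbump_def K_def)
    then show ?thesis using yh by (simp add: distrib_left sum_distrib_left mult.left_commute)
  qed
  then have "dmoll \<epsilon> f h z = (LINT w|lborel. (\<Sum>k\<in>UNIV. fst h $ k * (dmollker \<epsilon> (ex k) (z - w) * f w)) + snd h * (dmollker \<epsilon> et (z - w) * f w))"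
    by (simp add: dmoll_def distrib_right sum_distrib_right mult.assoc)
  also have "\<dots> = (\<Sum>k\<in>UNIV. fst h $ k * dmoll \<epsilon> f (ex k) z) + snd h * dmoll \<epsilon> f et z"
    unfolding dmoll_def using integrable_moll(2)[OF assms] by simp
  finally show ?thesis .
qed

lemma abs_integral_le:
  fixes f g :: "'a \<Rightarrow> real"
  assumes "integrable M f" "integrable M g" "\<And>z. \<bar>f z\<bar> \<le> g z"
  shows "\<bar>LINT z|M. f z\<bar> \<le> (LINT z|M. g z)"
proof -
  have "norm (LINT z|M. f z) \<le> (LINT z|M. norm (f z))" by (rule integral_norm_bound)
  also have "\<dots> \<le> (LINT z|M. g z)" using assms by (intro integral_mono) auto
  finally show ?thesis by simp
qed

lemma DERIV_integral_translate:
  assumes U: "C1_bdd U U'" and \<Psi>: "integrable lborel \<Psi>"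
  shows "((\<lambda>\<sigma>. LINT z|lborel. \<Psi> z * U (z + \<sigma> *\<^sub>R h)) has_real_derivative
     (LINT z|lborel. \<Psi> z * U' h (z + \<sigma> *\<^sub>R h))) (at \<sigma>)"
proof -
  have [measurable]: "\<Psi> \<in> borel_measurable borel" "U' h \<in> borel_measurable borel"
    using \<Psi> bdd_measD[OF C1_bdd_D(2)[OF U]] by auto
  obtain C where C: "C \<ge> 0" "\<And>z. \<bar>U' h z\<bar> \<le> C" using bdd_meas_bound[OF C1_bdd_D(2)[OF U, of h]] by blast
  have "((\<lambda>t. LINT z|lborel. \<Psi> z * U (z + \<sigma> *\<^sub>R h + t *\<^sub>R h)) has_real_derivative
     (LINT z|lborel. \<Psi> z * U' h (z + \<sigma> *\<^sub>R h))) (at 0)"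
  proof (rule DERIV_integral)
    show "((\<lambda>t. \<Psi> z * U (z + \<sigma> *\<^sub>R h + t *\<^sub>R h)) has_real_derivative \<Psi> z * U' h (z + \<sigma> *\<^sub>R h)) (at 0)" for z
      using DERIV_cmult[OF C1_bdd_D(3)[OF U, of "z + \<sigma> *\<^sub>R h" h 0], of "\<Psi> z"] by simp
    show "integrable lborel (\<lambda>z. \<Psi> z * U (z + \<sigma> *\<^sub>R h + t *\<^sub>R h))" for t
      using integrable_bdd_meas_mult[OF bdd_meas_shift[OF C1_bdd_D(1)[OF U], of "\<sigma> *\<^sub>R h + t *\<^sub>R h"] \<Psi>]
      by (simp add: mult.commute add.assoc)
    show "\<bar>\<Psi> z * U (z + \<sigma> *\<^sub>R h + t *\<^sub>R h) - \<Psi> z * U (z + \<sigma> *\<^sub>R h + 0 *\<^sub>R h)\<bar> \<le> \<bar>t\<bar> * (C * \<bar>\<Psi> z\<bar>)" for t z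
      using mult_left_mono[OF C1_bdd_line_bound[OF U C(2), of "z + \<sigma> *\<^sub>R h" t], of "\<bar>\<Psi> z\<bar>"]
      by (simp add: abs_mult[symmetric] right_diff_distrib mult_ac)
    show "integrable lborel (\<lambda>z. C * \<bar>\<Psi> z\<bar>)" using \<Psi> by simp
  qed measurable
  then have "((\<lambda>t. (\<lambda>\<sigma>. LINT z|lborel. \<Psi> z * U (z + \<sigma> *\<^sub>R h)) (\<sigma> + t)) has_real_derivative
     (LINT z|lborel. \<Psi> z * U' h (z + \<sigma> *\<^sub>R h))) (at 0)"
    by (simp add: scaleR_add_left add.assoc)
  then show ?thesis
    using DERIV_at_within_shift[of "\<lambda>\<sigma>. LINT z|lborel. \<Psi> z * U (z + \<sigma> *\<^sub>R h)" _ \<sigma> 0 UNIV] by simp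
qed

context ball_supersol
begin

lemma flux_grad_le_energy: "\<bar>flux p (g w) $ k\<bar> * \<bar>g w' $ k\<bar> \<le> energy p c R g w + energy p c R g w'"
proof -
  have "\<bar>flux p (g w) $ k\<bar> * \<bar>g w' $ k\<bar> \<le> norm (flux p (g w)) * norm (g w')"
    by (intro mult_mono component_le_norm_cart) auto
  also have "\<dots> \<le> norm (g w) powr p + norm (g w') powr p"
    using powr_mult_le_add[of "norm (g w)" "norm (g w')" p] p by (simp add: norm_flux)
  also have "\<dots> \<le> energy p c R g w + energy p c R g w'" by (intro add_mono powr_le_energy)
  finally show ?thesis .
qed

text \<open>With \<open>W\<close> the increment over \<open>h\<close> and
  \<open>\<Psi> = \<zeta> * W\<close>, the derivative of \<open>U\<close> along \<open>h\<close> at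
  an intermediate translate is split into gradient components, the defect \<open>N\<close> and a
  divergence. Beyond \<open>M\<close> and \<open>D\<close>, only \<open>E\<close> and
  \<open>Z\<close> enter the bounds, so the estimate does not deteriorate as \<epsilon> tends to 0.
  The factor \<open>norm h\<close> bounds the coefficients of \<open>h\<close>.\<close>

lemma translation_smooth:
  assumes \<epsilon>: "\<epsilon> > 0" "norm h + r + \<epsilon> < R" and \<zeta>: "C1_bdd \<zeta> \<zeta>'" "supp_in \<zeta> (cball c r)" "\<And>z. 0 \<le> \<zeta> z"
    and D: "\<And>z. \<zeta> z \<le> D" "\<And>k z. \<bar>\<zeta>' (ex k) z\<bar> \<le> D" and E: "(LINT z|lborel. energy p c R g z) \<le> E"
    and Z: "(LINT z|lborel. \<bar>\<zeta>' et z\<bar>) \<le> Z"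
  shows "(LINT z|lborel. \<zeta> z * (moll \<epsilon> u (z + h) - moll \<epsilon> u z)\<^sup>2)
    \<le> norm h * (real CARD('n) * (2 * M * D * E) + 2 * M * (M * Z + real CARD('n) * (D * E))
        + real CARD('n) * (2 * M * D * E + 4 * D * E))"
proof -
  define U where "U = moll \<epsilon> u"
  define U' where "U' = dmoll \<epsilon> u"
  define P where "P k = moll \<epsilon> (\<lambda>z. g z $ k)" for k
  define Q where "Q k = moll \<epsilon> (\<lambda>z. flux p (g z) $ k)" for k
  define Q' where "Q' k = dmoll \<epsilon> (\<lambda>z. flux p (g z) $ k)" for k
  define H where "H = moll \<epsilon> (energy p c R g)"
  have U: "C1_bdd U U'" and Q: "C1_bdd (Q k) (Q' k)" and Pb: "bdd_meas (P k)" for k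
    unfolding U_def U'_def Q_def Q'_def P_def
    using C1_bdd_moll[OF \<epsilon>(1)] integrable_u integrable_components C1_bdd_D(1) by blast+
  have UM: "\<bar>U z\<bar> \<le> M" for z unfolding U_def by (rule moll_bound[OF \<epsilon>(1) integrable_u uM])
  have PH: "\<bar>P k z\<bar> \<le> H z" for k z unfolding P_def H_def
    by (rule moll_abs_le[OF \<epsilon>(1) integrable_components(1) integrable_energy component_le_energy(1)])
  have QH: "\<bar>Q k z\<bar> \<le> H z" for k z unfolding Q_def H_def
    by (rule moll_abs_le[OF \<epsilon>(1) integrable_components(2) integrable_energy component_le_energy(2)])
  have QPH: "\<bar>Q k z\<bar> * \<bar>P k z'\<bar> \<le> H z + H z'" for k z z'
    using moll_mult_le[OF \<epsilon>(1) \<epsilon>(1) integrable_components(2) integrable_components(1) integrable_energy flux_grad_le_energy]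
    by (simp add: Q_def P_def H_def abs_mult)
  have H0: "0 \<le> H z" for z using PH[of undefined z] by (meson abs_ge_zero order_trans)
  have iH: "integrable lborel H" and HE: "(LINT z|lborel. H z) \<le> E"
    using integral_moll_le[OF \<epsilon>(1) integrable_energy energy_nonneg] E by (auto simp: H_def)
  have mH: "H \<in> borel_measurable borel" using iH by auto
  have iHa: "integrable lborel (\<lambda>z. H (z + a))" "(LINT z|lborel. H (z + a)) \<le> E" for a
    using integrable_shift[OF iH] integral_shift[OF mH] HE by auto
  have E0: "0 \<le> E" using HE H0 Bochner_Integration.integral_nonneg[of lborel H] by (meson order_trans)
  have D0: "0 \<le> D" using D(1) \<zeta>(3) order_trans by blast
  have sd: "supp_in (\<zeta>' e) (cball c r)" for e by (rule C1_bdd_supp_deriv[OF \<zeta>(1,2)]) simp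
  define W where "W z = U (z + h) - U z" for z
  define W' where "W' e z = U' e (z + h) - U' e z" for e z
  have W: "C1_bdd W W'" unfolding W_def[abs_def] W'_def[abs_def] by (intro C1_bdd_diff C1_bdd_shift U)
  have WM: "\<bar>W z\<bar> \<le> 2 * M" for z using UM[of z] UM[of "z + h"] by (simp add: W_def)
  define \<Psi> where "\<Psi> z = \<zeta> z * W z" for z
  define \<Psi>' where "\<Psi>' e z = \<zeta>' e z * W z + \<zeta> z * W' e z" for e z
  have \<Psi>: "C1_bdd \<Psi> \<Psi>'" unfolding \<Psi>_def[abs_def] \<Psi>'_def[abs_def] by (rule C1_bdd_mult[OF \<zeta>(1) W])
  have s\<Psi>: "supp_in \<Psi> (cball c r)" using \<zeta>(2) by (auto simp: supp_in_def \<Psi>_def)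
  have isup: "integrable lborel (\<lambda>z. f z * b z)" if "bdd_meas f" "supp_in f (cball c r)" "bdd_meas b" for f b
    by (rule integrable_bdd_meas_supp[OF bdd_meas_mult[OF that(1,3)] _ bounded_cball[of c r]])
      (use that(2) in \<open>auto simp: supp_in_def\<close>)
  note b\<zeta> = C1_bdd_D(1)[OF \<zeta>(1)] and b\<zeta>' = C1_bdd_D(2)[OF \<zeta>(1)] and b\<Psi> = C1_bdd_D(1)[OF \<Psi>]
    and bU = C1_bdd_D(1)[OF U] and bU' = C1_bdd_D(2)[OF U] and bQ = C1_bdd_D(1)[OF Q] and bQ' = C1_bdd_D(2)[OF Q]
  \<comment> \<open>\<open>\<Phi> 1 - \<Phi> 0\<close> is the integral of \<open>\<zeta> W\<^sup>2\<close>; by the mean value theorem it suffices to bound \<open>\<Phi>'\<close>.\<close>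
  define \<Phi> where "\<Phi> \<sigma> = (LINT z|lborel. \<Psi> z * U (z + \<sigma> *\<^sub>R h))" for \<sigma>
  define \<Phi>' where "\<Phi>' \<sigma> = (LINT z|lborel. \<Psi> z * U' h (z + \<sigma> *\<^sub>R h))" for \<sigma>
  have "integrable lborel \<Psi>" by (rule integrable_bdd_meas_supp[OF b\<Psi> s\<Psi> bounded_cball])
  then have "(\<Phi> has_real_derivative \<Phi>' \<sigma>) (at \<sigma>)" for \<sigma>
    unfolding \<Phi>_def[abs_def] \<Phi>'_def by (rule DERIV_integral_translate[OF U])
  then obtain \<sigma> where \<sigma>: "0 < \<sigma>" "\<sigma> < 1" "\<Phi> 1 - \<Phi> 0 = \<Phi>' \<sigma>"
    using MVT2[of 0 1 \<Phi> \<Phi>'] by auto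
  have "\<Phi> 1 - \<Phi> 0 = (LINT z|lborel. \<zeta> z * (W z)\<^sup>2)"
  proof -
    have "\<Phi> 1 - \<Phi> 0 = (LINT z|lborel. \<Psi> z * U (z + h) - \<Psi> z * U z)"
      unfolding \<Phi>_def using isup[OF b\<Psi> s\<Psi> bdd_meas_shift[OF bU]] isup[OF b\<Psi> s\<Psi> bU] by simp
    also have "\<dots> = (LINT z|lborel. \<zeta> z * (W z)\<^sup>2)"
      by (rule Bochner_Integration.integral_cong) (auto simp: \<Psi>_def W_def power2_eq_square algebra_simps)
    finally show ?thesis .
  qed
  moreover have "\<Phi>' \<sigma> \<le> norm h * (real CARD('n) * (2 * M * D * E) + 2 * M * (M * Z + real CARD('n) * (D * E))
        + real CARD('n) * (2 * M * D * E + 4 * D * E))"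
  proof -
    define a where "a = \<sigma> *\<^sub>R h"
    have na: "norm a \<le> norm h" using \<sigma> by (simp add: a_def mult_left_le_one_le)
    have near: "dist c (z + b) + \<epsilon> < R" if "z \<in> cball c r" "norm b \<le> norm h" for z b
    proof -
      have "dist c (z + b) \<le> dist c z + norm b" using dist_triangle[of c "z + b" z] by (simp add: dist_norm)
      then show ?thesis using that \<epsilon>(2) by simp
    qed
    have gradU: "U' (ex k) (z + b) = P k (z + b)" if "z \<in> cball c r" "norm b \<le> norm h" for z b k
      unfolding U'_def P_def by (rule moll_weak_grad[OF \<epsilon>(1) near[OF that]])
    \<comment> \<open>The defect of the mollified equation at the translate: solving for the time
      derivative gives \<open>N\<close> plus a divergence.\<close>
    define N where "N z = U' et (z + a) - (\<Sum>k\<in>UNIV. Q' k (ex k) (z + a))" for z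
    have N0: "0 \<le> N z" if "z \<in> cball c r" for z
      unfolding N_def U'_def Q'_def using moll_supersol[OF \<epsilon>(1) near[OF that na]] .
    have bN: "bdd_meas N" unfolding N_def[abs_def] by (intro bdd_meas_diff bdd_meas_sum bdd_meas_shift bU' bQ')
    have bPa: "bdd_meas (\<lambda>z. P k (z + a))" and bQa: "bdd_meas (\<lambda>z. Q k (z + a))"
      and bQ'a: "bdd_meas (\<lambda>z. Q' k e (z + a))" for k e by (intro bdd_meas_shift Pb bQ bQ')+
    have "\<Phi>' \<sigma> = (LINT z|lborel. (\<Sum>k\<in>UNIV. fst h $ k * (\<Psi> z * P k (z + a))) + snd h * (\<Psi> z * N z)
        + snd h * (\<Sum>k\<in>UNIV. \<Psi> z * Q' k (ex k) (z + a)))"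
      unfolding \<Phi>'_def a_def[symmetric]
    proof (rule Bochner_Integration.integral_cong[OF refl])
      fix z
      show "\<Psi> z * U' h (z + a) = (\<Sum>k\<in>UNIV. fst h $ k * (\<Psi> z * P k (z + a))) + snd h * (\<Psi> z * N z)
        + snd h * (\<Sum>k\<in>UNIV. \<Psi> z * Q' k (ex k) (z + a))"
      proof (cases "z \<in> cball c r")
        case True
        have "U' h (z + a) = (\<Sum>k\<in>UNIV. fst h $ k * P k (z + a)) + snd h * (N z + (\<Sum>k\<in>UNIV. Q' k (ex k) (z + a)))"
          using dmoll_linear[OF \<epsilon>(1) integrable_u, of h "z + a"] gradU[OF True na]
          by (simp add: U'_def[symmetric] N_def)
        then show ?thesis by (simp only:) (simp add: distrib_left sum_distrib_left mult_ac)
      next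
        case False
        then show ?thesis using supp_inD[OF s\<Psi> False] by simp
      qed
    qed
    also have "\<dots> = (\<Sum>k\<in>UNIV. fst h $ k * (LINT z|lborel. \<Psi> z * P k (z + a))) + snd h * (LINT z|lborel. \<Psi> z * N z)
        + snd h * (\<Sum>k\<in>UNIV. (LINT z|lborel. \<Psi> z * Q' k (ex k) (z + a)))"
      using isup[OF b\<Psi> s\<Psi> bPa] isup[OF b\<Psi> s\<Psi> bN] isup[OF b\<Psi> s\<Psi> bQ'a] by simp
    finally have eq: "\<Phi>' \<sigma> = \<dots>" .
    have \<Psi>D: "\<bar>\<Psi> z\<bar> \<le> D * (2 * M)" for z
      unfolding \<Psi>_def abs_mult using \<zeta>(3) D(1) WM D0 by (intro mult_mono) auto
    have T1: "\<bar>LINT z|lborel. \<Psi> z * P k (z + a)\<bar> \<le> 2 * M * D * E" for k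
    proof -
      have "\<bar>LINT z|lborel. \<Psi> z * P k (z + a)\<bar> \<le> (LINT z|lborel. D * (2 * M) * H (z + a))"
      proof (rule abs_integral_le[OF isup[OF b\<Psi> s\<Psi> bPa]])
        show "\<bar>\<Psi> z * P k (z + a)\<bar> \<le> D * (2 * M) * H (z + a)" for z
          unfolding abs_mult using \<Psi>D[of z] PH[of k "z + a"] D0 M_nonneg by (intro mult_mono) auto
      qed (use iHa in simp)
      also have "\<dots> \<le> D * (2 * M) * E" using iHa(2)[of a] D0 M_nonneg by (simp add: mult_left_mono)
      finally show ?thesis by (simp add: mult_ac)
    qed
    \<comment> \<open>The sign of \<open>N\<close> allows \<open>\<bar>\<Psi>\<bar>\<close> to be
      replaced by \<open>2 * M * \<zeta>\<close>; in the integral of \<open>\<zeta> * N\<close>,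
      integration by parts moves every derivative to \<zeta>.\<close>
    have T2: "\<bar>LINT z|lborel. \<Psi> z * N z\<bar> \<le> 2 * M * (M * Z + real CARD('n) * (D * E))"
    proof -
      have "\<bar>LINT z|lborel. \<Psi> z * N z\<bar> \<le> (LINT z|lborel. 2 * M * (\<zeta> z * N z))"
      proof (rule abs_integral_le[OF isup[OF b\<Psi> s\<Psi> bN]])
        show "\<bar>\<Psi> z * N z\<bar> \<le> 2 * M * (\<zeta> z * N z)" for z
        proof (cases "z \<in> cball c r")
          case True
          have "\<bar>\<Psi> z * N z\<bar> = \<zeta> z * \<bar>W z\<bar> * N z" using \<zeta>(3)[of z] N0[OF True] by (simp add: \<Psi>_def abs_mult)
          also have "\<dots> \<le> \<zeta> z * (2 * M) * N z"
            using \<zeta>(3)[of z] N0[OF True] WM[of z] by (intro mult_right_mono mult_left_mono) auto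
          finally show ?thesis by (simp add: mult_ac)
        next
          case False
          then show ?thesis using supp_inD[OF s\<Psi> False] supp_inD[OF \<zeta>(2) False] by simp
        qed
      qed (use isup[OF b\<zeta> \<zeta>(2) bN] in simp)
      also have "\<dots> = 2 * M * (LINT z|lborel. \<zeta> z * N z)" by simp
      also have "(LINT z|lborel. \<zeta> z * N z) = (LINT z|lborel. \<zeta> z * U' et (z + a)) - (\<Sum>k\<in>UNIV. LINT z|lborel. \<zeta> z * Q' k (ex k) (z + a))"
      proof -
        have "(LINT z|lborel. \<zeta> z * N z) = (LINT z|lborel. \<zeta> z * U' et (z + a) - (\<Sum>k\<in>UNIV. \<zeta> z * Q' k (ex k) (z + a)))"
          by (simp add: N_def right_diff_distrib sum_distrib_left)
        then show ?thesis
          using isup[OF b\<zeta> \<zeta>(2) bdd_meas_shift[OF bU']] isup[OF b\<zeta> \<zeta>(2) bQ'a] by simp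
      qed
      also have "\<dots> = - (LINT z|lborel. \<zeta>' et z * U (z + a)) + (\<Sum>k\<in>UNIV. LINT z|lborel. \<zeta>' (ex k) z * Q k (z + a))"
        unfolding integral_mult_derivative(3)[OF \<zeta>(1) C1_bdd_shift[OF U] \<zeta>(2)]
          integral_mult_derivative(3)[OF \<zeta>(1) C1_bdd_shift[OF Q] \<zeta>(2)] sum_negf by simp
      also have "\<dots> \<le> M * Z + (\<Sum>k\<in>(UNIV::'n set). D * E)"
      proof (intro add_mono sum_mono)
        have "\<bar>LINT z|lborel. \<zeta>' et z * U (z + a)\<bar> \<le> (LINT z|lborel. M * \<bar>\<zeta>' et z\<bar>)"
        proof (rule abs_integral_le[OF isup[OF b\<zeta>' sd bdd_meas_shift[OF bU]]])
          show "integrable lborel (\<lambda>z. M * \<bar>\<zeta>' et z\<bar>)"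
            using integrable_bdd_meas_supp[OF b\<zeta>' sd bounded_cball, of et] by simp
          show "\<bar>\<zeta>' et z * U (z + a)\<bar> \<le> M * \<bar>\<zeta>' et z\<bar>" for z
            using mult_left_mono[OF UM[of "z + a"], of "\<bar>\<zeta>' et z\<bar>"] by (simp add: abs_mult mult.commute)
        qed
        also have "\<dots> \<le> M * Z" using Z M_nonneg by (simp add: mult_left_mono)
        finally show "- (LINT z|lborel. \<zeta>' et z * U (z + a)) \<le> M * Z" by linarith
        fix k :: 'n
        have "\<bar>LINT z|lborel. \<zeta>' (ex k) z * Q k (z + a)\<bar> \<le> (LINT z|lborel. D * H (z + a))"
        proof (rule abs_integral_le[OF isup[OF b\<zeta>' sd bQa]])
          show "\<bar>\<zeta>' (ex k) z * Q k (z + a)\<bar> \<le> D * H (z + a)" for z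
            unfolding abs_mult using D(2)[of k z] QH[of k "z + a"] D0 by (intro mult_mono) auto
        qed (use iHa in simp)
        also have "\<dots> \<le> D * E" using iHa(2)[of a] D0 by (simp add: mult_left_mono)
        finally show "(LINT z|lborel. \<zeta>' (ex k) z * Q k (z + a)) \<le> D * E" by linarith
      qed
      finally show ?thesis using M_nonneg by (simp add: mult_left_mono)
    qed
    \<comment> \<open>The derivative moved to \<Psi> falls on \<zeta> or on \<open>W\<close>. In the
      second case a flux at \<open>z + a\<close> meets gradients at \<open>z + h\<close> and
      \<open>z\<close>, so the product bound has to hold for two different points; the four energies
      met there give \<open>4 * D * E\<close>.\<close>
    have T3: "\<bar>LINT z|lborel. \<Psi> z * Q' k (ex k) (z + a)\<bar> \<le> 2 * M * D * E + 4 * D * E" for k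
    proof -
      have "\<bar>LINT z|lborel. \<Psi> z * Q' k (ex k) (z + a)\<bar> = \<bar>LINT z|lborel. \<Psi>' (ex k) z * Q k (z + a)\<bar>"
        unfolding integral_mult_derivative(3)[OF \<Psi> C1_bdd_shift[OF Q] s\<Psi>] by simp
      also have "\<dots> \<le> (LINT z|lborel. D * (2 * M) * H (z + a) + D * (H (z + h) + H z + 2 * H (z + a)))"
      proof (rule abs_integral_le[OF isup[OF C1_bdd_D(2)[OF \<Psi>] C1_bdd_supp_deriv[OF \<Psi> s\<Psi> closed_cball] bQa]])
        show "integrable lborel (\<lambda>z. D * (2 * M) * H (z + a) + D * (H (z + h) + H z + 2 * H (z + a)))"
          using iHa iH by simp
        fix z
        show "\<bar>\<Psi>' (ex k) z * Q k (z + a)\<bar> \<le> D * (2 * M) * H (z + a) + D * (H (z + h) + H z + 2 * H (z + a))"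
        proof (cases "z \<in> cball c r")
          case True
          have W'P: "W' (ex k) z = P k (z + h) - P k z"
            using gradU[OF True, of h k] gradU[OF True, of 0 k] by (simp add: W'_def)
          have "\<bar>\<zeta>' (ex k) z * W z\<bar> \<le> D * (2 * M)"
            unfolding abs_mult using D(2)[of k z] WM[of z] D0 by (intro mult_mono) auto
          then have 1: "\<bar>\<zeta>' (ex k) z * W z\<bar> * \<bar>Q k (z + a)\<bar> \<le> D * (2 * M) * H (z + a)"
            using QH[of k "z + a"] D0 M_nonneg by (intro mult_mono) auto
          have "\<bar>P k (z + h) - P k z\<bar> * \<bar>Q k (z + a)\<bar> \<le> (\<bar>P k (z + h)\<bar> + \<bar>P k z\<bar>) * \<bar>Q k (z + a)\<bar>"
            by (intro mult_right_mono) auto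
          also have "\<dots> \<le> H (z + h) + H z + 2 * H (z + a)"
            using QPH[of k "z + a" "z + h"] QPH[of k "z + a" z] by (simp add: algebra_simps)
          finally have "\<zeta> z * (\<bar>P k (z + h) - P k z\<bar> * \<bar>Q k (z + a)\<bar>) \<le> D * (H (z + h) + H z + 2 * H (z + a))"
            using D(1)[of z] D0 by (intro mult_mono) auto
          then have 2: "\<bar>\<zeta> z * W' (ex k) z\<bar> * \<bar>Q k (z + a)\<bar> \<le> D * (H (z + h) + H z + 2 * H (z + a))"
            using \<zeta>(3)[of z] by (simp add: W'P abs_mult mult.assoc)
          have "\<bar>\<Psi>' (ex k) z * Q k (z + a)\<bar> \<le> (\<bar>\<zeta>' (ex k) z * W z\<bar> + \<bar>\<zeta> z * W' (ex k) z\<bar>) * \<bar>Q k (z + a)\<bar>"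
            unfolding abs_mult[of "\<Psi>' (ex k) z"] by (intro mult_right_mono) (auto simp: \<Psi>'_def)
          then show ?thesis using 1 2 by (simp add: distrib_right)
        next
          case False
          have "\<Psi>' (ex k) z = 0" by (rule supp_inD[OF C1_bdd_supp_deriv[OF \<Psi> s\<Psi> closed_cball] False])
          then show ?thesis using D0 M_nonneg H0 by simp
        qed
      qed
      also have "\<dots> = D * (2 * M) * (LINT z|lborel. H (z + a)) + D * ((LINT z|lborel. H (z + h)) + (LINT z|lborel. H z) + 2 * (LINT z|lborel. H (z + a)))"
        using iHa(1) iH by simp
      also have "\<dots> \<le> D * (2 * M) * E + D * (E + E + 2 * E)"
        using iHa(2) HE D0 M_nonneg by (intro add_mono mult_left_mono) auto
      finally show ?thesis by (simp add: algebra_simps)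
    qed
    have fk: "\<bar>fst h $ k\<bar> \<le> norm h" and sk: "\<bar>snd h\<bar> \<le> norm h" for k
      using component_le_norm_cart[of "fst h" k] norm_fst_le[of "fst h" "snd h"] norm_snd_le[of "snd h" "fst h"] by auto
    have "\<Phi>' \<sigma> \<le> (\<Sum>k\<in>UNIV. \<bar>fst h $ k\<bar> * \<bar>LINT z|lborel. \<Psi> z * P k (z + a)\<bar>) + \<bar>snd h\<bar> * \<bar>LINT z|lborel. \<Psi> z * N z\<bar>
        + \<bar>snd h\<bar> * (\<Sum>k\<in>UNIV. \<bar>LINT z|lborel. \<Psi> z * Q' k (ex k) (z + a)\<bar>)"
      unfolding eq
    proof (intro add_mono)
      show "(\<Sum>k\<in>UNIV. fst h $ k * (LINT z|lborel. \<Psi> z * P k (z + a))) \<le> (\<Sum>k\<in>UNIV. \<bar>fst h $ k\<bar> * \<bar>LINT z|lborel. \<Psi> z * P k (z + a)\<bar>)"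
        by (intro sum_mono) (simp add: abs_mult[symmetric])
      show "snd h * (LINT z|lborel. \<Psi> z * N z) \<le> \<bar>snd h\<bar> * \<bar>LINT z|lborel. \<Psi> z * N z\<bar>"
        by (simp add: abs_mult[symmetric])
      have "snd h * (\<Sum>k\<in>UNIV. (LINT z|lborel. \<Psi> z * Q' k (ex k) (z + a))) \<le> \<bar>snd h\<bar> * \<bar>\<Sum>k\<in>UNIV. (LINT z|lborel. \<Psi> z * Q' k (ex k) (z + a))\<bar>"
        by (simp add: abs_mult[symmetric])
      also have "\<dots> \<le> \<bar>snd h\<bar> * (\<Sum>k\<in>UNIV. \<bar>LINT z|lborel. \<Psi> z * Q' k (ex k) (z + a)\<bar>)"
        by (intro mult_left_mono sum_abs) auto
      finally show "snd h * (\<Sum>k\<in>UNIV. (LINT z|lborel. \<Psi> z * Q' k (ex k) (z + a))) \<le> \<bar>snd h\<bar> * (\<Sum>k\<in>UNIV. \<bar>LINT z|lborel. \<Psi> z * Q' k (ex k) (z + a)\<bar>)" .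
    qed
    also have "\<dots> \<le> (\<Sum>k\<in>(UNIV::'n set). norm h * (2 * M * D * E)) + norm h * (2 * M * (M * Z + real CARD('n) * (D * E)))
        + norm h * (\<Sum>k\<in>(UNIV::'n set). 2 * M * D * E + 4 * D * E)"
      by (intro add_mono mult_mono sum_mono fk sk T1 T2 T3 norm_ge_zero abs_ge_zero sum_nonneg)
    finally show ?thesis by (simp add: algebra_simps)
  qed
  ultimately show ?thesis using \<sigma>(3) unfolding W_def U_def by simp
qed

end

text \<open>\<epsilon> tends to 0 in \<open>translation_smooth\<close>, by dominated convergence
  since the mollified functions are bounded by \<open>M\<close> and the cutoff lives on a ball. The
  strict inequality \<open>norm h + r < R\<close> leaves room for the kernels.\<close>

lemma translation_estimate:
  fixes c :: "(real^'n) \<times> real"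
  assumes p: "p > 2" and r: "0 < r" "r < R" and M: "M \<ge> 0"
  shows "\<exists>C\<ge>0. \<forall>u g h. ball_supersol p M R c u g \<longrightarrow> (LINT z|lborel. norm (g z) powr p) \<le> K \<longrightarrow> norm h + r < R \<longrightarrow>
    (LINT z|lborel. cutoff c r 2 z * (u (z + h) - u z)\<^sup>2) \<le> C * norm h"
proof -
  define \<zeta> where "\<zeta> = cutoff c r 2"
  define \<zeta>' where "\<zeta>' = dcutoff c r 2"
  have \<zeta>: "C1_bdd \<zeta> \<zeta>'" "supp_in \<zeta> (cball c r)" "\<And>z. 0 \<le> \<zeta> z"
    unfolding \<zeta>_def \<zeta>'_def using C1_bdd_cutoff[of 2 r c] cutoff_supp[OF r(1), of 2 c] r(1) cutoff_nonneg by auto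
  \<comment> \<open>The sum, so that one number bounds both the cutoff and its spatial
    derivatives.\<close>
  define D where "D = (r\<^sup>2) ^ 2 + 2 * real 2 * r * (r\<^sup>2) ^ (2 - 1)"
  have D: "\<zeta> z \<le> D" "\<bar>\<zeta>' (ex k) z\<bar> \<le> D" for z k
  proof -
    have "\<bar>\<zeta>' (ex k) z\<bar> \<le> 2 * real 2 * r * norm (ex k) * (r\<^sup>2) ^ (2 - 1)"
      unfolding \<zeta>'_def using r(1) by (intro order_trans[OF dcutoff_bound] mult_left_mono power_mono) auto
    then show "\<bar>\<zeta>' (ex k) z\<bar> \<le> D" unfolding D_def by (simp add: add_increasing)
    have "0 \<le> 2 * real 2 * r * (r\<^sup>2) ^ (2 - 1)" using r(1) by simp
    then show "\<zeta> z \<le> D" unfolding D_def \<zeta>_def using cutoff_le[of c r 2 z] by linarith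
  qed
  have D0: "0 \<le> D" using D(2) by (meson abs_ge_zero order_trans)
  define E where "E = \<bar>(LINT z|lborel. indicat_real (ball c R) z) + K\<bar>"
  define Z where "Z = (LINT z|lborel. \<bar>\<zeta>' et z\<bar>)"
  define C where "C = real CARD('n) * (2 * M * D * E) + 2 * M * (M * Z + real CARD('n) * (D * E))
        + real CARD('n) * (2 * M * D * E + 4 * D * E)"
  show ?thesis
  proof (intro exI[of _ C] conjI allI impI)
    show "0 \<le> C" using M D0 by (simp add: C_def E_def Z_def)
    fix u g and h :: "(real^'n) \<times> real"
    assume su: "ball_supersol p M R c u g" and K: "(LINT z|lborel. norm (g z) powr p) \<le> K" and h: "norm h + r < R"
    interpret u: ball_supersol p M R c u g by fact
    have E: "(LINT z|lborel. energy p c R g z) \<le> E"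
      unfolding E_def using integral_energy_le[OF su K] by linarith
    obtain \<epsilon> :: "nat \<Rightarrow> real" where \<epsilon>: "\<And>n. \<epsilon> n > 0" "\<And>n. \<epsilon> n < R - r - norm h" "\<epsilon> \<longlonglongrightarrow> 0"
      and conv: "AE z in lborel. (\<lambda>n. moll (\<epsilon> n) u z) \<longlonglongrightarrow> u z"
      using moll_AE_tendsto[of "{()}" "\<lambda>_. u" "R - r - norm h"] u.integrable_u h by auto
    have [measurable]: "\<zeta> \<in> borel_measurable borel" "u \<in> borel_measurable borel"
      using bdd_measD[OF C1_bdd_D(1)[OF \<zeta>(1)]] u.mu by auto
    have bd: "\<bar>\<zeta> z * (a - b)\<^sup>2\<bar> \<le> D * (2 * M)\<^sup>2 * indicat_real (cball c r) z" if "\<bar>a\<bar> \<le> M" "\<bar>b\<bar> \<le> M" for a b z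
    proof (cases "z \<in> cball c r")
      case True
      have "(a - b)\<^sup>2 \<le> (2 * M)\<^sup>2" using that by (intro abs_le_square_iff[THEN iffD1]) auto
      then have "\<zeta> z * (a - b)\<^sup>2 \<le> D * (2 * M)\<^sup>2" using D(1)[of z] D0 by (intro mult_mono) auto
      then show ?thesis using True \<zeta>(3)[of z] by (simp add: abs_mult)
    next
      case False
      then show ?thesis using supp_inD[OF \<zeta>(2) False] by simp
    qed
    have "(\<lambda>n. LINT z|lborel. \<zeta> z * (moll (\<epsilon> n) u (z + h) - moll (\<epsilon> n) u z)\<^sup>2) \<longlonglongrightarrow> (LINT z|lborel. \<zeta> z * (u (z + h) - u z)\<^sup>2)"
    proof (rule integral_dominated_convergence[where w="\<lambda>z. D * (2 * M)\<^sup>2 * indicat_real (cball c r) z"])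
      show "integrable lborel (\<lambda>z. D * (2 * M)\<^sup>2 * indicat_real (cball c r) z)"
        by (intro integrable_mult_right integrable_indicator_cball)
      show "AE z in lborel. (\<lambda>n. \<zeta> z * (moll (\<epsilon> n) u (z + h) - moll (\<epsilon> n) u z)\<^sup>2) \<longlonglongrightarrow> \<zeta> z * (u (z + h) - u z)\<^sup>2"
        using conv AE_shift[OF conv, of h] by eventually_elim (intro tendsto_intros)
      show "AE z in lborel. norm (\<zeta> z * (moll (\<epsilon> n) u (z + h) - moll (\<epsilon> n) u z)\<^sup>2) \<le> D * (2 * M)\<^sup>2 * indicat_real (cball c r) z" for n
        using bd[OF moll_bound[OF \<epsilon>(1) u.integrable_u u.uM] moll_bound[OF \<epsilon>(1) u.integrable_u u.uM]] by simp
    qed measurable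
    moreover have "(LINT z|lborel. \<zeta> z * (moll (\<epsilon> n) u (z + h) - moll (\<epsilon> n) u z)\<^sup>2) \<le> C * norm h" for n
      using u.translation_smooth[OF \<epsilon>(1) _ \<zeta> D E, of h n Z] \<epsilon>(2)[of n] by (simp add: C_def Z_def mult.commute)
    ultimately have "(LINT z|lborel. \<zeta> z * (u (z + h) - u z)\<^sup>2) \<le> C * norm h"
      by (intro LIMSEQ_le_const2) auto
    then show "(LINT z|lborel. cutoff c r 2 z * (u (z + h) - u z)\<^sup>2) \<le> C * norm h" by (simp add: \<zeta>_def)
  qed
qed

text \<open>The step from a squared bound of order \<open>norm h\<close> to an \<open>L^1\<close>
  bound uses \<open>2 * l * x \<le> x\<^sup>2 + l\<^sup>2\<close>; the choice
  \<open>l = sqrt \<epsilon>\<close> balances both terms. Averaging over the shifts in the kernel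
  turns translates into the mollification error.\<close>

lemma moll_approximation_estimate:
  fixes c :: "(real^'n) \<times> real"
  assumes p: "p > 2" and r: "0 < r" "r < R" and M: "M \<ge> 0"
  shows "\<exists>C\<ge>0. \<forall>u g \<epsilon>. ball_supersol p M R c u g \<longrightarrow> (LINT z|lborel. norm (g z) powr p) \<le> K \<longrightarrow> 0 < \<epsilon> \<longrightarrow> \<epsilon> + r < R \<longrightarrow>
    (LINT z|lborel. cutoff c r 2 z * \<bar>moll \<epsilon> u z - u z\<bar>) \<le> C * sqrt \<epsilon>"
proof -
  obtain C where C: "C \<ge> 0" and tr: "\<And>u g h. ball_supersol p M R c u g \<Longrightarrow> (LINT z|lborel. norm (g z) powr p) \<le> K \<Longrightarrow> norm h + r < R \<Longrightarrow>
    (LINT z|lborel. cutoff c r 2 z * (u (z + h) - u z)\<^sup>2) \<le> C * norm h"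
    using translation_estimate[OF p r M, of c K] by blast
  have b: "bdd_meas (cutoff c r 2)" and s: "supp_in (cutoff c r 2) (cball c r)"
    using C1_bdd_D(1)[OF C1_bdd_cutoff[of 2 r c]] cutoff_supp[OF r(1), of 2 c] r(1) by auto
  define V where "V = (LINT z|lborel. cutoff c r 2 z)"
  have V0: "0 \<le> V" unfolding V_def by (intro Bochner_Integration.integral_nonneg cutoff_nonneg)
  show ?thesis
  proof (intro exI[of _ "(C + V) / 2"] conjI allI impI)
    show "0 \<le> (C + V) / 2" using C V0 by simp
    fix u g and \<epsilon> :: real
    assume su: "ball_supersol p M R c u g" and K: "(LINT z|lborel. norm (g z) powr p) \<le> K" and \<epsilon>: "0 < \<epsilon>" "\<epsilon> + r < R"
    interpret u: ball_supersol p M R c u g by fact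
    have bu: "bdd_meas u" using u.mu u.uM by (intro bdd_measI)
    have i: "integrable lborel (\<lambda>z. cutoff c r 2 z * f z)" if "bdd_meas f" for f
      by (rule integrable_bdd_meas_supp[OF bdd_meas_mult[OF b that] _ bounded_cball[of c r]])
        (use s in \<open>auto simp: supp_in_def\<close>)
    have "(LINT z|lborel. cutoff c r 2 z * \<bar>u (z + y) - u z\<bar>) \<le> (C + V) / 2 * sqrt \<epsilon>" if y: "norm y \<le> \<epsilon>" for y
    proof -
      define l where "l = sqrt \<epsilon>"
      have l: "l > 0" "l\<^sup>2 = \<epsilon>" using \<epsilon> by (auto simp: l_def)
      have bd: "bdd_meas (\<lambda>z. u (z + y) - u z)" by (intro bdd_meas_diff bdd_meas_shift bu)
      note i1 = i[OF bdd_meas_abs[OF bd]] i[OF bdd_meas_mult[OF bd bd]] i[OF bdd_meas_const[of 1]]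
      have "(LINT z|lborel. cutoff c r 2 z * \<bar>u (z + y) - u z\<bar>)
        \<le> (LINT z|lborel. (cutoff c r 2 z * (u (z + y) - u z)\<^sup>2) / (2 * l) + cutoff c r 2 z * l / 2)"
      proof (rule integral_mono)
        fix z
        define x where "x = \<bar>u (z + y) - u z\<bar>"
        have "0 \<le> (x - l)\<^sup>2" by simp
        then have "2 * l * x \<le> x\<^sup>2 + l\<^sup>2" by (simp add: power2_diff algebra_simps)
        then have "x \<le> x\<^sup>2 / (2 * l) + l / 2" using l(1) by (simp add: field_simps power2_eq_square)
        from mult_left_mono[OF this cutoff_nonneg[of c r 2 z]]
        show "cutoff c r 2 z * \<bar>u (z + y) - u z\<bar> \<le> (cutoff c r 2 z * (u (z + y) - u z)\<^sup>2) / (2 * l) + cutoff c r 2 z * l / 2"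
          by (simp add: x_def distrib_left)
      qed (use i1 in \<open>auto simp: power2_eq_square\<close>)
      also have "\<dots> = (LINT z|lborel. cutoff c r 2 z * (u (z + y) - u z)\<^sup>2) / (2 * l) + V * l / 2"
        using i1 by (simp add: V_def power2_eq_square)
      also have "\<dots> \<le> C * \<epsilon> / (2 * l) + V * l / 2"
        using tr[OF su K, of y] y \<epsilon> l C by (intro add_right_mono divide_right_mono) (auto intro: order_trans mult_left_mono)
      also have "\<dots> = (C + V) / 2 * l" using l by (simp add: l(2)[symmetric] power2_eq_square field_simps)
      finally show ?thesis by (simp add: l_def)
    qed
    from integral_moll_diff_le(2)[OF \<epsilon>(1) u.integrable_u b cutoff_nonneg _ this]
    show "(LINT z|lborel. cutoff c r 2 z * \<bar>moll \<epsilon> u z - u z\<bar>) \<le> (C + V) / 2 * sqrt \<epsilon>"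
      using C V0 \<epsilon> by simp
  qed
qed

text \<open>Only the kernel depends on the point, so the modulus of continuity is that of
  translation of \<open>mollker \<epsilon>\<close> in \<open>L^1\<close>; for fixed \<epsilon> it is
  common to all \<open>f\<close> bounded by \<open>M\<close>.\<close>

lemma moll_equicontinuous:
  fixes f :: "'a::euclidean_space \<Rightarrow> real"
  assumes \<epsilon>: "\<epsilon> > 0" and f: "integrable lborel f" "\<And>y. \<bar>f y\<bar> \<le> M"
  shows "\<bar>moll \<epsilon> f z - moll \<epsilon> f z'\<bar> \<le> M * (LINT w|lborel. \<bar>mollker \<epsilon> (w + (z' - z)) - mollker \<epsilon> w\<bar>)"
proof -
  note i = integrable_moll(1)[OF \<epsilon> f(1)]
  have M: "0 \<le> M" using f(2) abs_ge_zero order_trans by blast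
  have ik: "integrable lborel (\<lambda>w. mollker \<epsilon> (z - w))" for z :: 'a
    unfolding mollker_minus[of \<epsilon> z] using integrable_shift[OF integrable_mollker[OF \<epsilon>], of "-z"] by simp
  have "moll \<epsilon> f z - moll \<epsilon> f z' = (LINT w|lborel. (mollker \<epsilon> (z - w) - mollker \<epsilon> (z' - w)) * f w)"
    unfolding moll_def using i by (simp add: left_diff_distrib)
  also have "\<bar>\<dots>\<bar> \<le> (LINT w|lborel. M * \<bar>mollker \<epsilon> (z - w) - mollker \<epsilon> (z' - w)\<bar>)"
  proof (rule abs_integral_le)
    show "integrable lborel (\<lambda>w. (mollker \<epsilon> (z - w) - mollker \<epsilon> (z' - w)) * f w)"
      using i by (simp add: left_diff_distrib)
    show "integrable lborel (\<lambda>w. M * \<bar>mollker \<epsilon> (z - w) - mollker \<epsilon> (z' - w)\<bar>)"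
      using ik by simp
    show "\<bar>(mollker \<epsilon> (z - w) - mollker \<epsilon> (z' - w)) * f w\<bar> \<le> M * \<bar>mollker \<epsilon> (z - w) - mollker \<epsilon> (z' - w)\<bar>" for w
      using mult_left_mono[OF f(2)[of w], of "\<bar>mollker \<epsilon> (z - w) - mollker \<epsilon> (z' - w)\<bar>"] by (simp add: abs_mult mult.commute)
  qed
  also have "\<dots> = M * (LINT w|lborel. \<bar>mollker \<epsilon> (w - z) - mollker \<epsilon> (w - z')\<bar>)"
    by (simp add: mollker_minus[of \<epsilon> z] mollker_minus[of \<epsilon> z'])
  also have "(LINT w|lborel. \<bar>mollker \<epsilon> (w - z) - mollker \<epsilon> (w - z')\<bar>)
    = (LINT w|lborel. \<bar>mollker \<epsilon> (w + z' - z) - mollker \<epsilon> (w + z' - z')\<bar>)"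
    by (rule integral_shift[symmetric]) measurable
  finally show ?thesis by (simp add: add_diff_eq)
qed

text \<open>An argument of Arzela-Ascoli type: one subsequence converges for all radii at the points
  of a countable dense set, and equicontinuity at each fixed radius extends this to every
  point.\<close>

lemma moll_pointwise_subsequence:
  fixes u :: "nat \<Rightarrow> 'a::euclidean_space \<Rightarrow> real"
  assumes u: "\<And>i. integrable lborel (u i)" "\<And>i y. \<bar>u i y\<bar> \<le> M"
  obtains k where "strict_mono (k :: nat \<Rightarrow> nat)"
    "\<And>m z. convergent (\<lambda>i. moll (1 / real (Suc m)) (u (k i)) z)"
proof -
  have pos: "1 / real (Suc m) > 0" for m by simp
  obtain D :: "'a set" where D: "countable D" "\<And>X. open X \<Longrightarrow> X \<noteq> {} \<Longrightarrow> \<exists>d\<in>D. d \<in> X"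
    using countable_dense_exists by blast
  have M: "0 \<le> M" using u(2) abs_ge_zero order_trans by blast
  have "countable ((UNIV :: nat set) \<times> D)" using D(1) by simp
  moreover have "norm (moll (1 / real (Suc (fst x))) (u i) (snd x)) \<le> M" for i x
    using moll_bound[OF pos u(1) u(2)] by simp
  ultimately obtain k where k: "strict_mono (k :: nat \<Rightarrow> nat)"
    "\<And>x. x \<in> UNIV \<times> D \<Longrightarrow> \<exists>l. (\<lambda>i. moll (1 / real (Suc (fst x))) (u (k i)) (snd x)) \<longlonglongrightarrow> l"
    using function_convergent_subsequence[of "UNIV \<times> D" "\<lambda>i x. moll (1 / real (Suc (fst x))) (u i) (snd x)" M] by metis
  show thesis
  proof (rule that[OF k(1)])
    fix m z
    define \<epsilon> where "\<epsilon> = 1 / real (Suc m)"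
    have \<epsilon>: "\<epsilon> > 0" by (simp add: \<epsilon>_def)
    show "convergent (\<lambda>i. moll (1 / real (Suc m)) (u (k i)) z)"
      unfolding \<epsilon>_def[symmetric]
    proof (rule Cauchy_convergent, rule metric_CauchyI)
      fix e :: real assume e: "e > 0"
      \<comment> \<open>\<open>M + 1\<close> avoids division by 0 and gives a strict inequality
        below.\<close>
      have "e / (3 * (M + 1)) > 0" using e M by simp
      from tendstoD[OF L1_translation[OF integrable_mollker[OF \<epsilon>]] this]
      obtain d where d: "d > 0" "\<And>y. y \<noteq> 0 \<Longrightarrow> norm y < d \<Longrightarrow> (LINT w|lborel. \<bar>mollker \<epsilon> (w + y) - mollker \<epsilon> (w::'a)\<bar>) < e / (3 * (M + 1))"
        by (auto simp: eventually_at dist_norm)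
      obtain q where q: "q \<in> D" "q \<in> ball z d" using D(2)[of "ball z d"] d(1) by auto
      have "(LINT w|lborel. \<bar>mollker \<epsilon> (w + (q - z)) - mollker \<epsilon> w\<bar>) < e / (3 * (M + 1))"
        using d(2)[of "q - z"] q(2) \<open>e / (3 * (M + 1)) > 0\<close> by (cases "q = z") (auto simp: dist_norm norm_minus_commute)
      then have "M * (LINT w|lborel. \<bar>mollker \<epsilon> (w + (q - z)) - mollker \<epsilon> w\<bar>) \<le> M * (e / (3 * (M + 1)))"
        using M by (intro mult_left_mono) auto
      also have "\<dots> < e / 3" using e M by (simp add: field_simps)
      finally have near: "\<bar>moll \<epsilon> (u i) z - moll \<epsilon> (u i) q\<bar> < e / 3" for i
        using moll_equicontinuous[OF \<epsilon> u(1) u(2), of i z q] by linarith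
      obtain l where "(\<lambda>i. moll \<epsilon> (u (k i)) q) \<longlonglongrightarrow> l" using k(2)[of "(m, q)"] q(1) by (auto simp: \<epsilon>_def)
      then have "Cauchy (\<lambda>i. moll \<epsilon> (u (k i)) q)" by (rule LIMSEQ_imp_Cauchy)
      then obtain N where N: "\<And>i j. i \<ge> N \<Longrightarrow> j \<ge> N \<Longrightarrow> dist (moll \<epsilon> (u (k i)) q) (moll \<epsilon> (u (k j)) q) < e / 3"
        using e unfolding Cauchy_def by (meson divide_pos_pos zero_less_numeral)
      show "\<exists>N. \<forall>i\<ge>N. \<forall>j\<ge>N. dist (moll \<epsilon> (u (k i)) z) (moll \<epsilon> (u (k j)) z) < e"
      proof (intro exI allI impI)
        fix i j assume ij: "i \<ge> N" "j \<ge> N"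
        show "dist (moll \<epsilon> (u (k i)) z) (moll \<epsilon> (u (k j)) z) < e"
          using near[of "k i"] near[of "k j"] N[OF ij] unfolding dist_real_def by linarith
      qed
    qed
  qed
qed

text \<open>Above the level \<open>l\<close> the power pays for the excess:
  \<open>x powr (1 - q) \<le> l powr (1 - q)\<close>, as \<open>1 - q < 0\<close>. Given a bound on
  the integral of \<open>x powr q\<close>, the second term is small for large \<open>l\<close>; this
  is a quantitative form of uniform integrability.\<close>

lemma le_min_add_powr:
  fixes x l q :: real
  assumes "0 \<le> x" "0 < l" "q > 1"
  shows "x \<le> min x l + l powr (1 - q) * x powr q"
proof (cases "x \<le> l")
  case True
  then show ?thesis by simp
next
  case False
  then have x: "x > 0" using assms by simp
  have "x = x powr (1 - q) * x powr q" using x by (simp add: powr_add[symmetric])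
  also have "\<dots> \<le> l powr (1 - q) * x powr q"
    using False assms by (intro mult_right_mono powr_mono2') auto
  finally show ?thesis using False assms by simp
qed

lemma le_add_powr:
  fixes x \<eta> p :: real
  assumes "0 \<le> x" "0 < \<eta>" "p > 1"
  shows "x \<le> \<eta> + \<eta> powr (1 - p) * x powr p"
  using le_min_add_powr[OF assms] by linarith

text \<open>Mollifications converge for each radius and approximate the functions uniformly over the
  sequence, so the functions are Cauchy in a weighted \<open>L^1\<close> norm. The gradients are
  then Cauchy in \<open>L^1\<close> on the inner ball as well, and a further subsequence is Cauchy
  almost everywhere.\<close>

lemma local_compactness:
  fixes c :: "(real^'n) \<times> real"
  assumes p: "p > 2" and r: "0 < r" "r < R"
    and sol: "\<And>i. ball_supersol p M R c (u i) (g i)" and K: "\<And>i. (LINT z|lborel. norm (g i z) powr p) \<le> K"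
  shows "\<exists>s. strict_mono (s :: nat \<Rightarrow> nat) \<and> (AE z in lborel. z \<in> ball c r \<longrightarrow>
     convergent (\<lambda>i. u (s i) z) \<and> convergent (\<lambda>i. g (s i) z))"
proof -
  interpret s: ball_supersol p M R c "u i" "g i" for i by (rule sol)
  note M = s.M_nonneg
  define r1 where "r1 = (r + R) / 2"
  have r1: "r < r1" "r1 < R" "0 < r1" using r by (auto simp: r1_def)
  define \<zeta> where "\<zeta> = cutoff c r1 2"
  have \<zeta>: "bdd_meas \<zeta>" "supp_in \<zeta> (cball c r1)" "\<And>z. 0 \<le> \<zeta> z"
    unfolding \<zeta>_def using C1_bdd_D(1)[OF C1_bdd_cutoff[of 2 r1 c]] cutoff_supp[OF r1(3), of 2 c] r1(3) cutoff_nonneg by auto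
  have bu: "bdd_meas (u i)" for i using s.mu s.uM by (rule bdd_measI)
  have i\<zeta>: "integrable lborel (\<lambda>z. \<zeta> z * f z)" if "bdd_meas f" for f
    by (rule integrable_bdd_meas_supp[OF bdd_meas_mult[OF \<zeta>(1) that] _ bounded_cball[of c r1]])
      (use \<zeta>(2) in \<open>auto simp: supp_in_def\<close>)
  note [measurable] = s.mu s.mg bdd_measD[OF \<zeta>(1)]
  have [measurable]: "ball c r \<in> sets borel" by simp
  obtain k where k: "strict_mono (k :: nat \<Rightarrow> nat)"
    "\<And>m z. convergent (\<lambda>i. moll (1 / real (Suc m)) (u (k i)) z)"
    using moll_pointwise_subsequence[of u M] s.integrable_u s.uM by blast
  obtain C where C: "C \<ge> 0" and ap: "\<And>i \<epsilon>. 0 < \<epsilon> \<Longrightarrow> \<epsilon> + r1 < R \<Longrightarrow>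
      (LINT z|lborel. \<zeta> z * \<bar>moll \<epsilon> (u i) z - u i z\<bar>) \<le> C * sqrt \<epsilon>"
    using moll_approximation_estimate[OF p r1(3,2) M, of c K] sol K unfolding \<zeta>_def by blast
  have cauchy: "\<exists>N. \<forall>i\<ge>N. \<forall>j\<ge>N. (LINT z|lborel. \<zeta> z * \<bar>u (k i) z - u (k j) z\<bar>) < e" if e: "e > 0" for e
  proof -
    have "(\<lambda>m. C * sqrt (1 / real (Suc m))) \<longlonglongrightarrow> C * sqrt 0"
      by (intro tendsto_intros LIMSEQ_inverse_real_of_nat[unfolded inverse_eq_divide])
    then have "\<forall>\<^sub>F m in sequentially. C * sqrt (1 / real (Suc m)) < e / 4"
      using order_tendstoD(2)[of _ "C * sqrt 0" sequentially "e / 4"] e by simp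
    moreover have "\<forall>\<^sub>F m in sequentially. 1 / real (Suc m) < R - r1"
      using order_tendstoD(2)[OF LIMSEQ_inverse_real_of_nat, of "R - r1"] r1 by (simp add: inverse_eq_divide)
    ultimately have "\<forall>\<^sub>F m in sequentially. C * sqrt (1 / real (Suc m)) < e / 4 \<and> 1 / real (Suc m) < R - r1"
      by (rule eventually_conj)
    then obtain m where m: "C * sqrt (1 / real (Suc m)) < e / 4" "1 / real (Suc m) < R - r1"
      using eventually_happens'[OF sequentially_bot] by blast
    define \<epsilon> where "\<epsilon> = 1 / real (Suc m)"
    have \<epsilon>: "\<epsilon> > 0" "\<epsilon> + r1 < R" "C * sqrt \<epsilon> < e / 4" using m by (auto simp: \<epsilon>_def)
    \<comment> \<open>The pointwise limit at a fixed radius is the common reference for both members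
      of the pair \<open>i\<close>, \<open>j\<close>.\<close>
    define V where "V z = lim (\<lambda>i. moll \<epsilon> (u (k i)) z)" for z
    have V: "(\<lambda>i. moll \<epsilon> (u (k i)) z) \<longlonglongrightarrow> V z" for z
      unfolding V_def using k(2)[of m z] by (simp add: \<epsilon>_def convergent_LIMSEQ_iff)
    have bm: "\<bar>moll \<epsilon> (u i) z\<bar> \<le> M" for i z by (rule moll_bound[OF \<epsilon>(1) s.integrable_u s.uM])
    have bmm: "bdd_meas (moll \<epsilon> (u i))" for i by (rule bdd_measI[OF _ bm]) measurable
    have VM: "\<bar>V z\<bar> \<le> M" for z
      by (rule LIMSEQ_le_const2[OF tendsto_rabs[OF V]]) (use bm in auto)
    have mV: "V \<in> borel_measurable borel"
      by (rule borel_measurable_LIMSEQ_real[OF V]) (measurable)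
    have bV: "bdd_meas V" using mV VM by (rule bdd_measI)
    have "(\<lambda>i. LINT z|lborel. \<zeta> z * \<bar>moll \<epsilon> (u (k i)) z - V z\<bar>) \<longlonglongrightarrow> (LINT z|(lborel :: ((real^'n) \<times> real) measure). 0)"
    proof (rule integral_dominated_convergence[where w="\<lambda>z. \<zeta> z * (2 * M)"])
      show "integrable lborel (\<lambda>z. \<zeta> z * (2 * M))" by (rule i\<zeta>[OF bdd_meas_const])
      show "AE z in lborel. (\<lambda>i. \<zeta> z * \<bar>moll \<epsilon> (u (k i)) z - V z\<bar>) \<longlonglongrightarrow> 0"
      proof (rule AE_I2)
        fix z
        have "(\<lambda>i. \<zeta> z * \<bar>moll \<epsilon> (u (k i)) z - V z\<bar>) \<longlonglongrightarrow> \<zeta> z * \<bar>V z - V z\<bar>" by (intro tendsto_intros V)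
        then show "(\<lambda>i. \<zeta> z * \<bar>moll \<epsilon> (u (k i)) z - V z\<bar>) \<longlonglongrightarrow> 0" by simp
      qed
      show "AE z in lborel. norm (\<zeta> z * \<bar>moll \<epsilon> (u (k i)) z - V z\<bar>) \<le> \<zeta> z * (2 * M)" for i
      proof (rule AE_I2)
        fix z
        have "\<bar>moll \<epsilon> (u (k i)) z - V z\<bar> \<le> 2 * M" using bm[of "k i" z] VM[of z] by linarith
        then show "norm (\<zeta> z * \<bar>moll \<epsilon> (u (k i)) z - V z\<bar>) \<le> \<zeta> z * (2 * M)"
          using \<zeta>(3)[of z] by (simp add: abs_mult mult_left_mono)
      qed
    qed (use bdd_measD[OF bmm] mV in measurable)
    then have "\<forall>\<^sub>F i in sequentially. (LINT z|lborel. \<zeta> z * \<bar>moll \<epsilon> (u (k i)) z - V z\<bar>) < e / 4"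
      using order_tendstoD(2)[of _ 0 sequentially "e / 4"] e by simp
    then obtain N where N: "\<And>i. i \<ge> N \<Longrightarrow> (LINT z|lborel. \<zeta> z * \<bar>moll \<epsilon> (u (k i)) z - V z\<bar>) < e / 4"
      by (auto simp: eventually_sequentially)
    show ?thesis
    proof (intro exI allI impI)
      fix i j assume ij: "i \<ge> N" "j \<ge> N"
      note ii = i\<zeta>[OF bdd_meas_abs[OF bdd_meas_diff[OF bmm bu]]] i\<zeta>[OF bdd_meas_abs[OF bdd_meas_diff[OF bmm bV]]]
      have "(LINT z|lborel. \<zeta> z * \<bar>u (k i) z - u (k j) z\<bar>)
        \<le> (LINT z|lborel. \<zeta> z * \<bar>moll \<epsilon> (u (k i)) z - u (k i) z\<bar> + \<zeta> z * \<bar>moll \<epsilon> (u (k i)) z - V z\<bar>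
           + \<zeta> z * \<bar>moll \<epsilon> (u (k j)) z - V z\<bar> + \<zeta> z * \<bar>moll \<epsilon> (u (k j)) z - u (k j) z\<bar>)"
      proof (rule integral_mono[OF i\<zeta>[OF bdd_meas_abs[OF bdd_meas_diff[OF bu bu]]]])
        fix z
        have "\<bar>u (k i) z - u (k j) z\<bar> \<le> \<bar>moll \<epsilon> (u (k i)) z - u (k i) z\<bar> + \<bar>moll \<epsilon> (u (k i)) z - V z\<bar>
           + \<bar>moll \<epsilon> (u (k j)) z - V z\<bar> + \<bar>moll \<epsilon> (u (k j)) z - u (k j) z\<bar>" by linarith
        from mult_left_mono[OF this \<zeta>(3)[of z]]
        show "\<zeta> z * \<bar>u (k i) z - u (k j) z\<bar> \<le> \<zeta> z * \<bar>moll \<epsilon> (u (k i)) z - u (k i) z\<bar> + \<zeta> z * \<bar>moll \<epsilon> (u (k i)) z - V z\<bar>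
           + \<zeta> z * \<bar>moll \<epsilon> (u (k j)) z - V z\<bar> + \<zeta> z * \<bar>moll \<epsilon> (u (k j)) z - u (k j) z\<bar>"
          by (simp add: distrib_left)
      qed (use ii in auto)
      also have "\<dots> = (LINT z|lborel. \<zeta> z * \<bar>moll \<epsilon> (u (k i)) z - u (k i) z\<bar>) + (LINT z|lborel. \<zeta> z * \<bar>moll \<epsilon> (u (k i)) z - V z\<bar>)
           + (LINT z|lborel. \<zeta> z * \<bar>moll \<epsilon> (u (k j)) z - V z\<bar>) + (LINT z|lborel. \<zeta> z * \<bar>moll \<epsilon> (u (k j)) z - u (k j) z\<bar>)"
        using ii by simp
      also have "\<dots> < e"
        using N[OF ij(1)] N[OF ij(2)] ap[OF \<epsilon>(1,2), of "k i"] ap[OF \<epsilon>(1,2), of "k j"] \<epsilon>(3) by linarith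
      finally show "(LINT z|lborel. \<zeta> z * \<bar>u (k i) z - u (k j) z\<bar>) < e" .
    qed
  qed
  define q where "q = (r1\<^sup>2 - r\<^sup>2) ^ 2"
  have q: "q > 0" unfolding q_def using r r1 by (simp add: power_strict_mono)
  define B where "B = indicat_real (ball c r)"
  have [measurable]: "B \<in> borel_measurable borel" unfolding B_def by measurable
  have B01: "0 \<le> B z" "B z \<le> 1" for z by (auto simp: B_def indicator_def)
  have iB: "integrable lborel B" unfolding B_def using emeasure_bounded_finite[OF bounded_ball, of c r]
    by (intro integrable_real_indicator) auto
  have q\<zeta>: "q * B z \<le> \<zeta> z" for z
  proof (cases "z \<in> ball c r")
    case True
    then have "q \<le> \<zeta> z" unfolding q_def \<zeta>_def
      using r r1 by (intro cutoff_ge) (auto simp: dist_norm norm_minus_commute)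
    then show ?thesis using True by (simp add: B_def)
  next
    case False then show ?thesis using \<zeta>(3)[of z] by (simp add: B_def)
  qed
  \<comment> \<open>Division by the lower bound \<open>q\<close> of \<zeta> turns the weighted
    distance into a bound over the inner ball.\<close>
  define X where "X i j = (LINT z|lborel. \<zeta> z * \<bar>u i z - u j z\<bar>) / q" for i j
  have iBf: "integrable lborel (\<lambda>z. B z * f z)" if "integrable lborel f" for f
  proof -
    have "bdd_meas B" using B01 by (intro bdd_measI[of B 1]) auto
    then show ?thesis using that by (rule integrable_bdd_meas_mult)
  qed
  have iBu: "integrable lborel (\<lambda>z. B z * \<bar>u i z - u j z\<bar>)" for i j
    using s.integrable_u[of i] s.integrable_u[of j] by (intro iBf) auto
  have BX: "(LINT z|lborel. B z * \<bar>u i z - u j z\<bar>) \<le> X i j" for i j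
  proof -
    have "q * (LINT z|lborel. B z * \<bar>u i z - u j z\<bar>) = (LINT z|lborel. q * (B z * \<bar>u i z - u j z\<bar>))" by simp
    also have "\<dots> \<le> (LINT z|lborel. \<zeta> z * \<bar>u i z - u j z\<bar>)"
    proof (rule integral_mono)
      show "q * (B z * \<bar>u i z - u j z\<bar>) \<le> \<zeta> z * \<bar>u i z - u j z\<bar>" for z
        using mult_right_mono[OF q\<zeta>[of z], of "\<bar>u i z - u j z\<bar>"] by (simp add: mult.assoc)
    qed (use iBu i\<zeta>[OF bdd_meas_abs[OF bdd_meas_diff[OF bu bu]]] in auto)
    finally show ?thesis using q by (simp add: X_def pos_le_divide_eq mult.commute)
  qed
  from gradient_comparison[OF p r M, of c K] obtain C2 where C2: "C2 \<ge> 0" and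
    "\<forall>u g v h \<delta>. ball_supersol p M R c u g \<longrightarrow> ball_supersol p M R c v h \<longrightarrow> \<delta> > 0 \<longrightarrow>
    (LINT z|lborel. norm (g z) powr p) \<le> K \<longrightarrow> (LINT z|lborel. norm (h z) powr p) \<le> K \<longrightarrow>
    (LINT z|lborel. B z * (if \<bar>u z - v z\<bar> \<le> \<delta> then norm (g z - h z) powr p else 0)) \<le> C2 * \<delta>"
    unfolding B_def by (elim exE conjE)
  then have gc: "(LINT z|lborel. B z * (if \<bar>u i z - u j z\<bar> \<le> \<delta> then norm (g i z - g j z) powr p else 0)) \<le> C2 * \<delta>"
    if "\<delta> > 0" for i j \<delta>
    using sol[of i] sol[of j] K[of i] K[of j] that by simp
  have ig: "integrable lborel (g i)" for i
  proof (rule Bochner_Integration.integrable_bound[OF s.integrable_energy[of i]])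
    have gle: "norm (g i z) \<le> energy p c R (g i) z" for z
    proof (cases "z \<in> ball c R")
      case True
      then show ?thesis using powr_le_one_plus[of "norm (g i z)" 1 p] p by (simp add: energy_def)
    qed (simp add: s.out energy_def)
    show "AE z in lborel. norm (g i z) \<le> norm (energy p c R (g i) z)"
      unfolding real_norm_def by (intro AE_I2 order_trans[OF gle abs_ge_self])
  qed measurable
  have iBg: "integrable lborel (\<lambda>z. B z * norm (g i z - g j z))" for i j
    using ig[of i] ig[of j] by (intro iBf integrable_norm) auto
  \<comment> \<open>Function and gradient are paired so that a single subsequence works for both;
    \<open>B\<close> restricts to the inner ball.\<close>
  define S where "S i z = B z *\<^sub>R (u (k i) z, g (k i) z)" for i z
  have "\<exists>t. strict_mono t \<and> (AE z in lborel. Cauchy (\<lambda>i. S (t i) z))"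
  proof -
    have Sint: "integrable lborel (S i)" for i
    proof (rule Bochner_Integration.integrable_bound)
      show "integrable lborel (\<lambda>z. \<bar>u (k i) z\<bar> + norm (g (k i) z))" using s.integrable_u ig by auto
      show "AE z in lborel. norm (S i z) \<le> norm (\<bar>u (k i) z\<bar> + norm (g (k i) z))"
      proof (rule AE_I2)
        fix z
        have "norm (S i z) = B z * norm (u (k i) z, g (k i) z)" using B01 by (simp add: S_def del: scaleR_Pair)
        also have "\<dots> \<le> 1 * (\<bar>u (k i) z\<bar> + norm (g (k i) z))"
          using B01 norm_Pair_le[of "u (k i) z" "g (k i) z"] by (intro mult_mono) auto
        finally show "norm (S i z) \<le> norm (\<bar>u (k i) z\<bar> + norm (g (k i) z))" by simp
      qed
      show "S i \<in> borel_measurable lborel" unfolding S_def by measurable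
    qed
    have Sdiff: "(LINT z|lborel. norm (S i z - S j z)) \<le> X (k i) (k j) + (LINT z|lborel. B z * norm (g (k i) z - g (k j) z))" for i j
    proof -
      have "(LINT z|lborel. norm (S i z - S j z)) \<le> (LINT z|lborel. B z * \<bar>u (k i) z - u (k j) z\<bar> + B z * norm (g (k i) z - g (k j) z))"
      proof (rule integral_mono)
        fix z
        have "norm (S i z - S j z) = norm (B z *\<^sub>R (u (k i) z - u (k j) z, g (k i) z - g (k j) z))"
          by (simp add: S_def scaleR_diff_right right_diff_distrib)
        also have "\<dots> = B z * norm (u (k i) z - u (k j) z, g (k i) z - g (k j) z)" using B01 by (simp del: scaleR_Pair)
        also have "\<dots> \<le> B z * (\<bar>u (k i) z - u (k j) z\<bar> + norm (g (k i) z - g (k j) z))"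
          using B01 norm_Pair_le[of "u (k i) z - u (k j) z" "g (k i) z - g (k j) z"] by (intro mult_left_mono) auto
        finally show "norm (S i z - S j z) \<le> B z * \<bar>u (k i) z - u (k j) z\<bar> + B z * norm (g (k i) z - g (k j) z)"
          by (simp add: distrib_left)
      qed (use Sint iBu iBg in auto)
      also have "\<dots> = (LINT z|lborel. B z * \<bar>u (k i) z - u (k j) z\<bar>) + (LINT z|lborel. B z * norm (g (k i) z - g (k j) z))"
        using iBu iBg by simp
      finally show ?thesis using BX[of "k i" "k j"] by linarith
    qed
    define VB where "VB = (LINT z|lborel. B z)"
    have VB0: "0 \<le> VB" unfolding VB_def using B01 by (intro Bochner_Integration.integral_nonneg) auto
    have K0: "0 \<le> K" using K[of 0] by (rule order_trans[rotated]) simp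
    \<comment> \<open>Split into \<open>|u i - u j| \<le> \<delta>\<close>, where the gradients are close, and its complement, which has small measure.\<close>
    have gdiff: "(LINT z|lborel. B z * norm (g i z - g j z))
      \<le> \<eta> * VB + \<eta> powr (1 - p) * (C2 * \<delta>) + 2 * l / \<delta> * X i j + l powr (1 - p) * (2 * K)"
      if pos: "\<eta> > 0" "\<delta> > 0" "l > 0" for i j \<eta> \<delta> l
    proof -
      let ?f = "\<lambda>z. B z * (if \<bar>u i z - u j z\<bar> \<le> \<delta> then norm (g i z - g j z) powr p else 0)"
      have pw: "B z * norm (g i z - g j z) \<le> \<eta> * B z + \<eta> powr (1 - p) * ?f z + 2 * l / \<delta> * (B z * \<bar>u i z - u j z\<bar>)
        + l powr (1 - p) * (norm (g i z) powr p + norm (g j z) powr p)" for z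
      proof -
        have t: "0 \<le> l powr (1 - p) * (norm (g i z) powr p + norm (g j z) powr p)" by simp
        show ?thesis
        proof (cases "z \<in> ball c r")
          case False
          then show ?thesis using t by (simp add: B_def)
        next
          case True
          then have B1: "B z = 1" by (simp add: B_def)
          show ?thesis
          proof (cases "\<bar>u i z - u j z\<bar> \<le> \<delta>")
            case True
            have "norm (g i z - g j z) \<le> \<eta> + \<eta> powr (1 - p) * norm (g i z - g j z) powr p"
              using pos p by (intro le_add_powr) auto
            moreover have "0 \<le> 2 * l / \<delta> * \<bar>u i z - u j z\<bar>" using pos by simp
            ultimately show ?thesis using t unfolding B1 mult_1 mult_1_right if_P[OF True] by linarith
          next
            case False
            have "norm (g i z - g j z) \<le> norm (g i z) + norm (g j z)" by (rule norm_triangle_ineq4)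
            also have "\<dots> \<le> (l + l powr (1 - p) * norm (g i z) powr p) + (l + l powr (1 - p) * norm (g j z) powr p)"
              using pos p by (intro add_mono le_add_powr) auto
            finally have "norm (g i z - g j z) \<le> 2 * l + l powr (1 - p) * (norm (g i z) powr p + norm (g j z) powr p)"
              by (simp add: distrib_left)
            \<comment> \<open>Chebyshev: where the functions differ by more than \<delta>, a
              constant is at most a multiple of their difference.\<close>
            moreover have "2 * l \<le> 2 * l / \<delta> * \<bar>u i z - u j z\<bar>"
            proof -
              have "2 * l / \<delta> * \<delta> \<le> 2 * l / \<delta> * \<bar>u i z - u j z\<bar>" using False pos by (intro mult_left_mono) auto
              then show ?thesis using pos by simp
            qed
            ultimately show ?thesis using False pos by (simp add: B1)
          qed
        qed
      qed
      have if1: "integrable lborel ?f"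
      proof (rule Bochner_Integration.integrable_bound)
        show "integrable lborel (\<lambda>z. 2 powr p * (norm (g i z) powr p + norm (g j z) powr p))" using s.gp by simp
        show "AE z in lborel. norm (?f z) \<le> norm (2 powr p * (norm (g i z) powr p + norm (g j z) powr p))"
        proof (rule AE_I2)
          fix z
          have "norm (g i z - g j z) powr p \<le> (2 * max (norm (g i z)) (norm (g j z))) powr p"
            using norm_triangle_ineq4[of "g i z" "g j z"] p by (intro powr_mono2) auto
          also have "\<dots> = 2 powr p * max (norm (g i z)) (norm (g j z)) powr p" by (simp add: powr_mult le_max_iff_disj)
          also have "\<dots> \<le> 2 powr p * (norm (g i z) powr p + norm (g j z) powr p)" by (auto simp: max_def)
          finally have "norm (g i z - g j z) powr p \<le> 2 powr p * (norm (g i z) powr p + norm (g j z) powr p)" .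
          then have "\<bar>?f z\<bar> \<le> 2 powr p * (norm (g i z) powr p + norm (g j z) powr p)"
            using B01[of z] by (auto simp: abs_mult intro: order_trans[OF mult_left_le_one_le])
          then show "norm (?f z) \<le> norm (2 powr p * (norm (g i z) powr p + norm (g j z) powr p))" by simp
        qed
        have "?f \<in> borel_measurable borel" by measurable
        then show "?f \<in> borel_measurable lborel" by simp
      qed
      have "(LINT z|lborel. B z * norm (g i z - g j z)) \<le> (LINT z|lborel. \<eta> * B z + \<eta> powr (1 - p) * ?f z + 2 * l / \<delta> * (B z * \<bar>u i z - u j z\<bar>)
        + l powr (1 - p) * (norm (g i z) powr p + norm (g j z) powr p))"
        by (rule integral_mono[OF iBg _ pw])
          (intro Bochner_Integration.integrable_add integrable_mult_right iB if1 iBu s.gp)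
      also have "\<dots> = \<eta> * VB + \<eta> powr (1 - p) * (LINT z|lborel. ?f z) + 2 * l / \<delta> * (LINT z|lborel. B z * \<bar>u i z - u j z\<bar>)
        + l powr (1 - p) * ((LINT z|lborel. norm (g i z) powr p) + (LINT z|lborel. norm (g j z) powr p))"
        using iB if1 iBu s.gp by (simp add: VB_def)
      also have "\<dots> \<le> \<eta> * VB + \<eta> powr (1 - p) * (C2 * \<delta>) + 2 * l / \<delta> * X i j + l powr (1 - p) * (2 * K)"
        using gc[OF pos(2), of i j] BX[of i j] K[of i] K[of j] pos by (intro add_mono mult_left_mono order_refl) auto
      finally show ?thesis .
    qed
    have "\<exists>N. \<forall>i\<ge>N. \<forall>j\<ge>N. (LINT z|lborel. norm (S i z - S j z)) < e" if e: "e > 0" for e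
    proof -
      \<comment> \<open>Order of choice: \<eta> small for the set of closeness, \<open>l\<close>
        large for the tail of the gradients, then \<delta> depending on \<eta>, and last the index
        \<open>N\<close> depending on \<open>l\<close> and \<delta>. Each contribution is below
        \<open>e / 4\<close>.\<close>
      define \<eta> where "\<eta> = e / (8 * (VB + 1))"
      have \<eta>: "\<eta> > 0" "\<eta> * VB < e / 4" using e VB0 by (auto simp: \<eta>_def field_simps add_pos_nonneg)
      define l where "l = (e / (16 * (K + 1))) powr (1 / (1 - p))"
      have l: "l > 0" using e K0 by (simp add: l_def)
      have lp: "l powr (1 - p) = e / (16 * (K + 1))"
        using e K0 p by (simp add: l_def powr_powr)
      have "l powr (1 - p) * (2 * K) \<le> l powr (1 - p) * (2 * (K + 1))" by (intro mult_left_mono) auto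
      also have "\<dots> = e / 8" unfolding lp using K0 by (simp add: field_simps)
      finally have l2: "l powr (1 - p) * (2 * K) < e / 4" using e by simp
      define \<delta> where "\<delta> = e / (8 * (\<eta> powr (1 - p) * C2 + 1))"
      have A: "0 \<le> \<eta> powr (1 - p) * C2" using C2 by simp
      have \<delta>: "\<delta> > 0" using e A by (simp add: \<delta>_def)
      have \<delta>2: "\<eta> powr (1 - p) * (C2 * \<delta>) < e / 4"
      proof -
        have "(\<eta> powr (1 - p) * C2) * \<delta> \<le> (\<eta> powr (1 - p) * C2 + 1) * \<delta>" using \<delta> by (intro mult_right_mono) auto
        also have "\<dots> = e / 8"
        proof -
          have "x * (e / (8 * x)) = e / 8" if "x \<noteq> 0" for x using that by simp
          then show ?thesis unfolding \<delta>_def using A by (metis add_nonneg_eq_0_iff zero_le_one zero_neq_one)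
        qed
        finally show ?thesis using e by (simp add: mult.assoc)
      qed
      \<comment> \<open>The distance of the functions enters twice, directly and with the Chebyshev
        factor \<open>2 * l / \<delta>\<close>.\<close>
      define t where "t = 1 + 2 * l / \<delta>"
      have t: "t > 0" using l \<delta> by (simp add: t_def add_pos_pos)
      obtain N where N: "\<And>i j. i \<ge> N \<Longrightarrow> j \<ge> N \<Longrightarrow> (LINT z|lborel. \<zeta> z * \<bar>u (k i) z - u (k j) z\<bar>) < q * (e / 4) / t"
        using cauchy[of "q * (e / 4) / t"] q e t by auto
      show ?thesis
      proof (intro exI allI impI)
        fix i j assume ij: "i \<ge> N" "j \<ge> N"
        have "X (k i) (k j) < e / 4 / t" using N[OF ij] q by (simp add: X_def field_simps)
        then have "t * X (k i) (k j) < e / 4" using t by (simp add: field_simps)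
        then have "X (k i) (k j) + 2 * l / \<delta> * X (k i) (k j) < e / 4" by (simp add: t_def distrib_right)
        then show "(LINT z|lborel. norm (S i z - S j z)) < e"
          using Sdiff[of i j] gdiff[OF \<eta>(1) \<delta> l, of "k i" "k j"] \<eta>(2) \<delta>2 l2 by linarith
      qed
    qed
    from cauchy_L1_AE_cauchy_subseq[of lborel S, OF Sint this] show ?thesis by auto
  qed
  then obtain t where t: "strict_mono t" "AE z in lborel. Cauchy (\<lambda>i. S (t i) z)" by blast
  show ?thesis
  proof (intro exI[of _ "k \<circ> t"] conjI)
    show "strict_mono (k \<circ> t)" using k(1) t(1) by (rule strict_mono_o)
    show "AE z in lborel. z \<in> ball c r \<longrightarrow> convergent (\<lambda>i. u ((k \<circ> t) i) z) \<and> convergent (\<lambda>i. g ((k \<circ> t) i) z)"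
      using t(2)
    proof eventually_elim
      case (elim z)
      show ?case
      proof
        assume "z \<in> ball c r"
        then have "S (t i) z = (u (k (t i)) z, g (k (t i)) z)" for i by (simp add: S_def B_def)
        with Cauchy_convergent[OF elim] obtain L where L: "(\<lambda>i. (u (k (t i)) z, g (k (t i)) z)) \<longlonglongrightarrow> L"
          by (auto simp: convergent_def)
        from tendsto_fst[OF L] tendsto_snd[OF L]
        show "convergent (\<lambda>i. u ((k \<circ> t) i) z) \<and> convergent (\<lambda>i. g ((k \<circ> t) i) z)"
          by (auto simp: convergent_def)
      qed
    qed
  qed
qed

section \<open>Passage to the limit\<close>

lemma test_fun_facts:
  fixes \<phi> :: "'a::euclidean_space \<Rightarrow> real"
  assumes "test_fun D \<phi>"
  defines "S \<equiv> closure {z. \<phi> z \<noteq> 0}"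
  shows "compact S" "S \<subseteq> D" "bdd_meas \<phi>" "bdd_meas (\<lambda>z. frechet_derivative \<phi> (at z) v)"
    "supp_in \<phi> S" "supp_in (\<lambda>z. frechet_derivative \<phi> (at z) v) S"
proof -
  have C1: "C_k (Suc 0) \<phi>" and C0: "C_k 0 \<phi>" using assms(1) by (auto simp: test_fun_def smooth_def simp del: C_k.simps)
  show S: "compact S" "S \<subseteq> D" using assms by (auto simp: test_fun_def)
  obtain B where B: "S \<subseteq> cball 0 B" using compact_imp_bounded[OF S(1)] unfolding bounded_iff by force
  show 1: "supp_in \<phi> S" unfolding supp_in_def S_def using closure_subset[of "{z. \<phi> z \<noteq> 0}"] by blast
  show 2: "supp_in (\<lambda>z. frechet_derivative \<phi> (at z) v) S"
    unfolding supp_in_def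
  proof (intro allI impI)
    fix z assume z: "z \<notin> S"
    have "((\<lambda>_. 0) has_derivative (\<lambda>_. 0)) (at z)" by simp
    then have "(\<phi> has_derivative (\<lambda>_. 0)) (at z)"
      by (rule has_derivative_transform_within_open[where s="- S"]) (use z compact_imp_closed[OF S(1)] supp_inD[OF 1] in auto)
    from frechet_derivative_at[OF this] show "frechet_derivative \<phi> (at z) v = 0" by metis
  qed
  have "supp_in \<phi> (cball 0 B)" "supp_in (\<lambda>z. frechet_derivative \<phi> (at z) v) (cball 0 B)"
    unfolding supp_in_def using supp_inD[OF 1] supp_inD[OF 2] B by blast+
  then show "bdd_meas \<phi>" "bdd_meas (\<lambda>z. frechet_derivative \<phi> (at z) v)"
    using C0 C1 by (auto intro!: bdd_meas_continuous_supp)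
qed

lemma gradx_ex: "gradx \<phi> z $ k = frechet_derivative \<phi> (at z) (ex k)"
  by (simp add: gradx_def ex_def)

lemma dt_et: "dt \<phi> z = frechet_derivative \<phi> (at z) et"
  by (simp add: dt_def et_def)

text \<open>The weak formulation speaks of Lebesgue measurable functions, the convolution estimates
  of Borel ones; this is the bridge between the two.\<close>

lemma lebesgue_integral_eq_lborel:
  fixes f h :: "'a::euclidean_space \<Rightarrow> real"
  assumes "f \<in> borel_measurable lebesgue" "h \<in> borel_measurable borel" "AE z in lborel. f z = h z"
  shows "(LINT z|lebesgue. f z) = (LINT z|lborel. h z)"
proof -
  have h: "h \<in> borel_measurable lborel" using assms(2) by simp
  have "(LINT z|lebesgue. f z) = (LINT z|lebesgue. h z)"
    by (rule integral_cong_AE) (use assms(1) measurable_completion[OF h] AE_completion[OF assms(3)] in auto)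
  then show ?thesis using integral_completion[OF h] by simp
qed

lemma borel_measurable_vec:
  fixes f :: "'a \<Rightarrow> real^'n"
  assumes "\<And>k. (\<lambda>z. f z $ k) \<in> borel_measurable M"
  shows "f \<in> borel_measurable M"
  unfolding borel_measurable_euclidean_space[of f]
  using assms by (auto simp: Basis_vec_def inner_axis)

text \<open>Integrability is postulated on space-time boxes, whereas the estimates live on balls.
  Moving from the centre in space alone or in time alone stays in the closed ball, which places the
  enclosing box inside the cylinder.\<close>

lemma cball_in_cyl:
  fixes c :: "(real^'n) \<times> real"
  assumes "R > 0" "cball c R \<subseteq> cyl \<Omega> T"
  shows "closure (ball (fst c) R) \<subseteq> \<Omega>" "0 < snd c - R" "snd c - R < snd c + R" "snd c + R < T"
    "ball c R \<subseteq> ball (fst c) R \<times> {snd c - R <..< snd c + R}"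
proof -
  have "x \<in> \<Omega>" if "x \<in> cball (fst c) R" for x
  proof -
    have "(x, snd c) \<in> cball c R" using that by (cases c) (simp add: dist_Pair_Pair)
    then show ?thesis using assms(2) by (auto simp: cyl_def)
  qed
  then show "closure (ball (fst c) R) \<subseteq> \<Omega>" using assms(1) by auto
  have "(fst c, snd c + s) \<in> cyl \<Omega> T" if "\<bar>s\<bar> \<le> R" for s
    using that assms(2) by (cases c) (auto simp: dist_Pair_Pair dist_real_def)
  from this[of R] this[of "-R"] show "0 < snd c - R" "snd c + R < T" "snd c - R < snd c + R"
    using assms(1) by (auto simp: cyl_def)
  show "ball c R \<subseteq> ball (fst c) R \<times> {snd c - R <..< snd c + R}"
  proof
    fix z assume z: "z \<in> ball c R"
    have "dist (fst c) (fst z) < R" using dist_fst_le[of c z] z by simp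
    moreover have "dist (snd c) (snd z) < R" using dist_snd_le[of c z] z by simp
    ultimately show "z \<in> ball (fst c) R \<times> {snd c - R <..< snd c + R}"
      by (cases z) (auto simp: dist_real_def abs_less_iff)
  qed
qed

text \<open>Borel representatives are taken after restriction to the cylinder, since measurability
  is only given there, and are then cut off outside the ball. Test functions of the ball vanish
  outside it, so both weak statements carry over.\<close>

lemma ball_supersol_of_weak_supersol:
  fixes u :: "(real^'n) \<times> real \<Rightarrow> real"
  assumes p: "p > 2" and R: "R > 0" "cball c R \<subseteq> cyl \<Omega> T" and \<Omega>: "open \<Omega>"
    and ws: "weak_supersol p \<Omega> T u Du" and M: "AE z in lebesgue. z \<in> cyl \<Omega> T \<longrightarrow> \<bar>u z\<bar> \<le> M" "M \<ge> 0"
  shows "\<exists>u' g'. ball_supersol p M R c u' g' \<and> (AE z in lborel. z \<in> ball c R \<longrightarrow> u' z = u z \<and> g' z = Du z)"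
proof -
  define D where "D = cyl \<Omega> T"
  have D: "open D" unfolding D_def cyl_def using \<Omega> by (intro open_Times) auto
  have BD: "ball c R \<subseteq> D" using R(2) ball_subset_cball unfolding D_def by blast
  have "(\<lambda>z. indicat_real D z *\<^sub>R u z) \<in> borel_measurable lebesgue"
    and mDu: "(\<lambda>z. indicat_real D z *\<^sub>R Du z) \<in> borel_measurable lebesgue"
    using ws by (auto simp: weak_supersol_def loc_parabolic_sobolev_def set_borel_measurable_def D_def)
  then have m: "(\<lambda>z. indicat_real D z * u z) \<in> borel_measurable lebesgue"
    "(\<lambda>z. indicat_real D z * Du z $ k) \<in> borel_measurable lebesgue" for k
    using measurable_compose[OF mDu borel_measurable_nth[of k]] by auto
  obtain u0 where u0: "u0 \<in> borel_measurable borel" "AE z in lborel. indicat_real D z * u z = u0 z"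
    using completion_ex_borel_measurable_real[OF m(1)] by auto
  have "\<exists>g0. g0 \<in> borel_measurable borel \<and> (AE z in lborel. indicat_real D z * Du z $ k = g0 z)" for k
    using completion_ex_borel_measurable_real[OF m(2)] by auto
  then have "\<exists>g0. \<forall>k. g0 k \<in> borel_measurable borel \<and> (AE z in lborel. indicat_real D z * Du z $ k = g0 k z)"
    by (intro choice allI)
  then obtain g0 where g0: "\<And>k. g0 k \<in> borel_measurable borel" "\<And>k. AE z in lborel. indicat_real D z * Du z $ k = g0 k z"
    by blast
  \<comment> \<open>Clipping turns the almost everywhere bound into one at every point, and changes
    \<open>u0\<close> in the ball on a null set only.\<close>
  define u' where "u' z = indicat_real (ball c R) z * max (-M) (min M (u0 z))" for z
  define g' where "g' z = indicat_real (ball c R) z *\<^sub>R (\<chi> k. g0 k z)" for z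
  have [measurable]: "ball c R \<in> sets borel" by simp
  have mu': "u' \<in> borel_measurable borel" unfolding u'_def using u0(1) by measurable
  have mg'k: "(\<lambda>z. g' z $ k) \<in> borel_measurable borel" for k
  proof -
    have "(\<lambda>z. indicat_real (ball c R) z * g0 k z) \<in> borel_measurable borel" using g0(1)[of k] by measurable
    then show ?thesis by (simp add: g'_def)
  qed
  then have mg': "g' \<in> borel_measurable borel" by (rule borel_measurable_vec)
  have eq: "AE z in lborel. z \<in> ball c R \<longrightarrow> u' z = u z \<and> g' z = Du z"
  proof -
    have "AE z in lborel. \<forall>k\<in>UNIV. indicat_real D z * Du z $ k = g0 k z"
      by (rule AE_finite_allI) (use g0(2) in auto)
    moreover have "AE z in lborel. z \<in> D \<longrightarrow> \<bar>u z\<bar> \<le> M"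
      using M(1) unfolding D_def AE_completion_iff .
    ultimately show ?thesis using u0(2)
    proof eventually_elim
      case (elim z)
      show ?case
      proof
        assume z: "z \<in> ball c R"
        then have zD: "z \<in> D" using BD by blast
        have "u' z = u z" using elim(2,3) z zD by (simp add: u'_def)
        moreover have "g' z = Du z" using elim(1) z zD by (simp add: g'_def vec_eq_iff)
        ultimately show "u' z = u z \<and> g' z = Du z" by simp
      qed
    qed
  qed
  have tf: "test_fun D \<phi>" if "test_fun (ball c R) \<phi>" for \<phi>
    using that BD by (auto simp: test_fun_def)
  have "ball_supersol p M R c u' g'"
  proof (unfold_locales)
    show "p > 2" "R > 0" by fact+
    show "u' \<in> borel_measurable borel" "g' \<in> borel_measurable borel" by fact+
    show "\<bar>u' z\<bar> \<le> M" for z using M(2) by (auto simp: u'_def indicator_def)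
    show "u' z = 0" "g' z = 0" if "z \<notin> ball c R" for z using that by (auto simp: u'_def g'_def)
    show "integrable lborel (\<lambda>z. norm (g' z) powr p)"
    proof -
      note cc = cball_in_cyl[OF R]
      have "set_integrable lebesgue (ball (fst c) R \<times> {snd c - R<..<snd c + R}) (\<lambda>z. norm (Du z) powr p)"
        using ws cc(1-4) R(1) unfolding weak_supersol_def loc_parabolic_sobolev_def by auto
      then have "set_integrable lebesgue (ball c R) (\<lambda>z. norm (Du z) powr p)"
        by (rule set_integrable_subset) (use cc(5) in auto)
      then have i: "integrable lebesgue (\<lambda>z. indicat_real (ball c R) z * norm (Du z) powr p)"
        by (simp add: set_integrable_def)
      have m: "(\<lambda>z. norm (g' z) powr p) \<in> borel_measurable lborel" using mg' by measurable
      have "integrable lebesgue (\<lambda>z. norm (g' z) powr p)"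
      proof (rule integrable_cong_AE_imp[OF i measurable_completion[OF m]])
        show "AE z in lebesgue. indicat_real (ball c R) z * norm (Du z) powr p = norm (g' z) powr p"
          using AE_completion[OF eq]
        proof eventually_elim
          case (elim z)
          then show ?case by (cases "z \<in> ball c R") (use p in \<open>auto simp: g'_def\<close>)
        qed
      qed
      then show ?thesis using integrable_completion[OF m] by simp
    qed
    fix \<phi> assume \<phi>: "test_fun (ball c R) \<phi>"
    note f = test_fun_facts[OF \<phi>]
    have out: "\<phi> z = 0 \<and> frechet_derivative \<phi> (at z) v = 0" if "z \<notin> ball c R" for z v
      using supp_inD[OF f(5)] supp_inD[OF f(6)] f(2) that by blast
    have mf: "\<phi> \<in> borel_measurable borel" "(\<lambda>z. frechet_derivative \<phi> (at z) v) \<in> borel_measurable borel" for v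
      using f(3,4) by (auto dest: bdd_measD)
    have bl: "f \<in> borel_measurable lebesgue" if "f \<in> borel_measurable borel" for f :: "(real^'n) \<times> real \<Rightarrow> real"
      using measurable_completion[of f lborel borel] that by simp
    note mfl = bl[OF mf(1)] bl[OF mf(2)]
    have I1: "(LINT z:D|lebesgue. u z * frechet_derivative \<phi> (at z) v) = (LINT z|lborel. u' z * frechet_derivative \<phi> (at z) v)" for v
      unfolding set_lebesgue_integral_def
    proof (rule lebesgue_integral_eq_lborel)
      have "(\<lambda>z. (indicat_real D z * u z) * frechet_derivative \<phi> (at z) v) \<in> borel_measurable lebesgue"
        using m(1) mfl(2) by (rule borel_measurable_times)
      then show "(\<lambda>z. indicat_real D z *\<^sub>R (u z * frechet_derivative \<phi> (at z) v)) \<in> borel_measurable lebesgue"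
        by (simp add: mult.assoc)
      show "(\<lambda>z. u' z * frechet_derivative \<phi> (at z) v) \<in> borel_measurable borel" using mu' mf(2) by measurable
      show "AE z in lborel. indicat_real D z *\<^sub>R (u z * frechet_derivative \<phi> (at z) v) = u' z * frechet_derivative \<phi> (at z) v"
        using eq
      proof eventually_elim
        case (elim z)
        then show ?case using out[of z v] BD by (cases "z \<in> ball c R") auto
      qed
    qed
    {
      fix k
      have "(LINT z:D|lebesgue. Du z $ k * \<phi> z) = (LINT z|lborel. g' z $ k * \<phi> z)"
        unfolding set_lebesgue_integral_def
      proof (rule lebesgue_integral_eq_lborel)
        have "(\<lambda>z. (indicat_real D z * Du z $ k) * \<phi> z) \<in> borel_measurable lebesgue"
          using m(2) mfl(1) by (rule borel_measurable_times)
        then show "(\<lambda>z. indicat_real D z *\<^sub>R (Du z $ k * \<phi> z)) \<in> borel_measurable lebesgue"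
          by (simp add: mult.assoc)
        show "(\<lambda>z. g' z $ k * \<phi> z) \<in> borel_measurable borel" using mg'k mf(1) by measurable
        show "AE z in lborel. indicat_real D z *\<^sub>R (Du z $ k * \<phi> z) = g' z $ k * \<phi> z"
          using eq
        proof eventually_elim
          case (elim z)
          then show ?case using out[of z undefined] BD by (cases "z \<in> ball c R") auto
        qed
      qed
      moreover have "(LINT z:D|lebesgue. u z * gradx \<phi> z $ k) = - (LINT z:D|lebesgue. Du z $ k * \<phi> z)"
        using ws tf[OF \<phi>] unfolding weak_supersol_def loc_parabolic_sobolev_def D_def by blast
      ultimately show "(LINT z|lborel. u' z * gradx \<phi> z $ k) = - (LINT z|lborel. g' z $ k * \<phi> z)"
        unfolding gradx_ex I1 by simp
    }
    assume nn: "\<And>z. 0 \<le> \<phi> z"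
    have "(LINT z:D|lebesgue. norm (Du z) powr (p - 2) * (Du z \<bullet> gradx \<phi> z)) = (LINT z|lborel. flux p (g' z) \<bullet> gradx \<phi> z)"
      unfolding set_lebesgue_integral_def
    proof (rule lebesgue_integral_eq_lborel)
      \<comment> \<open>The indicator is kept inside the norm because only its product with
        \<open>Du\<close> is known to be measurable.\<close>
      have "(\<lambda>z. norm (indicat_real D z *\<^sub>R Du z) powr (p - 2) * (\<Sum>k\<in>UNIV. (indicat_real D z * Du z $ k) * frechet_derivative \<phi> (at z) (ex k))) \<in> borel_measurable lebesgue"
        using mDu m(2) mfl(2) by measurable
      moreover have "norm (indicat_real D z *\<^sub>R Du z) powr (p - 2) * (\<Sum>k\<in>UNIV. (indicat_real D z * Du z $ k) * frechet_derivative \<phi> (at z) (ex k))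
        = indicat_real D z *\<^sub>R (norm (Du z) powr (p - 2) * (Du z \<bullet> gradx \<phi> z))" for z
        by (cases "z \<in> D") (auto simp: inner_vec_def gradx_ex)
      ultimately show "(\<lambda>z. indicat_real D z *\<^sub>R (norm (Du z) powr (p - 2) * (Du z \<bullet> gradx \<phi> z))) \<in> borel_measurable lebesgue"
        by simp
      have "(\<lambda>z. norm (g' z) powr (p - 2) * (\<Sum>k\<in>UNIV. g' z $ k * frechet_derivative \<phi> (at z) (ex k))) \<in> borel_measurable borel"
        using mg' mg'k mf(2) by measurable
      then show "(\<lambda>z. flux p (g' z) \<bullet> gradx \<phi> z) \<in> borel_measurable borel"
        by (simp add: flux_def inner_vec_def gradx_ex sum_distrib_left mult.assoc)
      show "AE z in lborel. indicat_real D z *\<^sub>R (norm (Du z) powr (p - 2) * (Du z \<bullet> gradx \<phi> z)) = flux p (g' z) \<bullet> gradx \<phi> z"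
        using eq
      proof eventually_elim
        case (elim z)
        show ?case
        proof (cases "z \<in> ball c R")
          case True
          then show ?thesis using elim BD by (auto simp: flux_def)
        next
          case False
          then have "gradx \<phi> z = 0" using out by (simp add: vec_eq_iff gradx_ex)
          then show ?thesis by simp
        qed
      qed
    qed
    moreover have "0 \<le> - (LINT z:D|lebesgue. u z * dt \<phi> z) + (LINT z:D|lebesgue. norm (Du z) powr (p - 2) * (Du z \<bullet> gradx \<phi> z))"
      using ws tf[OF \<phi>] nn unfolding weak_supersol_def D_def by blast
    ultimately show "0 \<le> - (LINT z|lborel. u' z * dt \<phi> z) + (LINT z|lborel. flux p (g' z) \<bullet> gradx \<phi> z)"
      unfolding dt_et I1 by simp
  qed
  with eq show ?thesis by blast
qed

text \<open>Fatou's lemma; the limit inherits the bound without being known to be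
  integrable.\<close>

lemma nn_integral_limit_le:
  fixes F :: "nat \<Rightarrow> 'a \<Rightarrow> real"
  assumes [measurable]: "\<And>n. F n \<in> borel_measurable M" and "AE z in M. (\<lambda>n. F n z) \<longlonglongrightarrow> F0 z"
    and "\<And>n. (\<integral>\<^sup>+ z. ennreal (F n z) \<partial>M) \<le> K"
  shows "(\<integral>\<^sup>+ z. ennreal (F0 z) \<partial>M) \<le> K"
proof -
  have "(\<integral>\<^sup>+ z. ennreal (F0 z) \<partial>M) = (\<integral>\<^sup>+ z. liminf (\<lambda>n. ennreal (F n z)) \<partial>M)"
  proof (rule nn_integral_cong_AE)
    show "AE z in M. ennreal (F0 z) = liminf (\<lambda>n. ennreal (F n z))"
      using assms(2) by eventually_elim (rule lim_imp_Liminf[symmetric], auto intro: tendsto_ennrealI)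
  qed
  also have "\<dots> \<le> liminf (\<lambda>n. (\<integral>\<^sup>+ z. ennreal (F n z) \<partial>M))"
    by (rule nn_integral_liminf) measurable
  also have "\<dots> \<le> limsup (\<lambda>n. (\<integral>\<^sup>+ z. ennreal (F n z) \<partial>M))" by (rule Liminf_le_Limsup) simp
  also have "\<dots> \<le> K" by (rule Limsup_bounded) (use assms(3) in auto)
  finally show ?thesis .
qed

text \<open>Vitali convergence on a set of finite measure, with uniform integrability from the
  exponent \<open>q > 1\<close>. The difference \<open>d n\<close> is compared with its truncation
  at a level \<open>l\<close>: the truncation converges boundedly, and the excess is uniformly small
  by \<open>le_min_add_powr\<close>.\<close>

lemma integral_tendsto_of_Lq_bound:
  fixes F :: "nat \<Rightarrow> 'a \<Rightarrow> real"
  assumes mF [measurable]: "\<And>n. F n \<in> borel_measurable M" "F0 \<in> borel_measurable M"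
    and A: "A \<in> sets M" "emeasure M A < \<infinity>"
    and out: "\<And>n z. z \<notin> A \<Longrightarrow> F n z = 0" "\<And>z. z \<notin> A \<Longrightarrow> F0 z = 0"
    and conv: "AE z in M. (\<lambda>n. F n z) \<longlonglongrightarrow> F0 z"
    and q: "q > 1" and K: "\<And>n. (\<integral>\<^sup>+ z. ennreal (\<bar>F n z\<bar> powr q) \<partial>M) \<le> ennreal K" "K \<ge> 0"
    and \<phi> [measurable]: "\<phi> \<in> borel_measurable M" and B: "\<And>z. \<bar>\<phi> z\<bar> \<le> B"
  shows "\<And>n. integrable M (\<lambda>z. F n z * \<phi> z)" "integrable M (\<lambda>z. F0 z * \<phi> z)"
    "(\<lambda>n. LINT z|M. F n z * \<phi> z) \<longlonglongrightarrow> (LINT z|M. F0 z * \<phi> z)"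
proof -
  have K0: "(\<integral>\<^sup>+ z. ennreal (\<bar>F0 z\<bar> powr q) \<partial>M) \<le> ennreal K"
  proof (rule nn_integral_limit_le[OF _ _ K(1)])
    show "AE z in M. (\<lambda>n. \<bar>F n z\<bar> powr q) \<longlonglongrightarrow> \<bar>F0 z\<bar> powr q"
      using conv by eventually_elim (use q in \<open>intro tendsto_powr' tendsto_intros, auto\<close>)
  qed measurable
  have B0: "0 \<le> B" using B abs_ge_zero order_trans by blast
  note Iq = integral_le_of_nn_integral_le[OF _ _ K] and I0 = integral_le_of_nn_integral_le[OF _ _ K0 K(2)]
  have iq: "integrable M (\<lambda>z. \<bar>F n z\<bar> powr q)" "(LINT z|M. \<bar>F n z\<bar> powr q) \<le> K" for n
    by (rule Iq; simp)+
  have i0: "integrable M (\<lambda>z. \<bar>F0 z\<bar> powr q)" "(LINT z|M. \<bar>F0 z\<bar> powr q) \<le> K"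
    by (rule I0; simp)+
  have iA: "integrable M (indicat_real A)" using A by (intro integrable_real_indicator)
  have int: "integrable M f" if "f \<in> borel_measurable M" "integrable M (\<lambda>z. \<bar>f z\<bar> powr q)" "\<And>z. z \<notin> A \<Longrightarrow> f z = 0" for f :: "'a \<Rightarrow> real"
  proof (rule Bochner_Integration.integrable_bound[OF Bochner_Integration.integrable_add[OF iA that(2)] that(1)])
    have "\<bar>f z\<bar> \<le> indicat_real A z + \<bar>f z\<bar> powr q" for z
    proof (cases "z \<in> A")
      case True
      then show ?thesis using le_add_powr[of "\<bar>f z\<bar>" 1 q] q by simp
    qed (simp add: that(3))
    then show "AE z in M. norm (f z) \<le> norm (indicat_real A z + \<bar>f z\<bar> powr q)" by simp
  qed
  have iF: "integrable M (F n)" "integrable M F0" for n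
    using int[OF mF(1) iq(1)] int[OF mF(2) i0(1)] out by auto
  have mult: "integrable M (\<lambda>z. f z * \<phi> z)" if "integrable M f" for f
  proof (rule Bochner_Integration.integrable_bound[OF integrable_mult_right[OF integrable_abs[OF that], of B]])
    show "(\<lambda>z. f z * \<phi> z) \<in> borel_measurable M" using borel_measurable_integrable[OF that] by measurable
    show "AE z in M. norm (f z * \<phi> z) \<le> norm (B * \<bar>f z\<bar>)"
    proof (rule AE_I2)
      fix z
      have "\<bar>f z\<bar> * \<bar>\<phi> z\<bar> \<le> \<bar>f z\<bar> * B" by (intro mult_left_mono B) auto
      then show "norm (f z * \<phi> z) \<le> norm (B * \<bar>f z\<bar>)" using B0 by (simp add: abs_mult mult.commute)
    qed
  qed
  show iFp: "integrable M (\<lambda>z. F n z * \<phi> z)" and i0p: "integrable M (\<lambda>z. F0 z * \<phi> z)" for n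
    by (intro mult iF)+
  define d where "d n z = \<bar>F n z - F0 z\<bar>" for n z
  have md [measurable]: "d n \<in> borel_measurable M" for n unfolding d_def by measurable
  have id: "integrable M (d n)" for n unfolding d_def using iF by auto
  have dq: "d n z powr q \<le> 2 powr q * (\<bar>F n z\<bar> powr q + \<bar>F0 z\<bar> powr q)" for n z
  proof -
    have "d n z \<le> 2 * max \<bar>F n z\<bar> \<bar>F0 z\<bar>" unfolding d_def by linarith
    then have "d n z powr q \<le> (2 * max \<bar>F n z\<bar> \<bar>F0 z\<bar>) powr q" using q by (intro powr_mono2) (auto simp: d_def)
    also have "\<dots> = 2 powr q * max \<bar>F n z\<bar> \<bar>F0 z\<bar> powr q" by (simp add: powr_mult le_max_iff_disj)
    also have "\<dots> \<le> 2 powr q * (\<bar>F n z\<bar> powr q + \<bar>F0 z\<bar> powr q)" by (auto simp: max_def)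
    finally show ?thesis .
  qed
  have "(\<lambda>n. LINT z|M. d n z) \<longlonglongrightarrow> 0"
  proof (rule LIMSEQ_I)
    fix e :: real assume e: "e > 0"
    \<comment> \<open>Chosen so that the tail \<open>x * (2 powr q * (2 * (K + 1)))\<close> equals
      \<open>e / 4\<close>; \<open>l\<close> then solves \<open>l powr (1 - q) = x\<close>.\<close>
    define x where "x = e / (8 * 2 powr q * (K + 1))"
    define l where "l = x powr (1 / (1 - q))"
    have x: "x > 0" using e K(2) by (simp add: x_def)
    have l: "l > 0" "l powr (1 - q) = x" using x q by (auto simp: l_def powr_powr)
    have im: "integrable M (\<lambda>z. min (d n z) l)" for n
      by (rule Bochner_Integration.integrable_bound[OF id[of n]]) (use l in \<open>auto simp: d_def\<close>)
    have "(\<lambda>n. LINT z|M. min (d n z) l) \<longlonglongrightarrow> (LINT z|M. 0)"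
    proof (rule integral_dominated_convergence[where w="\<lambda>z. l * indicat_real A z"])
      show "integrable M (\<lambda>z. l * indicat_real A z)" using iA by simp
      show "AE z in M. (\<lambda>n. min (d n z) l) \<longlonglongrightarrow> 0"
        using conv
      proof eventually_elim
        case (elim z)
        have "(\<lambda>n. min (d n z) l) \<longlonglongrightarrow> min \<bar>F0 z - F0 z\<bar> l" unfolding d_def by (intro tendsto_intros elim)
        then show ?case using l by simp
      qed
      show "AE z in M. norm (min (d n z) l) \<le> l * indicat_real A z" for n
      proof (rule AE_I2)
        fix z show "norm (min (d n z) l) \<le> l * indicat_real A z"
          using l out[of z] by (cases "z \<in> A") (auto simp: d_def)
      qed
    qed measurable
    then have "\<forall>\<^sub>F n in sequentially. (LINT z|M. min (d n z) l) < e / 4"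
      using order_tendstoD(2)[of _ 0 sequentially "e / 4"] e by simp
    then obtain N where N: "\<And>n. n \<ge> N \<Longrightarrow> (LINT z|M. min (d n z) l) < e / 4"
      by (auto simp: eventually_sequentially)
    show "\<exists>N. \<forall>n\<ge>N. norm ((LINT z|M. d n z) - 0) < e"
    proof (intro exI allI impI)
      fix n assume n: "n \<ge> N"
      have "(LINT z|M. d n z) \<le> (LINT z|M. min (d n z) l + x * (2 powr q * (\<bar>F n z\<bar> powr q + \<bar>F0 z\<bar> powr q)))"
      proof (rule integral_mono[OF id])
        fix z
        have "d n z \<le> min (d n z) l + x * d n z powr q"
          using le_min_add_powr[of "d n z" l q] l q by (simp add: d_def)
        also have "\<dots> \<le> min (d n z) l + x * (2 powr q * (\<bar>F n z\<bar> powr q + \<bar>F0 z\<bar> powr q))"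
          using dq[of n z] x by (intro add_left_mono mult_left_mono) auto
        finally show "d n z \<le> min (d n z) l + x * (2 powr q * (\<bar>F n z\<bar> powr q + \<bar>F0 z\<bar> powr q))" .
      qed (use im iq i0 in auto)
      also have "\<dots> = (LINT z|M. min (d n z) l) + x * (2 powr q * ((LINT z|M. \<bar>F n z\<bar> powr q) + (LINT z|M. \<bar>F0 z\<bar> powr q)))"
        using im iq i0 by simp
      also have "\<dots> \<le> (LINT z|M. min (d n z) l) + x * (2 powr q * (K + K))"
        using x iq(2)[of n] i0(2) by (intro add_left_mono mult_left_mono add_mono) auto
      also have "x * (2 powr q * (K + K)) \<le> x * (2 powr q * (2 * (K + 1)))"
        using x by (intro mult_left_mono) auto
      also have "x * (2 powr q * (2 * (K + 1))) = e / 4"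
      proof -
        have "e / (8 * a * b) * (a * (2 * b)) = e / 4" if "a > 0" "b > 0" for a b :: real
          using that by (simp add: field_simps)
        from this[of "2 powr q" "K + 1"] show ?thesis unfolding x_def using K(2) by simp
      qed
      finally have "(LINT z|M. d n z) < e" using N[OF n] e by linarith
      moreover have "0 \<le> (LINT z|M. d n z)" by (simp add: d_def)
      ultimately show "norm ((LINT z|M. d n z) - 0) < e" by simp
    qed
  qed
  from tendsto_mult_left[OF this, of B] have Bd: "(\<lambda>n. B * (LINT z|M. d n z)) \<longlonglongrightarrow> 0" by simp
  have "(\<lambda>n. (LINT z|M. F n z * \<phi> z) - (LINT z|M. F0 z * \<phi> z)) \<longlonglongrightarrow> 0"
  proof (rule Lim_null_comparison[OF always_eventually Bd], rule allI)
    fix n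
    have "(LINT z|M. F n z * \<phi> z) - (LINT z|M. F0 z * \<phi> z) = (LINT z|M. F n z * \<phi> z - F0 z * \<phi> z)"
      using iFp i0p by simp
    also have "\<bar>\<dots>\<bar> \<le> (LINT z|M. B * d n z)"
    proof (rule abs_integral_le)
      fix z
      have "\<bar>F n z * \<phi> z - F0 z * \<phi> z\<bar> = d n z * \<bar>\<phi> z\<bar>" by (simp add: d_def abs_mult left_diff_distrib[symmetric])
      also have "\<dots> \<le> d n z * B" by (intro mult_left_mono B) (simp add: d_def)
      finally show "\<bar>F n z * \<phi> z - F0 z * \<phi> z\<bar> \<le> B * d n z" by (simp add: mult.commute)
    qed (use iFp i0p id in auto)
    finally show "norm ((LINT z|M. F n z * \<phi> z) - (LINT z|M. F0 z * \<phi> z)) \<le> B * (LINT z|M. d n z)" by simp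
  qed
  then show "(\<lambda>n. LINT z|M. F n z * \<phi> z) \<longlonglongrightarrow> (LINT z|M. F0 z * \<phi> z)" by (simp add: LIM_zero_iff)
qed

lemma nn_integral_gradient_eq:
  assumes "ball_supersol p M R c u' g'" "AE z in lborel. z \<in> ball c R \<longrightarrow> u' z = u z \<and> g' z = Du z"
    and S: "S \<subseteq> ball c R"
  shows "(\<integral>\<^sup>+ z. ennreal (indicator S z * norm (Du z) powr p) \<partial>lebesgue)
    = (\<integral>\<^sup>+ z. ennreal (indicator S z * norm (g' z) powr p) \<partial>lborel)"
proof -
  have "(\<integral>\<^sup>+ z. ennreal (indicator S z * norm (Du z) powr p) \<partial>lebesgue)
    = (\<integral>\<^sup>+ z. ennreal (indicator S z * norm (g' z) powr p) \<partial>lebesgue)"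
    by (rule nn_integral_cong_AE, rule AE_mp[OF AE_completion[OF assms(2)]])
      (use S in \<open>auto simp: indicator_def intro!: AE_I2\<close>)
  then show ?thesis by (simp add: nn_integral_completion)
qed

section \<open>Gradient bounds and subsequences on small balls\<close>

context
  fixes p T M :: real and \<Omega> :: "(real^'n) set"
    and u :: "nat \<Rightarrow> (real^'n) \<times> real \<Rightarrow> real" and Du :: "nat \<Rightarrow> (real^'n) \<times> real \<Rightarrow> real^'n"
  assumes p: "p > 2" and \<Omega>: "open \<Omega>" and M: "M \<ge> 0"
    and ws: "\<And>i. weak_supersol p \<Omega> T (u i) (Du i)"
    and uM: "\<And>i. AE z in lebesgue. z \<in> cyl \<Omega> T \<longrightarrow> \<bar>u i z\<bar> \<le> M"
begin

text \<open>The fourfold ball lies in the cylinder, the Caccioppoli inequality costs half the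
  radius, and its constant does not depend on \<open>i\<close>.\<close>

lemma local_gradient_bound:
  assumes \<rho>: "\<rho> > 0" "cball c (4 * \<rho>) \<subseteq> cyl \<Omega> T"
  shows "\<exists>K\<ge>0. \<forall>i. (\<integral>\<^sup>+ z. ennreal (indicator (ball c (2 * \<rho>)) z * norm (Du i z) powr p) \<partial>lebesgue) \<le> ennreal K"
proof -
  obtain C where C: "\<And>u g. ball_supersol p M (4 * \<rho>) c u g \<Longrightarrow>
    (LINT z|lborel. indicat_real (ball c (2 * \<rho>)) z * norm (g z) powr p) \<le> C"
    using caccioppoli[OF p, of "2 * \<rho>" "4 * \<rho>" M c] \<rho>(1) M by auto
  show ?thesis
  proof (intro exI[of _ "max 0 C"] conjI allI)
    fix i
    obtain u' g' where s: "ball_supersol p M (4 * \<rho>) c u' g'" "AE z in lborel. z \<in> ball c (4 * \<rho>) \<longrightarrow> u' z = u i z \<and> g' z = Du i z"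
      using ball_supersol_of_weak_supersol[OF p _ \<rho>(2) \<Omega> ws uM M, of i] \<rho>(1) by auto
    interpret s: ball_supersol p M "4 * \<rho>" c u' g' by fact
    have [measurable]: "ball c (2 * \<rho>) \<in> sets borel" by simp
    note [measurable] = s.mg
    have "integrable lborel (\<lambda>z. indicat_real (ball c (2 * \<rho>)) z * norm (g' z) powr p)"
    proof (rule Bochner_Integration.integrable_bound[OF s.gp])
      have "(\<lambda>z. indicat_real (ball c (2 * \<rho>)) z * norm (g' z) powr p) \<in> borel_measurable borel" by measurable
      then show "(\<lambda>z. indicat_real (ball c (2 * \<rho>)) z * norm (g' z) powr p) \<in> borel_measurable lborel" by simp
    qed (auto simp: indicator_def)
    from nn_integral_eq_integral[OF this]
    have "(\<integral>\<^sup>+ z. ennreal (indicator (ball c (2 * \<rho>)) z * norm (g' z) powr p) \<partial>lborel) \<le> ennreal (max 0 C)"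
      using C[OF s(1)] by (simp add: ennreal_leI le_max_iff_disj)
    then show "(\<integral>\<^sup>+ z. ennreal (indicator (ball c (2 * \<rho>)) z * norm (Du i z) powr p) \<partial>lebesgue) \<le> ennreal (max 0 C)"
      using nn_integral_gradient_eq[OF s, of "ball c (2 * \<rho>)"] \<rho>(1) by (simp add: subset_ball)
  qed simp
qed

text \<open>The double ball carries a uniform gradient bound, so compactness applies on
  \<open>ball c \<rho>\<close>. The sequence \<open>s\<close> is arbitrary because the diagonal
  argument extracts from sequences already thinned out.\<close>

lemma local_subsequence:
  fixes s :: "nat \<Rightarrow> nat"
  assumes \<rho>: "\<rho> > 0" "cball c (4 * \<rho>) \<subseteq> cyl \<Omega> T"
  shows "\<exists>r. strict_mono (r :: nat \<Rightarrow> nat) \<and> (AE z in lebesgue. z \<in> ball c \<rho> \<longrightarrow>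
     convergent (\<lambda>i. u (s (r i)) z) \<and> convergent (\<lambda>i. Du (s (r i)) z))"
proof -
  obtain K where K: "K \<ge> 0" "\<And>i. (\<integral>\<^sup>+ z. ennreal (indicator (ball c (2 * \<rho>)) z * norm (Du i z) powr p) \<partial>lebesgue) \<le> ennreal K"
    using local_gradient_bound[OF \<rho>] by auto
  have sub: "cball c (2 * \<rho>) \<subseteq> cyl \<Omega> T" using \<rho> subset_cball[of "2 * \<rho>" "4 * \<rho>" c] by auto
  have "\<forall>i. \<exists>ug. ball_supersol p M (2 * \<rho>) c (fst ug) (snd ug) \<and> (AE z in lborel. z \<in> ball c (2 * \<rho>) \<longrightarrow> fst ug z = u (s i) z \<and> snd ug z = Du (s i) z)"
    using ball_supersol_of_weak_supersol[OF p _ sub \<Omega> ws uM M] \<rho>(1) by simp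
  then obtain ug where ug: "\<And>i. ball_supersol p M (2 * \<rho>) c (fst (ug i)) (snd (ug i))"
    "\<And>i. AE z in lborel. z \<in> ball c (2 * \<rho>) \<longrightarrow> fst (ug i) z = u (s i) z \<and> snd (ug i) z = Du (s i) z"
    using choice[of "\<lambda>i ug. ball_supersol p M (2 * \<rho>) c (fst ug) (snd ug) \<and> (AE z in lborel. z \<in> ball c (2 * \<rho>) \<longrightarrow> fst ug z = u (s i) z \<and> snd ug z = Du (s i) z)"] by blast
  have gK: "(LINT z|lborel. norm (snd (ug i) z) powr p) \<le> K" for i
  proof -
    interpret t: ball_supersol p M "2 * \<rho>" c "fst (ug i)" "snd (ug i)" by (rule ug(1))
    have e: "indicator (ball c (2 * \<rho>)) z * norm (snd (ug i) z) powr p = norm (snd (ug i) z) powr p" for z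
      using t.out(2)[of z] p by (cases "z \<in> ball c (2 * \<rho>)") auto
    have "(\<integral>\<^sup>+ z. ennreal (norm (snd (ug i) z) powr p) \<partial>lborel) \<le> ennreal K"
      using nn_integral_gradient_eq[OF ug(1,2) order_refl, of i] K(2)[of "s i"] by (simp only: e)
    with t.gp K(1) show ?thesis
      by (intro integral_le_of_nn_integral_le) auto
  qed
  have "\<rho> < 2 * \<rho>" using \<rho>(1) by simp
  from local_compactness[OF p \<rho>(1) this, of M c "\<lambda>i. fst (ug i)" "\<lambda>i. snd (ug i)" K, OF ug(1) gK]
  obtain r where r: "strict_mono r" "AE z in lborel. z \<in> ball c \<rho> \<longrightarrow>
     convergent (\<lambda>i. fst (ug (r i)) z) \<and> convergent (\<lambda>i. snd (ug (r i)) z)" by auto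
  have "AE z in lborel. \<forall>i. z \<in> ball c (2 * \<rho>) \<longrightarrow> fst (ug i) z = u (s i) z \<and> snd (ug i) z = Du (s i) z"
    unfolding AE_all_countable using ug(2) by simp
  with r(2) have "AE z in lborel. z \<in> ball c \<rho> \<longrightarrow> convergent (\<lambda>i. u (s (r i)) z) \<and> convergent (\<lambda>i. Du (s (r i)) z)"
  proof eventually_elim
    case (elim z)
    show ?case
    proof
      assume z: "z \<in> ball c \<rho>"
      then have "z \<in> ball c (2 * \<rho>)" using \<rho>(1) by simp
      then show "convergent (\<lambda>i. u (s (r i)) z) \<and> convergent (\<lambda>i. Du (s (r i)) z)" using elim z by simp
    qed
  qed
  then show ?thesis using r(1) AE_completion by blast
qed

end

text \<open>Multiplying by the indicator of \<open>S\<close> gives measurable functions living on a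
  set of finite measure; the test function vanishes off \<open>S\<close>, so the integrals over
  \<open>D\<close> are unchanged.\<close>

lemma set_integral_tendsto_of_Lq_bound:
  fixes F :: "nat \<Rightarrow> 'a::euclidean_space \<Rightarrow> real"
  assumes mF: "\<And>n. (\<lambda>z. indicat_real D z * F n z) \<in> borel_measurable lebesgue"
      "(\<lambda>z. indicat_real D z * F0 z) \<in> borel_measurable lebesgue"
    and S: "compact S" "S \<subseteq> D"
    and conv: "AE z in lebesgue. z \<in> D \<longrightarrow> (\<lambda>n. F n z) \<longlonglongrightarrow> F0 z"
    and q: "q > 1" and K: "\<And>n. (\<integral>\<^sup>+ z. ennreal (indicator S z * \<bar>F n z\<bar> powr q) \<partial>lebesgue) \<le> ennreal K" "K \<ge> 0"
    and \<phi>: "bdd_meas \<phi>" "supp_in \<phi> S"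
  shows "\<And>n. set_integrable lebesgue D (\<lambda>z. F n z * \<phi> z)" "set_integrable lebesgue D (\<lambda>z. F0 z * \<phi> z)"
    "(\<lambda>n. LINT z:D|lebesgue. F n z * \<phi> z) \<longlonglongrightarrow> (LINT z:D|lebesgue. F0 z * \<phi> z)"
proof -
  have lS: "S \<in> lmeasurable" using S(1) by (rule lmeasurable_compact)
  have mS: "S \<in> sets lebesgue" using lS by (rule fmeasurableD)
  have m\<phi>: "\<phi> \<in> borel_measurable lebesgue"
    using measurable_completion[of \<phi> lborel borel] bdd_measD[OF \<phi>(1)] by simp
  obtain B where B: "\<And>z. \<bar>\<phi> z\<bar> \<le> B" using bdd_meas_bound[OF \<phi>(1)] by blast
  define F' where "F' n z = indicat_real S z * F n z" for n z
  define F0' where "F0' z = indicat_real S z * F0 z" for z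
  have eqD: "indicat_real S z * f = indicat_real S z * (indicat_real D z * f)" for z f
    using S(2) by (auto simp: indicator_def)
  have m': "F' n \<in> borel_measurable lebesgue" "F0' \<in> borel_measurable lebesgue" for n
    unfolding F'_def[abs_def] F0'_def[abs_def] eqD[of _ "F n _"] eqD[of _ "F0 _"]
    by (intro borel_measurable_times mF borel_measurable_indicator mS)+
  have eq: "indicat_real D z *\<^sub>R (F n z * \<phi> z) = F' n z * \<phi> z" "indicat_real D z *\<^sub>R (F0 z * \<phi> z) = F0' z * \<phi> z" for n z
    using S(2) supp_inD[OF \<phi>(2), of z] by (cases "z \<in> S"; auto simp: F'_def F0'_def)+
  have K': "(\<integral>\<^sup>+ z. ennreal (\<bar>F' n z\<bar> powr q) \<partial>lebesgue) \<le> ennreal K" for n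
  proof -
    have "\<bar>F' n z\<bar> powr q = indicator S z * \<bar>F n z\<bar> powr q" for z
      using q by (cases "z \<in> S") (auto simp: F'_def)
    then show ?thesis using K(1)[of n] by simp
  qed
  have c': "AE z in lebesgue. (\<lambda>n. F' n z) \<longlonglongrightarrow> F0' z"
    using conv
  proof eventually_elim
    case (elim z)
    then show ?case using S(2) by (cases "z \<in> S") (auto simp: F'_def F0'_def)
  qed
  have out: "F' n z = 0" "F0' z = 0" if "z \<notin> S" for n z using that by (auto simp: F'_def F0'_def)
  have fS: "emeasure lebesgue S < \<infinity>" using lS by (auto simp: fmeasurable_def)
  note r = integral_tendsto_of_Lq_bound[OF m' mS fS out c' q K' K(2) m\<phi> B]
  show "set_integrable lebesgue D (\<lambda>z. F n z * \<phi> z)" for n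
    unfolding set_integrable_def eq by (rule r(1))
  show "set_integrable lebesgue D (\<lambda>z. F0 z * \<phi> z)"
    unfolding set_integrable_def eq by (rule r(2))
  show "(\<lambda>n. LINT z:D|lebesgue. F n z * \<phi> z) \<longlonglongrightarrow> (LINT z:D|lebesgue. F0 z * \<phi> z)"
    unfolding set_lebesgue_integral_def eq by (rule r(3))
qed

text \<open>The exponent \<open>p - 2\<close> is positive, so \<open>norm a powr (p - 2)\<close> is
  continuous also at 0.\<close>

lemma tendsto_flux:
  assumes "p > 2" "(a \<longlongrightarrow> b) G"
  shows "((\<lambda>i. flux p (a i)) \<longlongrightarrow> flux p b) G"
  unfolding flux_def using assms by (intro tendsto_scaleR tendsto_powr' tendsto_norm tendsto_const) auto

lemma set_integral_flux_gradx:
  assumes "\<And>k. set_integrable lebesgue D (\<lambda>z. flux p (g z) $ k * frechet_derivative \<phi> (at z) (ex k))"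
  shows "(LINT z:D|lebesgue. norm (g z) powr (p - 2) * (g z \<bullet> gradx \<phi> z))
    = (\<Sum>k\<in>UNIV. LINT z:D|lebesgue. flux p (g z) $ k * frechet_derivative \<phi> (at z) (ex k))"
proof -
  have eq: "indicat_real D z *\<^sub>R (norm (g z) powr (p - 2) * (g z \<bullet> gradx \<phi> z))
    = (\<Sum>k\<in>UNIV. indicat_real D z *\<^sub>R (flux p (g z) $ k * frechet_derivative \<phi> (at z) (ex k)))" for z
    by (simp add: inner_vec_def gradx_ex flux_def sum_distrib_left mult.assoc)
  show ?thesis using assms unfolding set_lebesgue_integral_def set_integrable_def eq
    by (rule Bochner_Integration.integral_sum)
qed

section \<open>The weak formulation for the limit function\<close>

context
  fixes p T M :: real and \<Omega> :: "(real^'n) set"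
    and u :: "nat \<Rightarrow> (real^'n) \<times> real \<Rightarrow> real" and Du :: "nat \<Rightarrow> (real^'n) \<times> real \<Rightarrow> real^'n"
    and v :: "(real^'n) \<times> real \<Rightarrow> real" and Dv :: "(real^'n) \<times> real \<Rightarrow> real^'n"
  assumes p: "p > 2" and M: "M \<ge> 0"
    and ws: "\<And>i. weak_supersol p \<Omega> T (u i) (Du i)"
    and uM: "\<And>i. AE z in lebesgue. z \<in> cyl \<Omega> T \<longrightarrow> \<bar>u i z\<bar> \<le> M"
    and conv: "AE z in lebesgue. z \<in> cyl \<Omega> T \<longrightarrow> (\<lambda>i. u i z) \<longlonglongrightarrow> v z \<and> (\<lambda>i. Du i z) \<longlonglongrightarrow> Dv z"
    and mv: "set_borel_measurable lebesgue (cyl \<Omega> T) v" "set_borel_measurable lebesgue (cyl \<Omega> T) Dv"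
    and bd: "\<And>S. compact S \<Longrightarrow> S \<subseteq> cyl \<Omega> T \<Longrightarrow>
      \<exists>K\<ge>0. \<forall>i. (\<integral>\<^sup>+ z. ennreal (indicator S z * norm (Du i z) powr p) \<partial>lebesgue) \<le> ennreal K"
begin

lemma measurable_weak_supersol:
  "(\<lambda>z. indicat_real (cyl \<Omega> T) z * u i z) \<in> borel_measurable lebesgue"
  "(\<lambda>z. indicat_real (cyl \<Omega> T) z *\<^sub>R Du i z) \<in> borel_measurable lebesgue"
  "(\<lambda>z. indicat_real (cyl \<Omega> T) z * v z) \<in> borel_measurable lebesgue"
  "(\<lambda>z. indicat_real (cyl \<Omega> T) z *\<^sub>R Dv z) \<in> borel_measurable lebesgue"
  using ws[of i] mv by (auto simp: weak_supersol_def loc_parabolic_sobolev_def set_borel_measurable_def)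

lemma limit_bound: "AE z in lebesgue. z \<in> cyl \<Omega> T \<longrightarrow> \<bar>v z\<bar> \<le> M"
proof -
  have "AE z in lebesgue. \<forall>i. z \<in> cyl \<Omega> T \<longrightarrow> \<bar>u i z\<bar> \<le> M"
    unfolding AE_all_countable using uM by simp
  with conv show ?thesis
  proof eventually_elim
    case (elim z)
    show ?case
    proof
      assume z: "z \<in> cyl \<Omega> T"
      with elim(1) have "(\<lambda>i. \<bar>u i z\<bar>) \<longlonglongrightarrow> \<bar>v z\<bar>" by (intro tendsto_intros) auto
      then show "\<bar>v z\<bar> \<le> M" by (rule LIMSEQ_le_const2) (use elim(2) z in auto)
    qed
  qed
qed

lemma measurable_components_cyl:
  assumes m: "(\<lambda>z. indicat_real D z *\<^sub>R g z) \<in> borel_measurable lebesgue" and "p > 2"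
  shows "(\<lambda>z. indicat_real D z * (g z :: real^'n) $ k) \<in> borel_measurable lebesgue"
    "(\<lambda>z. indicat_real D z * flux p (g z) $ k) \<in> borel_measurable lebesgue"
proof -
  have 1: "(\<lambda>z. (indicat_real D z *\<^sub>R g z) $ k) \<in> borel_measurable lebesgue"
    using measurable_compose[OF m borel_measurable_nth[of k]] by simp
  then show "(\<lambda>z. indicat_real D z * g z $ k) \<in> borel_measurable lebesgue" by simp
  have "(\<lambda>z. norm (indicat_real D z *\<^sub>R g z) powr (p - 2) * (indicat_real D z *\<^sub>R g z) $ k) \<in> borel_measurable lebesgue"
    using m 1 by measurable
  moreover have eq: "norm (indicat_real D z *\<^sub>R g z) powr (p - 2) * (indicat_real D z *\<^sub>R g z) $ k = indicat_real D z * flux p (g z) $ k" for z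
    by (cases "z \<in> D") (auto simp: flux_def)
  ultimately show "(\<lambda>z. indicat_real D z * flux p (g z) $ k) \<in> borel_measurable lebesgue" unfolding eq by simp
qed

text \<open>Each integral in the weak formulation is linear in the function, in its gradient or in
  the flux, and on the support of the test function these are bounded in \<open>L^2\<close>,
  \<open>L^p\<close> and \<open>L^(p/(p-1))\<close>. Together with convergence almost everywhere
  this makes each integral converge.\<close>

lemma weak_supersol_limit: "weak_supersol p \<Omega> T v Dv"
proof -
  define D where "D = cyl \<Omega> T"
  note m = measurable_weak_supersol[folded D_def]
  have convu: "AE z in lebesgue. z \<in> D \<longrightarrow> (\<lambda>i. u i z) \<longlonglongrightarrow> v z"
    and convD: "AE z in lebesgue. z \<in> D \<longrightarrow> (\<lambda>i. Du i z $ k) \<longlonglongrightarrow> Dv z $ k"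
    and convF: "AE z in lebesgue. z \<in> D \<longrightarrow> (\<lambda>i. flux p (Du i z) $ k) \<longlonglongrightarrow> flux p (Dv z) $ k" for k
    using conv unfolding D_def by (eventually_elim, auto intro!: tendsto_vec_nth tendsto_flux[OF p])+
  \<comment> \<open>The conjugate exponent turns the flux into the gradient: the norm of the flux to
    the power \<open>p / (p - 1)\<close> is \<open>norm (Du i z) powr p\<close>. One
    \<open>K\<close> serves both bounds.\<close>
  have Du_bound: "\<exists>K\<ge>0. (\<forall>i. (\<integral>\<^sup>+ z. ennreal (indicator S z * \<bar>Du i z $ k\<bar> powr p) \<partial>lebesgue) \<le> ennreal K)
      \<and> (\<forall>i. (\<integral>\<^sup>+ z. ennreal (indicator S z * \<bar>flux p (Du i z) $ k\<bar> powr (p / (p - 1))) \<partial>lebesgue) \<le> ennreal K)"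
    if S: "compact S" "S \<subseteq> D" for S k
  proof -
    obtain K where K: "K \<ge> 0" "\<And>i. (\<integral>\<^sup>+ z. ennreal (indicator S z * norm (Du i z) powr p) \<partial>lebesgue) \<le> ennreal K"
      using bd S unfolding D_def by blast
    have 1: "\<bar>Du i z $ k\<bar> powr p \<le> norm (Du i z) powr p" for i z
      using p by (intro powr_mono2 component_le_norm_cart) auto
    have 2: "\<bar>flux p (Du i z) $ k\<bar> powr (p / (p - 1)) \<le> norm (Du i z) powr p" for i z
    proof -
      have "\<bar>flux p (Du i z) $ k\<bar> powr (p / (p - 1)) \<le> norm (flux p (Du i z)) powr (p / (p - 1))"
        using p by (intro powr_mono2 component_le_norm_cart) auto
      also have "\<dots> = norm (Du i z) powr p" using p by (simp add: norm_flux powr_powr)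
      finally show ?thesis .
    qed
    show ?thesis
    proof (intro exI[of _ K] conjI allI K(1))
      fix i
      show "(\<integral>\<^sup>+ z. ennreal (indicator S z * \<bar>Du i z $ k\<bar> powr p) \<partial>lebesgue) \<le> ennreal K"
        by (rule order_trans[OF nn_integral_mono K(2)[of i]]) (auto intro!: ennreal_leI mult_left_mono 1)
      show "(\<integral>\<^sup>+ z. ennreal (indicator S z * \<bar>flux p (Du i z) $ k\<bar> powr (p / (p - 1))) \<partial>lebesgue) \<le> ennreal K"
        by (rule order_trans[OF nn_integral_mono K(2)[of i]]) (auto intro!: ennreal_leI mult_left_mono 2)
    qed
  qed
  \<comment> \<open>Any exponent above 1 suits a bounded function; 2 is taken.\<close>
  have u_bound: "(\<integral>\<^sup>+ z. ennreal (indicator S z * \<bar>u i z\<bar> powr 2) \<partial>lebesgue) \<le> ennreal (M\<^sup>2 * measure lebesgue S)"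
    if S: "compact S" "S \<subseteq> D" for S i
  proof -
    have lS: "S \<in> lmeasurable" using S(1) by (rule lmeasurable_compact)
    have "(\<integral>\<^sup>+ z. ennreal (indicator S z * \<bar>u i z\<bar> powr 2) \<partial>lebesgue) \<le> (\<integral>\<^sup>+ z. ennreal (M\<^sup>2) * indicator S z \<partial>lebesgue)"
    proof (rule nn_integral_mono_AE)
      show "AE z in lebesgue. ennreal (indicator S z * \<bar>u i z\<bar> powr 2) \<le> ennreal (M\<^sup>2) * indicator S z"
        using uM[of i]
      proof eventually_elim
        case (elim z)
        show ?case
        proof (cases "z \<in> S")
          case True
          then have "\<bar>u i z\<bar> powr 2 \<le> M\<^sup>2"
            using elim S(2) M by (simp add: D_def subset_eq powr_numeral abs_le_square_iff[symmetric])
          then show ?thesis using True by (simp add: ennreal_leI)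
        qed simp
      qed
    qed
    also have "\<dots> = ennreal (M\<^sup>2) * emeasure lebesgue S"
      using lS by (intro nn_integral_cmult_indicator fmeasurableD)
    also have "\<dots> = ennreal (M\<^sup>2 * measure lebesgue S)"
      using lS by (simp add: emeasure_eq_measure2 ennreal_mult)
    finally show ?thesis .
  qed
  have lim: "(LINT z:D|lebesgue. v z * gradx \<phi> z $ k) = - (LINT z:D|lebesgue. Dv z $ k * \<phi> z)"
      "(\<And>z. 0 \<le> \<phi> z) \<Longrightarrow> 0 \<le> - (LINT z:D|lebesgue. v z * dt \<phi> z)
        + (LINT z:D|lebesgue. norm (Dv z) powr (p - 2) * (Dv z \<bullet> gradx \<phi> z))"
    if \<phi>: "test_fun D \<phi>" for \<phi> k
  proof -
    define S where "S = closure {z. \<phi> z \<noteq> 0}"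
    note f = test_fun_facts[OF \<phi>, folded S_def]
    have L1: "(\<lambda>i. LINT z:D|lebesgue. u i z * frechet_derivative \<phi> (at z) w)
      \<longlonglongrightarrow> (LINT z:D|lebesgue. v z * frechet_derivative \<phi> (at z) w)" for w
      by (rule set_integral_tendsto_of_Lq_bound(3)[where q=2 and K="M\<^sup>2 * measure lebesgue S", OF m(1,3) f(1,2) convu _ u_bound[OF f(1,2)] _ f(4,6)])
        auto
    obtain K where K: "K \<ge> 0" "\<And>i. (\<integral>\<^sup>+ z. ennreal (indicator S z * \<bar>Du i z $ k\<bar> powr p) \<partial>lebesgue) \<le> ennreal K"
      using Du_bound[OF f(1,2), of k] by blast
    have L2: "(\<lambda>i. LINT z:D|lebesgue. Du i z $ k * \<phi> z) \<longlonglongrightarrow> (LINT z:D|lebesgue. Dv z $ k * \<phi> z)"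
      by (rule set_integral_tendsto_of_Lq_bound(3)[OF measurable_components_cyl(1)[OF m(2) p] measurable_components_cyl(1)[OF m(4) p]
            f(1,2) convD _ K(2,1) f(3,5)]) (use p in auto)
    have "(LINT z:D|lebesgue. u i z * frechet_derivative \<phi> (at z) (ex k)) = - (LINT z:D|lebesgue. Du i z $ k * \<phi> z)" for i
      using ws[of i] \<phi> unfolding weak_supersol_def loc_parabolic_sobolev_def D_def gradx_ex by blast
    then show "(LINT z:D|lebesgue. v z * gradx \<phi> z $ k) = - (LINT z:D|lebesgue. Dv z $ k * \<phi> z)"
      unfolding gradx_ex using LIMSEQ_unique[OF L1[of "ex k"]] tendsto_minus[OF L2] by simp
    assume nn: "\<And>z. 0 \<le> \<phi> z"
    have F: "\<And>i. set_integrable lebesgue D (\<lambda>z. flux p (Du i z) $ k * frechet_derivative \<phi> (at z) (ex k))"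
      "set_integrable lebesgue D (\<lambda>z. flux p (Dv z) $ k * frechet_derivative \<phi> (at z) (ex k))"
      "(\<lambda>i. LINT z:D|lebesgue. flux p (Du i z) $ k * frechet_derivative \<phi> (at z) (ex k))
         \<longlonglongrightarrow> (LINT z:D|lebesgue. flux p (Dv z) $ k * frechet_derivative \<phi> (at z) (ex k))" for k
    proof -
      obtain K where K: "K \<ge> 0" "\<And>i. (\<integral>\<^sup>+ z. ennreal (indicator S z * \<bar>flux p (Du i z) $ k\<bar> powr (p / (p - 1))) \<partial>lebesgue) \<le> ennreal K"
        using Du_bound[OF f(1,2), of k] by blast
      have q: "p / (p - 1) > 1" using p by simp
      note r = set_integral_tendsto_of_Lq_bound[OF measurable_components_cyl(2)[OF m(2) p] measurable_components_cyl(2)[OF m(4) p]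
            f(1,2) convF q K(2,1) f(4)[of "ex k"] f(6)[of "ex k"]]
      show "\<And>i. set_integrable lebesgue D (\<lambda>z. flux p (Du i z) $ k * frechet_derivative \<phi> (at z) (ex k))"
        "set_integrable lebesgue D (\<lambda>z. flux p (Dv z) $ k * frechet_derivative \<phi> (at z) (ex k))"
        "(\<lambda>i. LINT z:D|lebesgue. flux p (Du i z) $ k * frechet_derivative \<phi> (at z) (ex k))
         \<longlonglongrightarrow> (LINT z:D|lebesgue. flux p (Dv z) $ k * frechet_derivative \<phi> (at z) (ex k))"
        by (rule r)+
    qed
    have "(\<lambda>i. - (LINT z:D|lebesgue. u i z * dt \<phi> z)
        + (LINT z:D|lebesgue. norm (Du i z) powr (p - 2) * (Du i z \<bullet> gradx \<phi> z)))
      \<longlonglongrightarrow> - (LINT z:D|lebesgue. v z * dt \<phi> z)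
        + (LINT z:D|lebesgue. norm (Dv z) powr (p - 2) * (Dv z \<bullet> gradx \<phi> z))"
      unfolding set_integral_flux_gradx[OF F(1)] set_integral_flux_gradx[OF F(2)] dt_et
      by (intro tendsto_intros L1 F(3))
    moreover have "0 \<le> - (LINT z:D|lebesgue. u i z * dt \<phi> z)
        + (LINT z:D|lebesgue. norm (Du i z) powr (p - 2) * (Du i z \<bullet> gradx \<phi> z))" for i
      using ws[of i] \<phi> nn unfolding weak_supersol_def D_def by blast
    ultimately show "0 \<le> - (LINT z:D|lebesgue. v z * dt \<phi> z)
        + (LINT z:D|lebesgue. norm (Dv z) powr (p - 2) * (Dv z \<bullet> gradx \<phi> z))"
      by (intro LIMSEQ_le_const) auto
  qed
  have int: "set_integrable lebesgue (\<Omega>' \<times> {t1<..<t2}) (\<lambda>z. \<bar>v z\<bar> powr p) \<and>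
      set_integrable lebesgue (\<Omega>' \<times> {t1<..<t2}) (\<lambda>z. norm (Dv z) powr p)"
    if h: "open \<Omega>'" "compact (closure \<Omega>')" "closure \<Omega>' \<subseteq> \<Omega>" "0 < t1" "t1 < t2" "t2 < T" for \<Omega>' t1 t2
  proof -
    \<comment> \<open>The box in the definition is open; the compact box around it lies in the
      cylinder since \<open>closure \<Omega>' \<subseteq> \<Omega>\<close>, \<open>0 < t1\<close>
      and \<open>t2 < T\<close>, so \<open>bd\<close> applies.\<close>
    define S where "S = closure \<Omega>' \<times> {t1..t2}"
    have S: "compact S" "S \<subseteq> D" unfolding S_def D_def cyl_def using h by (auto intro: compact_Times)
    have lS: "S \<in> lmeasurable" using S(1) by (rule lmeasurable_compact)
    have mS: "S \<in> sets lebesgue" using lS by (rule fmeasurableD)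
    have sub: "\<Omega>' \<times> {t1<..<t2} \<subseteq> S" unfolding S_def using closure_subset[of \<Omega>'] by auto
    have "open (\<Omega>' \<times> {t1<..<t2})" using h(1) by (intro open_Times) auto
    then have mO: "\<Omega>' \<times> {t1<..<t2} \<in> sets lebesgue" by auto
    have "set_integrable lebesgue S (\<lambda>z. \<bar>v z\<bar> powr p)"
      unfolding set_integrable_def
    proof (rule Bochner_Integration.integrable_bound)
      show "integrable lebesgue (\<lambda>z. M powr p * indicat_real S z)"
        using lS by (intro integrable_mult_right integrable_real_indicator) (auto simp: fmeasurable_def)
      have "(\<lambda>z. indicat_real S z * \<bar>indicat_real D z * v z\<bar> powr p) \<in> borel_measurable lebesgue"
        using m(3) mS by measurable
      moreover have "indicat_real S z * \<bar>indicat_real D z * v z\<bar> powr p = indicat_real S z *\<^sub>R \<bar>v z\<bar> powr p" for z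
        using S(2) by (cases "z \<in> S") auto
      ultimately show "(\<lambda>z. indicat_real S z *\<^sub>R \<bar>v z\<bar> powr p) \<in> borel_measurable lebesgue" by simp
      show "AE z in lebesgue. norm (indicat_real S z *\<^sub>R \<bar>v z\<bar> powr p) \<le> norm (M powr p * indicat_real S z)"
        using limit_bound
      proof eventually_elim
        case (elim z)
        show ?case
        proof (cases "z \<in> S")
          case True
          then have "\<bar>v z\<bar> powr p \<le> M powr p" using elim S(2) p by (intro powr_mono2) (auto simp: D_def)
          then show ?thesis using True by simp
        qed simp
      qed
    qed
    moreover have "set_integrable lebesgue S (\<lambda>z. norm (Dv z) powr p)"
    proof -
      obtain K where K: "K \<ge> 0" "\<And>i. (\<integral>\<^sup>+ z. ennreal (indicator S z * norm (Du i z) powr p) \<partial>lebesgue) \<le> ennreal K"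
        using bd S unfolding D_def by blast
      have meas: "(\<lambda>z. indicat_real S z * norm (g z) powr p) \<in> borel_measurable lebesgue"
        if "(\<lambda>z. indicat_real D z *\<^sub>R g z) \<in> borel_measurable lebesgue" for g :: "(real^'n) \<times> real \<Rightarrow> real^'n"
      proof -
        have "(\<lambda>z. indicat_real S z * norm (indicat_real D z *\<^sub>R g z) powr p) \<in> borel_measurable lebesgue"
          using that mS by measurable
        moreover have eq: "indicat_real S z * norm (indicat_real D z *\<^sub>R g z) powr p = indicat_real S z * norm (g z) powr p" for z
          using S(2) by (cases "z \<in> S") auto
        ultimately show ?thesis unfolding eq by simp
      qed
      have "(\<integral>\<^sup>+ z. ennreal (indicat_real S z * norm (Dv z) powr p) \<partial>lebesgue) \<le> ennreal K"
      proof (rule nn_integral_limit_le[OF meas[OF m(2)] _ K(2)])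
        show "AE z in lebesgue. (\<lambda>i. indicat_real S z * norm (Du i z) powr p) \<longlonglongrightarrow> indicat_real S z * norm (Dv z) powr p"
          using conv
        proof eventually_elim
          case (elim z)
          show ?case
          proof (cases "z \<in> S")
            case True
            then have "(\<lambda>i. Du i z) \<longlonglongrightarrow> Dv z" using elim S(2) by (auto simp: D_def)
            then show ?thesis using p by (intro tendsto_intros tendsto_powr') auto
          qed simp
        qed
      qed
      from integral_le_of_nn_integral_le(1)[OF meas[OF m(4)] _ this K(1)]
      show ?thesis by (simp add: set_integrable_def)
    qed
    ultimately show ?thesis using set_integrable_subset[OF _ mO sub] by blast
  qed
  show ?thesis
    unfolding weak_supersol_def loc_parabolic_sobolev_def
    using mv int lim unfolding D_def by blast
qed

end

section \<open>Globalisation by a countable cover and a diagonal subsequence\<close>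

theorem theorem4p1:
  fixes p T M :: real and \<Omega> :: "(real^'n) set"
    and u :: "nat \<Rightarrow> (real^'n) \<times> real \<Rightarrow> real"
    and Du :: "nat \<Rightarrow> (real^'n) \<times> real \<Rightarrow> real^'n"
  assumes "p > 2" and "bounded \<Omega>" and "open \<Omega>" and "T > 0"
    and "\<And>i. weak_supersol p \<Omega> T (u i) (Du i)"
    and "\<And>i. AE z in lebesgue. z \<in> cyl \<Omega> T \<longrightarrow> \<bar>u i z\<bar> \<le> M"
  shows "\<exists>r v Dv. strict_mono r \<and>
     (AE z in lebesgue. z \<in> cyl \<Omega> T \<longrightarrow>
        (\<lambda>i. u (r i) z) \<longlonglongrightarrow> v z \<and> (\<lambda>i. Du (r i) z) \<longlonglongrightarrow> Dv z) \<and>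
     weak_supersol p \<Omega> T v Dv"
proof (cases "cyl \<Omega> T = {}")
  \<comment> \<open>An empty cylinder is treated apart: the cover below is enumerated by a map from
    the naturals, which needs a nonempty set of centres.\<close>
  case True
  then show ?thesis using assms(5)[of 0]
    by (intro exI[of _ id] exI[of _ "u 0"] exI[of _ "Du 0"]) (auto simp: strict_mono_id)
next
  case False
  note p = assms(1) and \<Omega> = assms(3) and ws = assms(5)
  \<comment> \<open>Passing to the absolute value gives a nonnegative bound at once.\<close>
  have M: "\<bar>M\<bar> \<ge> 0" by simp
  have uM: "AE z in lebesgue. z \<in> cyl \<Omega> T \<longrightarrow> \<bar>u i z\<bar> \<le> \<bar>M\<bar>" for i
    using assms(6)[of i] by eventually_elim auto
  define D where "D = cyl \<Omega> T"
  have oD: "open D" unfolding D_def cyl_def using \<Omega> by (intro open_Times) auto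
  \<comment> \<open>The factor 4 is the room required by the local lemmas.\<close>
  have "\<forall>z\<in>D. \<exists>\<rho>>0. cball z (4 * \<rho>) \<subseteq> D"
  proof
    fix z assume "z \<in> D"
    then obtain e where "e > 0" "cball z e \<subseteq> D" using oD open_contains_cball by blast
    then show "\<exists>\<rho>>0. cball z (4 * \<rho>) \<subseteq> D" by (intro exI[of _ "e / 4"]) auto
  qed
  then obtain \<rho> where \<rho>: "\<And>z. z \<in> D \<Longrightarrow> \<rho> z > 0 \<and> cball z (4 * \<rho> z) \<subseteq> D" by metis
  \<comment> \<open>Countably many of the balls suffice, so the exceptional null sets can be united
    and the extraction made diagonal.\<close>
  obtain F where F: "F \<subseteq> (\<lambda>z. ball z (\<rho> z)) ` D" "countable F" "\<Union>F = \<Union>((\<lambda>z. ball z (\<rho> z)) ` D)"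
    using Lindelof[of "(\<lambda>z. ball z (\<rho> z)) ` D"] by auto
  have covD: "D \<subseteq> \<Union>F" unfolding F(3) using \<rho> by force
  have "F \<noteq> {}" using covD False by (auto simp: D_def)
  obtain C where C: "C \<subseteq> D" "countable C" "F = (\<lambda>z. ball z (\<rho> z)) ` C"
    using countable_subset_image[of F "\<lambda>z. ball z (\<rho> z)" D] F(1,2) by blast
  have "C \<noteq> {}" using C(3) \<open>F \<noteq> {}\<close> by auto
  define c where "c = from_nat_into C"
  have rc: "range c = C" unfolding c_def using \<open>C \<noteq> {}\<close> C(2) by (rule range_from_nat_into)
  have cD: "c n \<in> D" for n using rc C(1) by blast
  have cov: "D \<subseteq> (\<Union>n. ball (c n) (\<rho> (c n)))" using covD unfolding C(3) rc[symmetric] by blast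
  define P where "P n s \<longleftrightarrow> (AE z in lebesgue. z \<in> ball (c n) (\<rho> (c n)) \<longrightarrow>
     convergent (\<lambda>i. u (s i) z) \<and> convergent (\<lambda>i. Du (s i) z))" for n and s :: "nat \<Rightarrow> nat"
  interpret subseqs P
  proof
    fix n and s :: "nat \<Rightarrow> nat"
    show "\<exists>r'. strict_mono r' \<and> P n (s \<circ> r')"
      unfolding P_def comp_def
      using local_subsequence[where u=u and Du=Du, OF p \<Omega> M ws uM, where \<rho>="\<rho> (c n)" and c="c n" and s=s] \<rho>[OF cD[of n]] unfolding D_def by blast
  qed
  define r where "r = diagseq"
  have r: "strict_mono r" unfolding r_def by (rule subseq_diagseq)
  \<comment> \<open>Convergence passes to subsequences, as the diagonal extraction requires.\<close>
  have stable: "P n (s \<circ> t)" if "strict_mono t" "P n s" for n s t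
    using that(2) unfolding P_def
  proof eventually_elim
    case (elim z)
    then show ?case using convergent_subseq_convergent[OF _ that(1), of "\<lambda>i. u (s i) z"]
        convergent_subseq_convergent[OF _ that(1), of "\<lambda>i. Du (s i) z"] by (auto simp: comp_def)
  qed
  have Pr: "P n r" for n
  proof -
    \<comment> \<open>The diagonal argument gives the property only from index \<open>Suc n\<close>
      on; convergence ignores the initial segment.\<close>
    have "P n (r \<circ> ((+) (Suc n)))" unfolding r_def by (rule diagseq_holds) (rule stable)
    then show ?thesis unfolding P_def
    proof eventually_elim
      case (elim z)
      have "convergent (\<lambda>i. f (i + Suc n)) \<longleftrightarrow> convergent f" for f :: "nat \<Rightarrow> 'b::real_normed_vector"
        by (rule convergent_ignore_initial_segment)
      from this[of "\<lambda>i. u (r i) z"] this[of "\<lambda>i. Du (r i) z"] elim show ?case by (simp add: comp_def add.commute)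
    qed
  qed
  \<comment> \<open>The indicator goes inside the limit because only the restricted functions are
    measurable; \<open>lim\<close> has a value at every point, so the limit function is measurable
    as a whole.\<close>
  define v where "v z = lim (\<lambda>i. indicat_real D z * u (r i) z)" for z
  define Dv where "Dv z = lim (\<lambda>i. indicat_real D z *\<^sub>R Du (r i) z)" for z
  have "AE z in lebesgue. \<forall>n. z \<in> ball (c n) (\<rho> (c n)) \<longrightarrow> convergent (\<lambda>i. u (r i) z) \<and> convergent (\<lambda>i. Du (r i) z)"
    unfolding AE_all_countable using Pr unfolding P_def by simp
  then have conv: "AE z in lebesgue. z \<in> cyl \<Omega> T \<longrightarrow> (\<lambda>i. u (r i) z) \<longlonglongrightarrow> v z \<and> (\<lambda>i. Du (r i) z) \<longlonglongrightarrow> Dv z"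
  proof eventually_elim
    case (elim z)
    show ?case
    proof
      assume "z \<in> cyl \<Omega> T"
      then have z: "z \<in> D" by (simp add: D_def)
      then obtain n where "z \<in> ball (c n) (\<rho> (c n))" using cov by blast
      with elim z show "(\<lambda>i. u (r i) z) \<longlonglongrightarrow> v z \<and> (\<lambda>i. Du (r i) z) \<longlonglongrightarrow> Dv z"
        by (auto simp: v_def Dv_def convergent_LIMSEQ_iff)
    qed
  qed
  have mi: "(\<lambda>z. indicat_real D z * u i z) \<in> borel_measurable lebesgue"
      "(\<lambda>z. indicat_real D z *\<^sub>R Du i z) \<in> borel_measurable lebesgue" for i
    using ws[of i] by (auto simp: weak_supersol_def loc_parabolic_sobolev_def set_borel_measurable_def D_def)
  have mD: "D \<in> sets lebesgue" using oD by auto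
  have mv: "v \<in> borel_measurable lebesgue" "Dv \<in> borel_measurable lebesgue"
    unfolding v_def[abs_def] Dv_def[abs_def] by (rule borel_measurable_lim_metric, rule mi)+
  have mv': "set_borel_measurable lebesgue (cyl \<Omega> T) v" "set_borel_measurable lebesgue (cyl \<Omega> T) Dv"
    unfolding set_borel_measurable_def D_def[symmetric]
    by (intro borel_measurable_scaleR borel_measurable_indicator mD mv)+
  have bd: "\<exists>K\<ge>0. \<forall>i. (\<integral>\<^sup>+ z. ennreal (indicator S z * norm (Du i z) powr p) \<partial>lebesgue) \<le> ennreal K"
    if S: "compact S" "S \<subseteq> cyl \<Omega> T" for S
  proof -
    \<comment> \<open>Finitely many balls of radius \<open>\<rho> (c n)\<close> cover
      \<open>S\<close>; their gradient bounds, known on the concentric double balls, add up.\<close>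
    have cv: "S \<subseteq> (\<Union>n\<in>UNIV. ball (c n) (\<rho> (c n)))" using S(2) cov by (auto simp: D_def)
    obtain N where N: "finite N" "S \<subseteq> (\<Union>n\<in>N. ball (c n) (\<rho> (c n)))"
      by (rule compactE_image[OF S(1) open_ball cv])
    have "\<forall>n. \<exists>K\<ge>0. \<forall>i. (\<integral>\<^sup>+ z. ennreal (indicator (ball (c n) (2 * \<rho> (c n))) z * norm (Du i z) powr p) \<partial>lebesgue) \<le> ennreal K"
    proof
      fix n
      show "\<exists>K\<ge>0. \<forall>i. (\<integral>\<^sup>+ z. ennreal (indicator (ball (c n) (2 * \<rho> (c n))) z * norm (Du i z) powr p) \<partial>lebesgue) \<le> ennreal K"
        using local_gradient_bound[where u=u and Du=Du, OF p \<Omega> M ws uM, where \<rho>="\<rho> (c n)" and c="c n"] \<rho>[OF cD[of n]]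
        unfolding D_def by blast
    qed
    then obtain K where K: "\<And>n. K n \<ge> 0"
      "\<And>n i. (\<integral>\<^sup>+ z. ennreal (indicator (ball (c n) (2 * \<rho> (c n))) z * norm (Du i z) powr p) \<partial>lebesgue) \<le> ennreal (K n)"
      using choice[of "\<lambda>n K. K \<ge> 0 \<and> (\<forall>i. (\<integral>\<^sup>+ z. ennreal (indicator (ball (c n) (2 * \<rho> (c n))) z * norm (Du i z) powr p) \<partial>lebesgue) \<le> ennreal K)"] by blast
    show ?thesis
    proof (intro exI[of _ "\<Sum>n\<in>N. K n"] conjI allI)
      show "0 \<le> (\<Sum>n\<in>N. K n)" by (intro sum_nonneg K)
      fix i
      have meas: "(\<lambda>z. ennreal (indicator (ball (c n) (2 * \<rho> (c n))) z * norm (Du i z) powr p)) \<in> borel_measurable lebesgue" for n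
      proof -
        have b: "ball (c n) (2 * \<rho> (c n)) \<in> sets lebesgue" by auto
        have sub: "ball (c n) (2 * \<rho> (c n)) \<subseteq> D"
          using \<rho>[OF cD[of n]] subset_ball[of "2 * \<rho> (c n)" "4 * \<rho> (c n)" "c n"] ball_subset_cball[of "c n" "4 * \<rho> (c n)"] by auto
        have "(\<lambda>z. ennreal (indicator (ball (c n) (2 * \<rho> (c n))) z * norm (indicat_real D z *\<^sub>R Du i z) powr p)) \<in> borel_measurable lebesgue"
          using mi(2)[of i] b by measurable
        moreover have eq: "indicator (ball (c n) (2 * \<rho> (c n))) z * norm (indicat_real D z *\<^sub>R Du i z) powr p
          = indicator (ball (c n) (2 * \<rho> (c n))) z * norm (Du i z) powr p" for z
          using sub by (auto simp: indicator_def)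
        ultimately show ?thesis unfolding eq by simp
      qed
      have "(\<integral>\<^sup>+ z. ennreal (indicator S z * norm (Du i z) powr p) \<partial>lebesgue)
        \<le> (\<integral>\<^sup>+ z. (\<Sum>n\<in>N. ennreal (indicator (ball (c n) (2 * \<rho> (c n))) z * norm (Du i z) powr p)) \<partial>lebesgue)"
      proof (rule nn_integral_mono)
        fix z
        show "ennreal (indicator S z * norm (Du i z) powr p) \<le> (\<Sum>n\<in>N. ennreal (indicator (ball (c n) (2 * \<rho> (c n))) z * norm (Du i z) powr p))"
        proof (cases "z \<in> S")
          case True
          then obtain n where n: "n \<in> N" "z \<in> ball (c n) (\<rho> (c n))" using N(2) by blast
          then have "z \<in> ball (c n) (2 * \<rho> (c n))" using \<rho>[OF cD[of n]] by auto
          then have "ennreal (indicator S z * norm (Du i z) powr p) = ennreal (indicator (ball (c n) (2 * \<rho> (c n))) z * norm (Du i z) powr p)"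
            using True by simp
          also have "\<dots> \<le> (\<Sum>n\<in>N. ennreal (indicator (ball (c n) (2 * \<rho> (c n))) z * norm (Du i z) powr p))"
            by (rule member_le_sum[OF n(1) _ N(1)]) simp
          finally show ?thesis .
        qed simp
      qed
      also have "\<dots> = (\<Sum>n\<in>N. (\<integral>\<^sup>+ z. ennreal (indicator (ball (c n) (2 * \<rho> (c n))) z * norm (Du i z) powr p) \<partial>lebesgue))"
        by (rule nn_integral_sum) (rule meas)
      also have "\<dots> \<le> (\<Sum>n\<in>N. ennreal (K n))" by (intro sum_mono K)
      also have "\<dots> = ennreal (\<Sum>n\<in>N. K n)" by (rule sum_ennreal) (rule K)
      finally show "(\<integral>\<^sup>+ z. ennreal (indicator S z * norm (Du i z) powr p) \<partial>lebesgue) \<le> ennreal (\<Sum>n\<in>N. K n)" .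
    qed
  qed
  have bd': "\<exists>K\<ge>0. \<forall>i. (\<integral>\<^sup>+ z. ennreal (indicator S z * norm (Du (r i) z) powr p) \<partial>lebesgue) \<le> ennreal K"
    if "compact S" "S \<subseteq> cyl \<Omega> T" for S using bd[OF that] by blast
  have "weak_supersol p \<Omega> T v Dv"
    by (rule weak_supersol_limit[OF p M ws uM conv mv' bd'])
  with r conv show ?thesis by blast
qed

end
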